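(* Let $(\mathcal{D},\mathrm{E})$ be a relative category closed by finite coproducts. Then all possible simplicial descent structures $(\mathbf{s},\mu,\lambda)$ on $(\mathcal{D},\mathrm{E})$ are unique up to unique isomorphism of $Fun(\Delta^{op}\mathcal{D},\mathcal{D})[\mathrm{E}^{-1}]$. More concretely, given two simplicial descent structures $(\mathbf{s},\mu,\lambda)$ and $(\mathbf{s}',\mu',\lambda')$ on $(\mathcal{D},\mathrm{E})$, there exists a unique (as a morphism of $Fun(\Delta^{op}\mathcal{D},\mathcal{D})[\mathrm{E}^{-1}]$) zigzag of natural weak equivalences $\psi:\mathbf{s}\dashrightarrow\mathbf{s}'$ compatible with $(\mu,\lambda)$ and $(\mu',\lambda')$.
   Context: **Compatibility.** $\psi:\mathbf{s}\dashrightarrow\mathbf{s}'$ is compatible with $\lambda,\lambda'$ if $\lambda'\circ\psi_c=\lambda$ in $Fun(\mathcal{D},\mathcal{D})[\mathrm{E}^{-1}]$, and with $\mu,\mu'$ if $\mu'\circ\psi_{\mathrm{D}}=(\psi\ast\psi)\circ\mu$ in $Fun(\Delta^{op}\Delta^{op}\mathcal{D},\mathcal{D})[\mathrm{E}^{-1}]$, where $\psi\ast\psi:\mathbf{s}\mathbf{s}\dashrightarrow\mathbf{s}'\mathbf{s}'$ is induced by $\psi$ on the inner and outer simple functors. **Simplicial descent structures.** $\Delta$ is the category of ordered sets $[n]=\{0,\dots,n\}$ and order preserving maps. $\Delta^{op}\mathcal{D}$ is the category of simplicial objects in $\mathcal{D}$; $c(A)$ is the constant simplicial object on $A$; $\mathrm{D}(Z)_n=Z_{n,n}$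 is the diagonal of a bisimplicial object. If $\mathcal D$ has finite coproducts and $K$ is a simplicial finite set, $(X\boxtimes K)_n=\coprod_{K_n}X_n$; the map $d^0:[0]\to[1]$ induces $d_0^X:X\to X\boxtimes\Delta[1]$, and we write $A$ for $c(A)$. A class $\mathrm{E}$ of morphisms of $\mathcal{D}$ is saturated if it consists of exactly the morphisms that become invertible in $\mathcal{D}[\mathrm{E}^{-1}]$. A relative category $(\mathcal{D},\mathrm{E})$ is a category with a saturated class of morphisms (weak equivalences); it is closed by finite coproducts if $\mathcal{D}$ has an initial object and finite coproducts, and $f\sqcup g\in\mathrm{E}$ whenever $f,g\in\mathrm{E}$. A zigzag of natural weak equivalences $F\dashrightarrow G$ is a finite chain of natural transformations, in either direction, connecting $F$ to $G$, each objectwise in $\mathrm{E}$; $Fun(\mathcal{C},\mathcal{D})[\mathrm{E}^{-1}]$ is the localization at the objectwise weak equivalences, and a zigzag is identified with the isomorphism it defines there. A simplicial descent structure on a relative category $(\mathcal{D},\mathrm{E})$ closed by finite coproducts is a triple $(\mathbf{s},\mu,\lambda)$ with: (S1) $\mathbf{s}:\Delta^{op}\mathcal{D}\to\mathcal{D}$ is a functor (the simple functor) such that $\mathbf{s}(X)\sqcup\mathbf{s}(Y)\to\mathbf{s}(X\sqcup Y)$ is in $\mathrm{E}$ for all $X,Y$. (S2) $\mu:\mathbf{s}\circ\mathrm{D}\dashrightarrow\mathbf{s}\circ\mathbf{s}$ is a zigzag of natural weak equivalences, where $\mathbf{s}\mathbf{s}(Z)=\mathbf{s}(n\mapsto\mathbf{s}(m\mapsto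 Z_{n,m}))$. (S3) $\lambda:\mathbf{s}\circ c\dashrightarrow 1_{\mathcal{D}}$ is a zigzag of natural weak equivalences compatible with $\mu$: with $(X\times\Delta)_{n,m}=X_n$, $(\Delta\times X)_{n,m}=X_m$, the composites $\mathbf{s}(X)\xrightarrow{\mu_{\Delta\times X}}\mathbf{s}c\mathbf{s}(X)\xrightarrow{\lambda_{\mathbf{s}(X)}}\mathbf{s}(X)$ and $\mathbf{s}(X)\xrightarrow{\mu_{X\times\Delta}}\mathbf{s}(n\mapsto\mathbf{s}c(X_n))\xrightarrow{\mathbf{s}(\lambda_X)}\mathbf{s}(X)$ are the identity in $Fun(\Delta^{op}\mathcal{D},\mathcal{D})[\mathrm{E}^{-1}]$. (S4) If $f:X\to Y$ in $\Delta^{op}\mathcal{D}$ has $f_n\in\mathrm{E}$ for all $n$, then $\mathbf{s}(f)\in\mathrm{E}$. (S5) $\mathbf{s}(d_0^A:A\to A\boxtimes\Delta[1])\in\mathrm{E}$ for each object $A$ of $\mathcal{D}$. *)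

theory Defs
  imports "HOL-Library.FuncSet"
begin

section \<open>Categories, functors, natural transformations\<close>

text \<open>\<open>cmp C g f\<close> is the composite written \<open>g \<circ> f\<close>; its value is irrelevant unless \<open>cd C f = dm C g\<close>.\<close>

record ('o, 'm) cat =
  Ob :: "'o set"
  Ar :: "'m set"
  dm :: "'m \<Rightarrow> 'o"
  cd :: "'m \<Rightarrow> 'o"
  idn :: "'o \<Rightarrow> 'm"
  cmp :: "'m \<Rightarrow> 'm \<Rightarrow> 'm"

definition hom :: "('o, 'm) cat \<Rightarrow> 'o \<Rightarrow> 'o \<Rightarrow> 'm set" where
  "hom C a b = {f \<in> Ar C. dm C f = a \<and> cd C f = b}"

locale category =
  fixes C :: "('o, 'm) cat"
  assumes dm_closed: "f \<in> Ar C \<Longrightarrow> dm C f \<in> Ob C"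
    and cd_closed: "f \<in> Ar C \<Longrightarrow> cd C f \<in> Ob C"
    and idn_hom: "a \<in> Ob C \<Longrightarrow> idn C a \<in> hom C a a"
    and cmp_hom: "f \<in> hom C a b \<Longrightarrow> g \<in> hom C b c \<Longrightarrow> cmp C g f \<in> hom C a c"
    and cmp_idn_right: "f \<in> hom C a b \<Longrightarrow> cmp C f (idn C a) = f"
    and cmp_idn_left: "f \<in> hom C a b \<Longrightarrow> cmp C (idn C b) f = f"
    and cmp_assoc: "f \<in> hom C a b \<Longrightarrow> g \<in> hom C b c \<Longrightarrow> h \<in> hom C c d \<Longrightarrow>
      cmp C h (cmp C g f) = cmp C (cmp C h g) f"

definition is_iso :: "('o, 'm) cat \<Rightarrow> 'm \<Rightarrow> bool" where
  "is_iso C f \<longleftrightarrow> f \<in> Ar C \<and>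
    (\<exists>g \<in> hom C (cd C f) (dm C f).
      cmp C g f = idn C (dm C f) \<and> cmp C f g = idn C (cd C f))"

definition op_cat :: "('o, 'm) cat \<Rightarrow> ('o, 'm) cat" where
  "op_cat C = \<lparr>Ob = Ob C, Ar = Ar C, dm = cd C, cd = dm C, idn = idn C,
    cmp = (\<lambda>g f. cmp C f g)\<rparr>"

text \<open>Functors and natural transformations are required to be \<open>undefined\<close> outside the objects
  and arrows of their domain, so that HOL equality is the usual equality of functors and of natural
  transformations.\<close>

datatype ('a, 'f, 'o, 'm) func = Func (fob: "'a \<Rightarrow> 'o") (far: "'f \<Rightarrow> 'm")

datatype ('a, 'f, 'o, 'm) nt =
  NT (src: "('a, 'f, 'o, 'm) func") (tgt: "('a, 'f, 'o, 'm) func") (cpt: "'a \<Rightarrow> 'm")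

definition is_functor ::
  "('a, 'f) cat \<Rightarrow> ('o, 'm) cat \<Rightarrow> ('a, 'f, 'o, 'm) func \<Rightarrow> bool" where
  "is_functor A B F \<longleftrightarrow>
    fob F \<in> Ob A \<rightarrow>\<^sub>E Ob B \<and> far F \<in> Ar A \<rightarrow>\<^sub>E Ar B \<and>
    (\<forall>f \<in> Ar A. far F f \<in> hom B (fob F (dm A f)) (fob F (cd A f))) \<and>
    (\<forall>a \<in> Ob A. far F (idn A a) = idn B (fob F a)) \<and>
    (\<forall>f \<in> Ar A. \<forall>g \<in> Ar A. cd A f = dm A g \<longrightarrow>
      far F (cmp A g f) = cmp B (far F g) (far F f))"

definition is_nat_trans ::
  "('a, 'f) cat \<Rightarrow> ('o, 'm) cat \<Rightarrow> ('a, 'f, 'o, 'm) nt \<Rightarrow> bool" where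
  "is_nat_trans A B \<alpha> \<longleftrightarrow>
    is_functor A B (src \<alpha>) \<and> is_functor A B (tgt \<alpha>) \<and>
    cpt \<alpha> \<in> extensional (Ob A) \<and>
    (\<forall>a \<in> Ob A. cpt \<alpha> a \<in> hom B (fob (src \<alpha>) a) (fob (tgt \<alpha>) a)) \<and>
    (\<forall>f \<in> Ar A. cmp B (cpt \<alpha> (cd A f)) (far (src \<alpha>) f)
      = cmp B (far (tgt \<alpha>) f) (cpt \<alpha> (dm A f)))"

definition fun_cat ::
  "('a, 'f) cat \<Rightarrow> ('o, 'm) cat \<Rightarrow> (('a, 'f, 'o, 'm) func, ('a, 'f, 'o, 'm) nt) cat" where
  "fun_cat A B = \<lparr>Ob = {F. is_functor A B F}, Ar = {\<alpha>. is_nat_trans A B \<alpha>},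
    dm = src, cd = tgt,
    idn = (\<lambda>F. NT F F (\<lambda>a\<in>Ob A. idn B (fob F a))),
    cmp = (\<lambda>\<beta> \<alpha>. NT (src \<alpha>) (tgt \<beta>) (\<lambda>a\<in>Ob A. cmp B (cpt \<beta> a) (cpt \<alpha> a)))\<rparr>"

text \<open>In the following, the leading category argument is the domain of the resulting functor or
  natural transformation: \<open>id_fun A = 1\<^sub>A\<close>, \<open>fun_comp A G F = G \<circ> F\<close>, and the whiskerings are
  \<open>whisk_left A G \<alpha> = G \<alpha>\<close> and \<open>whisk_right A \<alpha> F = \<alpha>\<^sub>F\<close>.\<close>

definition id_fun :: "('o, 'm) cat \<Rightarrow> ('o, 'm, 'o, 'm) func" where
  "id_fun A = Func (\<lambda>a\<in>Ob A. a) (\<lambda>f\<in>Ar A. f)"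

definition fun_comp :: "('a, 'f) cat \<Rightarrow> ('b, 'g, 'o, 'm) func \<Rightarrow> ('a, 'f, 'b, 'g) func
    \<Rightarrow> ('a, 'f, 'o, 'm) func" where
  "fun_comp A G F = Func (\<lambda>a\<in>Ob A. fob G (fob F a)) (\<lambda>f\<in>Ar A. far G (far F f))"

definition whisk_left :: "('a, 'f) cat \<Rightarrow> ('b, 'g, 'o, 'm) func \<Rightarrow> ('a, 'f, 'b, 'g) nt
    \<Rightarrow> ('a, 'f, 'o, 'm) nt" where
  "whisk_left A G \<alpha> =
    NT (fun_comp A G (src \<alpha>)) (fun_comp A G (tgt \<alpha>)) (\<lambda>a\<in>Ob A. far G (cpt \<alpha> a))"

definition whisk_right :: "('a, 'f) cat \<Rightarrow> ('b, 'g, 'o, 'm) nt \<Rightarrow> ('a, 'f, 'b, 'g) func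
    \<Rightarrow> ('a, 'f, 'o, 'm) nt" where
  "whisk_right A \<alpha> F =
    NT (fun_comp A (src \<alpha>) F) (fun_comp A (tgt \<alpha>) F) (\<lambda>a\<in>Ob A. cpt \<alpha> (fob F a))"

text \<open>\<open>post J A F : Fun(J,A) \<rightarrow> Fun(J,B)\<close> is composition with \<open>F : A \<rightarrow> B\<close>, and \<open>post_nt J A \<alpha>\<close>
  is the transformation \<open>post J A F \<rightarrow> post J A G\<close> induced by \<open>\<alpha> : F \<rightarrow> G\<close>.\<close>

definition post :: "('j, 'u) cat \<Rightarrow> ('a, 'f) cat \<Rightarrow> ('a, 'f, 'o, 'm) func
    \<Rightarrow> (('j, 'u, 'a, 'f) func, ('j, 'u, 'a, 'f) nt,
        ('j, 'u, 'o, 'm) func, ('j, 'u, 'o, 'm) nt) func" where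
  "post J A F = Func (\<lambda>X\<in>Ob (fun_cat J A). fun_comp J F X) (\<lambda>\<phi>\<in>Ar (fun_cat J A). whisk_left J F \<phi>)"

definition post_nt :: "('j, 'u) cat \<Rightarrow> ('a, 'f) cat \<Rightarrow> ('a, 'f, 'o, 'm) nt
    \<Rightarrow> (('j, 'u, 'a, 'f) func, ('j, 'u, 'a, 'f) nt,
        ('j, 'u, 'o, 'm) func, ('j, 'u, 'o, 'm) nt) nt" where
  "post_nt J A \<alpha> = NT (post J A (src \<alpha>)) (post J A (tgt \<alpha>))
    (\<lambda>X\<in>Ob (fun_cat J A). whisk_right J \<alpha> X)"

definition const_fun :: "('j, 'u) cat \<Rightarrow> ('o, 'm) cat \<Rightarrow> 'o \<Rightarrow> ('j, 'u, 'o, 'm) func" where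
  "const_fun J D A = Func (\<lambda>j\<in>Ob J. A) (\<lambda>u\<in>Ar J. idn D A)"

definition diag_fun :: "('j, 'u) cat \<Rightarrow> ('o, 'm) cat
    \<Rightarrow> ('o, 'm, ('j, 'u, 'o, 'm) func, ('j, 'u, 'o, 'm) nt) func" where
  "diag_fun J D = Func (\<lambda>A\<in>Ob D. const_fun J D A)
    (\<lambda>f\<in>Ar D. NT (const_fun J D (dm D f)) (const_fun J D (cd D f)) (\<lambda>j\<in>Ob J. f))"


section \<open>Coproducts\<close>

definition is_coproduct ::
  "('o, 'm) cat \<Rightarrow> 'i set \<Rightarrow> ('i \<Rightarrow> 'o) \<Rightarrow> 'o \<Rightarrow> ('i \<Rightarrow> 'm) \<Rightarrow> bool" where
  "is_coproduct C I A P \<iota> \<longleftrightarrow>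
    P \<in> Ob C \<and> (\<forall>i\<in>I. \<iota> i \<in> hom C (A i) P) \<and>
    (\<forall>Q \<in> Ob C. \<forall>g. (\<forall>i\<in>I. g i \<in> hom C (A i) Q) \<longrightarrow>
      (\<exists>!h. h \<in> hom C P Q \<and> (\<forall>i\<in>I. cmp C h (\<iota> i) = g i)))"

abbreviation is_coproduct2 ::
  "('o, 'm) cat \<Rightarrow> 'o \<Rightarrow> 'o \<Rightarrow> 'o \<Rightarrow> 'm \<Rightarrow> 'm \<Rightarrow> bool" where
  "is_coproduct2 C A B P i j \<equiv> is_coproduct C (UNIV :: bool set) (case_bool A B) P (case_bool i j)"

text \<open>The case \<open>n = 0\<close> is an initial object.\<close>

definition has_finite_coproducts :: "('o, 'm) cat \<Rightarrow> bool" where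
  "has_finite_coproducts C \<longleftrightarrow>
    (\<forall>(n::nat) A. (\<forall>i<n. A i \<in> Ob C) \<longrightarrow> (\<exists>P \<iota>. is_coproduct C {..<n} A P \<iota>))"


section \<open>Localization\<close>

text \<open>The localization \<open>C[W\<^sup>-\<^sup>1]\<close> of Gabriel and Zisman. A path from \<open>a\<close> to \<open>b\<close> is a list of steps,
  read from left to right: \<open>Fwd f\<close> runs along an arrow \<open>f\<close>, \<open>Bwd w\<close> runs against an arrow
  \<open>w \<in> W\<close>.\<close>

datatype 'm step = Fwd 'm | Bwd 'm

fun is_path :: "('o, 'm) cat \<Rightarrow> 'm set \<Rightarrow> 'o \<Rightarrow> 'm step list \<Rightarrow> 'o \<Rightarrow> bool" where
  "is_path C W a [] b \<longleftrightarrow> a \<in> Ob C \<and> a = b"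
| "is_path C W a (Fwd f # p) b \<longleftrightarrow> f \<in> Ar C \<and> dm C f = a \<and> is_path C W (cd C f) p b"
| "is_path C W a (Bwd w # p) b \<longleftrightarrow> w \<in> Ar C \<and> w \<in> W \<and> cd C w = a \<and> is_path C W (dm C w) p b"

inductive loc_eq ::
    "('o, 'm) cat \<Rightarrow> 'm set \<Rightarrow> 'o \<Rightarrow> 'o \<Rightarrow> 'm step list \<Rightarrow> 'm step list \<Rightarrow> bool"
  for C :: "('o, 'm) cat" and W :: "'m set" where
  refl: "is_path C W a p b \<Longrightarrow> loc_eq C W a b p p"
| sym: "loc_eq C W a b p q \<Longrightarrow> loc_eq C W a b q p"
| trans: "loc_eq C W a b p q \<Longrightarrow> loc_eq C W a b q r \<Longrightarrow> loc_eq C W a b p r"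
| append: "loc_eq C W a b p q \<Longrightarrow> loc_eq C W b c r t \<Longrightarrow> loc_eq C W a c (p @ r) (q @ t)"
| idn: "a \<in> Ob C \<Longrightarrow> loc_eq C W a a [Fwd (idn C a)] []"
| cmp: "f \<in> hom C a b \<Longrightarrow> g \<in> hom C b c \<Longrightarrow> loc_eq C W a c [Fwd f, Fwd g] [Fwd (cmp C g f)]"
| inv_right: "w \<in> hom C a b \<Longrightarrow> w \<in> W \<Longrightarrow> loc_eq C W a a [Fwd w, Bwd w] []"
| inv_left: "w \<in> hom C a b \<Longrightarrow> w \<in> W \<Longrightarrow> loc_eq C W b b [Bwd w, Fwd w] []"

definition loc_mor ::
  "('o, 'm) cat \<Rightarrow> 'm set \<Rightarrow> 'o \<Rightarrow> 'o \<Rightarrow> 'm step list \<Rightarrow> 'o \<times> 'o \<times> 'm step list set" where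
  "loc_mor C W a b p = (a, b, {q. loc_eq C W a b p q})"

definition localization ::
  "('o, 'm) cat \<Rightarrow> 'm set \<Rightarrow> ('o, 'o \<times> 'o \<times> 'm step list set) cat" where
  "localization C W = \<lparr>Ob = Ob C,
    Ar = {loc_mor C W a b p | a b p. is_path C W a p b},
    dm = fst, cd = (\<lambda>f. fst (snd f)),
    idn = (\<lambda>a. loc_mor C W a a []),
    cmp = (\<lambda>(_, c, Q) (a, _, P). (a, c, {r. \<exists>p\<in>P. \<exists>q\<in>Q. loc_eq C W a c (p @ q) r}))\<rparr>"

definition is_zigzag :: "('o, 'm) cat \<Rightarrow> 'm set \<Rightarrow> 'o \<Rightarrow> 'm step list \<Rightarrow> 'o \<Rightarrow> bool" where
  "is_zigzag C W a p b \<longleftrightarrow> is_path C W a p b \<and> (\<forall>f. Fwd f \<in> set p \<longrightarrow> f \<in> W)"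

fun inv_step :: "'m step \<Rightarrow> 'm step" where
  "inv_step (Fwd f) = Bwd f" | "inv_step (Bwd f) = Fwd f"

lemma loc_mor_eq: "loc_eq C W a b p q \<Longrightarrow> loc_mor C W a b p = loc_mor C W a b q"
  by (auto simp: loc_mor_def intro: loc_eq.trans loc_eq.sym)

lemma cmp_loc_mor:
  assumes "is_path C W a p b" "is_path C W b q c"
  shows "cmp (localization C W) (loc_mor C W b c q) (loc_mor C W a b p) = loc_mor C W a c (p @ q)"
proof -
  have "(\<exists>p'. loc_eq C W a b p p' \<and> (\<exists>q'. loc_eq C W b c q q' \<and> loc_eq C W a c (p' @ q') r))
      \<longleftrightarrow> loc_eq C W a c (p @ q) r" for r
    using assms by (meson loc_eq.append loc_eq.refl loc_eq.trans)
  then show ?thesis by (simp add: localization_def loc_mor_def)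
qed

text \<open>A zigzag is identified with the isomorphism of the localization that it defines.\<close>

lemma (in category) zigzag_iso:
  assumes "is_zigzag C W a p b"
  shows "is_iso (localization C W) (loc_mor C W a b p)"
proof -
  let ?L = "localization C W"
  have "\<exists>q. is_path C W b q a \<and> loc_eq C W a a (p @ q) [] \<and> loc_eq C W b b (q @ p) []"
    using assms
  proof (induction p arbitrary: a)
    case Nil
    then show ?case by (auto simp: is_zigzag_def intro!: exI[of _ "[]"] loc_eq.refl)
  next
    case (Cons x p)
    obtain c where x: "is_path C W a [x] c" "is_path C W c [inv_step x] a"
        "loc_eq C W a a [x, inv_step x] []" "loc_eq C W c c [inv_step x, x] []"
        and p: "is_zigzag C W c p b"
    proof (cases x)
      case (Fwd f)
      then show ?thesis using Cons.prems dm_closed cd_closed that[of "cd C f"]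
          loc_eq.inv_right[of f C a "cd C f" W] loc_eq.inv_left[of f C a "cd C f" W]
        by (auto simp: is_zigzag_def hom_def)
    next
      case (Bwd f)
      then show ?thesis using Cons.prems dm_closed cd_closed that[of "dm C f"]
          loc_eq.inv_right[of f C "dm C f" a W] loc_eq.inv_left[of f C "dm C f" a W]
        by (auto simp: is_zigzag_def hom_def)
    qed
    from Cons.IH[OF p] obtain q where q: "is_path C W b q c" "loc_eq C W c c (p @ q) []"
        "loc_eq C W b b (q @ p) []" by blast
    have path_app: "is_path C W u (r @ t) w"
      if "is_path C W u r v" "is_path C W v t w" for u v w r t
      using that by (induction C W u r v rule: is_path.induct) auto
    have "loc_eq C W a a ([x] @ (p @ q) @ [inv_step x]) ([x] @ [] @ [inv_step x])"
      by (intro loc_eq.append[where b = c] q loc_eq.refl x)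
    moreover have "loc_eq C W b b (q @ [inv_step x, x] @ p) (q @ [] @ p)"
      using p by (intro loc_eq.append[where b = c] q loc_eq.refl x) (simp add: is_zigzag_def)
    ultimately show ?case using q x path_app[OF q(1) x(2)]
      by (intro exI[of _ "q @ [inv_step x]"]) (auto intro: loc_eq.trans)
  qed
  then obtain q where q: "is_path C W b q a" "loc_eq C W a a (p @ q) []" "loc_eq C W b b (q @ p) []"
    by blast
  have p: "is_path C W a p b" using assms by (simp add: is_zigzag_def)
  have "cmp ?L (loc_mor C W b a q) (loc_mor C W a b p) = idn ?L a"
       "cmp ?L (loc_mor C W a b p) (loc_mor C W b a q) = idn ?L b"
    using cmp_loc_mor[OF p q(1)] cmp_loc_mor[OF q(1) p] loc_mor_eq[OF q(2)] loc_mor_eq[OF q(3)]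
    by (simp_all add: localization_def)
  moreover have "loc_mor C W b a q \<in> hom ?L b a" "loc_mor C W a b p \<in> hom ?L a b"
    using p q by (auto simp: localization_def hom_def) (auto simp: loc_mor_def)
  ultimately show ?thesis
    unfolding is_iso_def by (intro conjI bexI[of _ "loc_mor C W b a q"]) (simp_all add: hom_def)
qed

definition saturated :: "('o, 'm) cat \<Rightarrow> 'm set \<Rightarrow> bool" where
  "saturated C W \<longleftrightarrow>
    W = {f \<in> Ar C. is_iso (localization C W) (loc_mor C W (dm C f) (cd C f) [Fwd f])}"

text \<open>The image of a zigzag under a map of arrows; whiskered zigzags are of this form.\<close>

abbreviation map_zigzag :: "('m \<Rightarrow> 'n) \<Rightarrow> 'm step list \<Rightarrow> 'n step list" where
  "map_zigzag h \<equiv> map (map_step h)"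

definition objectwise ::
  "('a, 'f) cat \<Rightarrow> ('o, 'm) cat \<Rightarrow> 'm set \<Rightarrow> ('a, 'f, 'o, 'm) nt set" where
  "objectwise A D E = {\<alpha> \<in> Ar (fun_cat A D). \<forall>a \<in> Ob A. cpt \<alpha> a \<in> E}"

abbreviation nat_zigzag :: "('a, 'f) cat \<Rightarrow> ('o, 'm) cat \<Rightarrow> 'm set \<Rightarrow> ('a, 'f, 'o, 'm) func
    \<Rightarrow> ('a, 'f, 'o, 'm) nt step list \<Rightarrow> ('a, 'f, 'o, 'm) func \<Rightarrow> bool" where
  "nat_zigzag A D E F p G \<equiv> is_zigzag (fun_cat A D) (objectwise A D E) F p G"

abbreviation nat_eq :: "('a, 'f) cat \<Rightarrow> ('o, 'm) cat \<Rightarrow> 'm set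
    \<Rightarrow> ('a, 'f, 'o, 'm) func \<Rightarrow> ('a, 'f, 'o, 'm) func
    \<Rightarrow> ('a, 'f, 'o, 'm) nt step list \<Rightarrow> ('a, 'f, 'o, 'm) nt step list \<Rightarrow> bool" where
  "nat_eq A D E F G p q \<equiv> loc_eq (fun_cat A D) (objectwise A D E) F G p q"

abbreviation nat_mor :: "('a, 'f) cat \<Rightarrow> ('o, 'm) cat \<Rightarrow> 'm set
    \<Rightarrow> ('a, 'f, 'o, 'm) func \<Rightarrow> ('a, 'f, 'o, 'm) func \<Rightarrow> ('a, 'f, 'o, 'm) nt step list
    \<Rightarrow> ('a, 'f, 'o, 'm) func \<times> ('a, 'f, 'o, 'm) func \<times> ('a, 'f, 'o, 'm) nt step list set" where
  "nat_mor A D E F G p \<equiv> loc_mor (fun_cat A D) (objectwise A D E) F G p"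


section \<open>Relative categories\<close>

locale relative_category = category D
  for D :: "('o, 'm) cat" +
  fixes E :: "'m set"
  assumes saturated: "saturated D E"

locale relative_category_coprod = relative_category D E
  for D :: "('o, 'm) cat" and E :: "'m set" +
  assumes finite_coproducts: "has_finite_coproducts D"
    and coprod_closed: "\<lbrakk>f \<in> E; g \<in> E;
        is_coproduct2 D (dm D f) (dm D g) P i j;
        is_coproduct2 D (cd D f) (cd D g) P' i' j';
        h \<in> hom D P P'; cmp D h i = cmp D i' f; cmp D h j = cmp D j' g\<rbrakk> \<Longrightarrow> h \<in> E"


section \<open>Simplicial objects\<close>

text \<open>The object \<open>n\<close> of \<open>delta_cat\<close> stands for \<open>[n] = {0, \<dots>, n}\<close>. Arrows of \<open>delta_cat\<close> and
  \<open>finset_cat\<close> carry their domain and codomain.\<close>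

type_synonym dmor = "nat \<times> nat \<times> (nat \<Rightarrow> nat)"

definition delta_cat :: "(nat, dmor) cat" where
  "delta_cat = \<lparr>Ob = UNIV,
    Ar = {(n, m, f). f \<in> {..n} \<rightarrow>\<^sub>E {..m} \<and> mono_on {..n} f},
    dm = fst, cd = (\<lambda>u. fst (snd u)),
    idn = (\<lambda>n. (n, n, \<lambda>i\<in>{..n}. i)),
    cmp = (\<lambda>(_, k, g) (n, _, f). (n, k, compose {..n} g f))\<rparr>"

definition finset_cat :: "('k set, 'k set \<times> 'k set \<times> ('k \<Rightarrow> 'k)) cat" where
  "finset_cat = \<lparr>Ob = {S. finite S},
    Ar = {(S, T, f). finite S \<and> finite T \<and> f \<in> S \<rightarrow>\<^sub>E T},
    dm = fst, cd = (\<lambda>u. fst (snd u)),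
    idn = (\<lambda>S. (S, S, \<lambda>x\<in>S. x)),
    cmp = (\<lambda>(_, U, g) (S, _, f). (S, U, compose S g f))\<rparr>"

type_synonym ('o, 'm) sob = "(nat, dmor, 'o, 'm) func"
type_synonym ('o, 'm) sar = "(nat, dmor, 'o, 'm) nt"
type_synonym ('o, 'm) ssob = "(('o, 'm) sob, ('o, 'm) sar) sob"
type_synonym ('o, 'm) ssar = "(('o, 'm) sob, ('o, 'm) sar) sar"
type_synonym 'k sfinset = "('k set, 'k set \<times> 'k set \<times> ('k \<Rightarrow> 'k)) sob"

abbreviation delta_op :: "(nat, dmor) cat" where
  "delta_op \<equiv> op_cat delta_cat"

abbreviation simp_cat :: "('o, 'm) cat \<Rightarrow> (('o, 'm) sob, ('o, 'm) sar) cat" where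
  "simp_cat D \<equiv> fun_cat delta_op D"

text \<open>A bisimplicial object \<open>Z\<close> is a simplicial object of simplicial objects:
  \<open>Z\<^sub>n\<^sub>,\<^sub>m = fob (fob Z n) m\<close>.\<close>

abbreviation bisimp_cat :: "('o, 'm) cat \<Rightarrow> (('o, 'm) ssob, ('o, 'm) ssar) cat" where
  "bisimp_cat D \<equiv> simp_cat (simp_cat D)"

abbreviation const_s :: "('o, 'm) cat \<Rightarrow> ('o, 'm, ('o, 'm) sob, ('o, 'm) sar) func" where
  "const_s D \<equiv> diag_fun delta_op D"

definition diagonal ::
  "('o, 'm) cat \<Rightarrow> (('o, 'm) ssob, ('o, 'm) ssar, ('o, 'm) sob, ('o, 'm) sar) func" where
  "diagonal D =
    (let dob = (\<lambda>Z. Func (\<lambda>n\<in>Ob delta_op. fob (fob Z n) n)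
           (\<lambda>u\<in>Ar delta_op.
              cmp D (cpt (far Z u) (cd delta_op u)) (far (fob Z (dm delta_op u)) u)))
     in Func (\<lambda>Z\<in>Ob (bisimp_cat D). dob Z)
          (\<lambda>\<phi>\<in>Ar (bisimp_cat D).
             NT (dob (src \<phi>)) (dob (tgt \<phi>)) (\<lambda>n\<in>Ob delta_op. cpt (cpt \<phi> n) n)))"

definition std_simplex :: "nat \<Rightarrow> dmor sfinset" where
  "std_simplex p = Func (\<lambda>n\<in>Ob delta_op. hom delta_cat n p)
    (\<lambda>u\<in>Ar delta_op. (hom delta_cat (cd delta_cat u) p, hom delta_cat (dm delta_cat u) p,
       \<lambda>k\<in>hom delta_cat (cd delta_cat u) p. cmp delta_cat k u))"

text \<open>\<open>T\<close> together with the coprojections \<open>\<iota> n k : X\<^sub>n \<rightarrow> T\<^sub>n\<close>, \<open>k \<in> K\<^sub>n\<close>, is a choice of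
  \<open>X \<boxtimes> K\<close>. An arrow \<open>u : [m] \<rightarrow> [n]\<close> acts on the summand of index \<open>k\<close> by \<open>X(u)\<close>, with values in
  the summand of index \<open>K(u)(k)\<close>.\<close>

definition is_box :: "('o, 'm) cat \<Rightarrow> ('o, 'm) sob \<Rightarrow> 'k sfinset
    \<Rightarrow> ('o, 'm) sob \<Rightarrow> (nat \<Rightarrow> 'k \<Rightarrow> 'm) \<Rightarrow> bool" where
  "is_box D X K T \<iota> \<longleftrightarrow> T \<in> Ob (simp_cat D) \<and>
    (\<forall>n. is_coproduct D (fob K n) (\<lambda>_. fob X n) (fob T n) (\<iota> n)) \<and>
    (\<forall>u \<in> Ar delta_cat. \<forall>k \<in> fob K (cd delta_cat u).
      cmp D (far T u) (\<iota> (cd delta_cat u) k)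
        = cmp D (\<iota> (dm delta_cat u) (snd (snd (far K u)) k)) (far X u))"

text \<open>The map \<open>d\<^sub>0\<^sup>X : X \<cong> X \<boxtimes> \<Delta>[0] \<rightarrow> X \<boxtimes> \<Delta>[1]\<close> induced by the coface \<open>d\<^sup>0 : [0] \<rightarrow> [1]\<close>, which
  omits \<open>0\<close>: in degree \<open>n\<close> it is the coprojection indexed by \<open>[n] \<rightarrow> [0] \<rightarrow> [1]\<close>.\<close>

definition coface0 :: dmor where
  "coface0 = (0, 1, \<lambda>i\<in>{..0}. 1)"

definition d0_map :: "('o, 'm) sob \<Rightarrow> ('o, 'm) sob \<Rightarrow> (nat \<Rightarrow> dmor \<Rightarrow> 'm) \<Rightarrow> ('o, 'm) sar" where
  "d0_map X T \<iota> =
    NT X T (\<lambda>n\<in>Ob delta_op. \<iota> n (cmp delta_cat coface0 (n, 0, \<lambda>i\<in>{..n}. 0)))"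


section \<open>Simplicial descent structures\<close>

text \<open>Functors from bisimplicial objects: \<open>simple_diag D s\<close> is \<open>s \<circ> D\<close>, and \<open>simple2 D t s\<close>, with
  outer functor \<open>t\<close> and inner functor \<open>s\<close>, sends \<open>Z\<close> to \<open>t(n \<mapsto> s(m \<mapsto> Z\<^sub>n\<^sub>,\<^sub>m))\<close>.\<close>

abbreviation simple_diag where
  "simple_diag D s \<equiv> fun_comp (bisimp_cat D) s (diagonal D)"

abbreviation simple2 where
  "simple2 D t s \<equiv> fun_comp (bisimp_cat D) t (post delta_op (simp_cat D) s)"

text \<open>Since \<open>\<Delta> \<times> X\<close> is the constant simplicial object on \<open>X\<close> and \<open>X \<times> \<Delta>\<close> is
  \<open>n \<mapsto> c(X\<^sub>n)\<close>, the functors \<open>X \<mapsto> \<Delta> \<times> X\<close> and \<open>X \<mapsto> X \<times> \<Delta>\<close> are the functor \<open>c\<close> of the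
  category of simplicial objects and the functor induced by \<open>c\<close>, respectively.\<close>

locale simplicial_descent_structure = relative_category_coprod D E
  for D :: "('o, 'm) cat" and E :: "'m set" +
  fixes s :: "(('o, 'm) sob, ('o, 'm) sar, 'o, 'm) func"
    and mu :: "(('o, 'm) ssob, ('o, 'm) ssar, 'o, 'm) nt step list"
    and lam :: "('o, 'm, 'o, 'm) nt step list"
  assumes S1_functor: "is_functor (simp_cat D) D s"
    and S1_coprod: "\<lbrakk>is_coproduct2 (simp_cat D) X Y P i j;
        is_coproduct2 D (fob s X) (fob s Y) Q a b;
        h \<in> hom D Q (fob s P); cmp D h a = far s i; cmp D h b = far s j\<rbrakk> \<Longrightarrow> h \<in> E"
    and S2: "nat_zigzag (bisimp_cat D) D E (simple_diag D s) mu (simple2 D s s)"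
    and S3: "nat_zigzag D D E (fun_comp D s (const_s D)) lam (id_fun D)"
    and S3_outer: "nat_eq (simp_cat D) D E s s
        (map_zigzag (\<lambda>\<alpha>. whisk_right (simp_cat D) \<alpha> (const_s (simp_cat D))) mu
          @ map_zigzag (\<lambda>\<alpha>. whisk_right (simp_cat D) \<alpha> s) lam)
        []"
    and S3_inner: "nat_eq (simp_cat D) D E s s
        (map_zigzag (\<lambda>\<alpha>. whisk_right (simp_cat D) \<alpha> (post delta_op D (const_s D))) mu
          @ map_zigzag (\<lambda>\<alpha>. whisk_left (simp_cat D) s (post_nt delta_op D \<alpha>)) lam)
        []"
    and S4: "\<lbrakk>f \<in> Ar (simp_cat D); \<And>n. cpt f n \<in> E\<rbrakk> \<Longrightarrow> far s f \<in> E"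
    and S5: "\<lbrakk>A \<in> Ob D; is_box D (const_fun delta_op D A) (std_simplex 1) T \<iota>\<rbrakk>
        \<Longrightarrow> far s (d0_map (const_fun delta_op D A) T \<iota>) \<in> E"

text \<open>\<open>\<psi> * \<psi>\<close> is built as \<open>s s \<dashrightarrow> s' s \<dashrightarrow> s' s'\<close>; by naturality the route through \<open>s s'\<close> gives the
  same morphism of the localization.\<close>

definition star :: "('o, 'm) cat \<Rightarrow> (('o, 'm) sob, ('o, 'm) sar, 'o, 'm) func
    \<Rightarrow> (('o, 'm) sob, ('o, 'm) sar, 'o, 'm) func
    \<Rightarrow> (('o, 'm) sob, ('o, 'm) sar, 'o, 'm) nt step list
    \<Rightarrow> (('o, 'm) ssob, ('o, 'm) ssar, 'o, 'm) nt step list" where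
  "star D s s' \<psi> =
    map_zigzag (\<lambda>\<alpha>. whisk_right (bisimp_cat D) \<alpha> (post delta_op (simp_cat D) s)) \<psi>
    @ map_zigzag (\<lambda>\<alpha>. whisk_left (bisimp_cat D) s' (post_nt delta_op (simp_cat D) \<alpha>)) \<psi>"

definition compatible_lam :: "('o, 'm) cat \<Rightarrow> 'm set
    \<Rightarrow> (('o, 'm) sob, ('o, 'm) sar, 'o, 'm) func \<Rightarrow> ('o, 'm, 'o, 'm) nt step list
    \<Rightarrow> ('o, 'm, 'o, 'm) nt step list
    \<Rightarrow> (('o, 'm) sob, ('o, 'm) sar, 'o, 'm) nt step list \<Rightarrow> bool" where
  "compatible_lam D E s lam lam' \<psi> \<longleftrightarrow>
    nat_eq D D E (fun_comp D s (const_s D)) (id_fun D)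
      (map_zigzag (\<lambda>\<alpha>. whisk_right D \<alpha> (const_s D)) \<psi> @ lam') lam"

definition compatible_mu :: "('o, 'm) cat \<Rightarrow> 'm set
    \<Rightarrow> (('o, 'm) sob, ('o, 'm) sar, 'o, 'm) func
    \<Rightarrow> (('o, 'm) ssob, ('o, 'm) ssar, 'o, 'm) nt step list
    \<Rightarrow> (('o, 'm) sob, ('o, 'm) sar, 'o, 'm) func
    \<Rightarrow> (('o, 'm) ssob, ('o, 'm) ssar, 'o, 'm) nt step list
    \<Rightarrow> (('o, 'm) sob, ('o, 'm) sar, 'o, 'm) nt step list \<Rightarrow> bool" where
  "compatible_mu D E s mu s' mu' \<psi> \<longleftrightarrow>
    nat_eq (bisimp_cat D) D E (simple_diag D s) (simple2 D s' s')
      (map_zigzag (\<lambda>\<alpha>. whisk_right (bisimp_cat D) \<alpha> (diagonal D)) \<psi> @ mu')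
      (mu @ star D s s' \<psi>)"

end

theory Submission
  imports Defs
begin

text \<open>Work in the 2-category of relative categories: a 2-cell \<open>F \<Rightarrow> G\<close> between functors \<open>A \<rightarrow> B\<close> is
  a morphism of \<open>Fun(A,B)[W\<^sup>-\<^sup>1]\<close>. The reason for the theorem is that the simple functor \<open>s\<close> of a
  descent structure is left adjoint, in this 2-category, to the constant functor
  \<open>c : D \<rightarrow> \<Delta>\<^sup>o\<^sup>pD\<close>, with counit \<open>\<lambda>\<close> (lemmas \<open>adj\<close> and \<open>triangle_c\<close>). Two left adjoints of \<open>c\<close> are
  related by exactly one 2-cell compatible with the counits, and it is invertible (\<open>adj_unique\<close>,
  \<open>mate_compatible\<close>, \<open>mate_invertible\<close>). So compatibility with \<open>\<lambda>\<close> alone already determines \<open>\<psi>\<close>.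

  The unit comes from the total decalage \<open>Z\<^sub>n\<^sub>,\<^sub>m = X\<^sub>n\<^sub>+\<^sub>1\<^sub>+\<^sub>m\<close>. The two inclusions of ordinals
  into the join \<open>[n] * [m] = [n+1+m]\<close> give maps \<open>p : Z \<rightarrow> X \<times> \<Delta>\<close> and \<open>q : Z \<rightarrow> \<Delta> \<times> X\<close>. For fixed
  \<open>n\<close> the map \<open>Z\<^sub>n\<^sub>,\<^sub>\<bullet> \<rightarrow> c(X\<^sub>n)\<close> is a simplicial homotopy equivalence, hence inverted by \<open>s\<close>, and
  the unit \<open>\<eta> : X \<rightarrow> c(s X)\<close> is the composite \<open>X \<leftarrow> s(c X\<^sub>n) \<leftarrow> s(Z\<^sub>n\<^sub>,\<^sub>\<bullet>) \<rightarrow> c(s X)\<close> of \<open>\<lambda>\<close>, \<open>s(p)\<close>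
  and \<open>s(q)\<close>. By naturality of \<open>\<mu>\<close> and the two axioms (S3), the composite \<open>\<lambda>\<^sub>s \<circ> s(\<eta>)\<close> becomes
  \<open>s(D q) \<circ> s(D p)\<^sup>-\<^sup>1\<close>, where \<open>D p\<close> and \<open>D q\<close> are the maps \<open>X\<^sub>2\<^sub>n\<^sub>+\<^sub>1 \<rightarrow> X\<^sub>n\<close> restricting to the
  first and the last \<open>n+1\<close> vertices. These are simplicially homotopic, so the triangle identity
  \<open>\<lambda>\<^sub>s \<circ> s(\<eta>) = 1\<close> holds (\<open>triangle_s\<close>). The other triangle identity holds because \<open>p\<close> and \<open>q\<close>
  agree on constant objects.

  That \<open>s\<close> identifies homotopic maps (\<open>s_homotopy\<close>) follows once \<open>s\<close> inverts an end inclusion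
  \<open>X \<rightarrow> X \<boxtimes> \<Delta>[1]\<close> of the cylinder. The cylinder is the diagonal of the bisimplicial object
  \<open>(n,m) \<mapsto> X\<^sub>n \<squnion> \<dots> \<squnion> X\<^sub>n\<close>, with one summand for each \<open>k \<in> \<Delta>[1]\<^sub>m\<close>; by \<open>\<mu>\<close> and (S4) this reduces
  to constant \<open>X\<close>, which is (S5).

  The path defining \<open>\<psi>\<close> has a single forward step which is not visibly a weak equivalence, namely
  the one induced by \<open>q\<close>; since \<open>\<psi>\<close> is invertible and all its other steps are weak equivalences,
  that step is one too, by saturation. Finally both sides of the compatibility with \<open>\<mu>\<close> are
  2-cells into \<open>s's'\<close>, which is left adjoint to the double constant functor, so it suffices to
  compare them on constant bisimplicial objects (\<open>mu_compatible\<close>). There the identity reduces to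
  the second axiom of (S3) and the compatibility with \<open>\<lambda>\<close>.\<close>

section \<open>Functor categories\<close>

lemma hom_iff: "f \<in> hom C a b \<longleftrightarrow> f \<in> Ar C \<and> dm C f = a \<and> cd C f = b"
  by (simp add: hom_def)

context category
begin

lemma idn_props: "a \<in> Ob C \<Longrightarrow> idn C a \<in> Ar C" "a \<in> Ob C \<Longrightarrow> dm C (idn C a) = a"
    "a \<in> Ob C \<Longrightarrow> cd C (idn C a) = a"
  using idn_hom by (auto simp: hom_iff)

lemma cmp_props:
  assumes "f \<in> Ar C" "g \<in> Ar C" "cd C f = dm C g"
  shows "cmp C g f \<in> Ar C" "dm C (cmp C g f) = dm C f" "cd C (cmp C g f) = cd C g"
  using cmp_hom[of f "dm C f" "cd C f" g "cd C g"] assms by (auto simp: hom_iff)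

lemma cmp_assoc':
  assumes "f \<in> Ar C" "g \<in> Ar C" "h \<in> Ar C" "cd C f = dm C g" "cd C g = dm C h"
  shows "cmp C h (cmp C g f) = cmp C (cmp C h g) f"
  using assms by (intro cmp_assoc) (auto simp: hom_iff)

lemma cmp_idn': "f \<in> Ar C \<Longrightarrow> a = dm C f \<Longrightarrow> cmp C f (idn C a) = f"
    "f \<in> Ar C \<Longrightarrow> a = cd C f \<Longrightarrow> cmp C (idn C a) f = f"
  by (auto intro: cmp_idn_right cmp_idn_left simp: hom_iff)

end

lemmas cat_idn = category.idn_props
lemmas cat_cmp = category.cmp_props
lemmas cat_dm = category.dm_closed
lemmas cat_cd = category.cd_closed
lemmas cat_assoc = category.cmp_assoc'
lemmas cat_unit = category.cmp_idn'

lemma op_cat_simps: "Ob (op_cat C) = Ob C" "Ar (op_cat C) = Ar C" "dm (op_cat C) = cd C"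
    "cd (op_cat C) = dm C" "idn (op_cat C) = idn C" "cmp (op_cat C) g f = cmp C f g"
  by (simp_all add: op_cat_def)

lemma category_op: "category C \<Longrightarrow> category (op_cat C)"
  by unfold_locales
    (auto simp: op_cat_simps hom_iff cat_idn cat_cmp cat_dm cat_cd cat_assoc cat_unit)

lemma functor_ob: "is_functor A B F \<Longrightarrow> a \<in> Ob A \<Longrightarrow> fob F a \<in> Ob B"
  by (auto simp: is_functor_def)

lemma functor_ar:
  assumes "is_functor A B F" "f \<in> Ar A"
  shows "far F f \<in> Ar B" "dm B (far F f) = fob F (dm A f)" "cd B (far F f) = fob F (cd A f)"
  using assms by (auto simp: is_functor_def hom_iff)

lemma functor_idn: "is_functor A B F \<Longrightarrow> a \<in> Ob A \<Longrightarrow> far F (idn A a) = idn B (fob F a)"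
  by (auto simp: is_functor_def)

lemma functor_cmp:
  "is_functor A B F \<Longrightarrow> f \<in> Ar A \<Longrightarrow> g \<in> Ar A \<Longrightarrow> cd A f = dm A g \<Longrightarrow>
    far F (cmp A g f) = cmp B (far F g) (far F f)"
  by (auto simp: is_functor_def)

lemmas functor_simps = functor_ob functor_ar functor_idn functor_cmp

lemma is_functorI:
  assumes "category A"
    and "\<And>a. a \<in> Ob A \<Longrightarrow> fo a \<in> Ob B"
    and "\<And>f. f \<in> Ar A \<Longrightarrow> fa f \<in> hom B (fo (dm A f)) (fo (cd A f))"
    and "\<And>a. a \<in> Ob A \<Longrightarrow> fa (idn A a) = idn B (fo a)"
    and "\<And>f g. f \<in> Ar A \<Longrightarrow> g \<in> Ar A \<Longrightarrow> cd A f = dm A g \<Longrightarrow>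
      fa (cmp A g f) = cmp B (fa g) (fa f)"
  shows "is_functor A B (Func (restrict fo (Ob A)) (restrict fa (Ar A)))"
  using assms(2-) unfolding is_functor_def
  by (auto simp: hom_iff cat_idn[OF assms(1)] cat_cmp[OF assms(1)] cat_dm[OF assms(1)]
      cat_cd[OF assms(1)])

text \<open>Functors and transformations take the value \<open>undefined\<close> outside their domain, so they are
  determined by their values on it.\<close>

lemma func_eqI:
  assumes "is_functor A B F" "is_functor A B G"
    and "\<And>a. a \<in> Ob A \<Longrightarrow> fob F a = fob G a" "\<And>f. f \<in> Ar A \<Longrightarrow> far F f = far G f"
  shows "F = G"
proof (rule func.expand)
  have "fob F = fob G"
    by (rule PiE_ext[of _ "Ob A" "\<lambda>_. Ob B"]) (use assms in \<open>auto simp: is_functor_def\<close>)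
  moreover have "far F = far G"
    by (rule PiE_ext[of _ "Ar A" "\<lambda>_. Ar B"]) (use assms in \<open>auto simp: is_functor_def\<close>)
  ultimately show "fob F = fob G \<and> far F = far G" ..
qed

lemma nat_cpt:
  assumes "is_nat_trans A B \<alpha>" "a \<in> Ob A"
  shows "cpt \<alpha> a \<in> Ar B" "dm B (cpt \<alpha> a) = fob (src \<alpha>) a" "cd B (cpt \<alpha> a) = fob (tgt \<alpha>) a"
  using assms by (auto simp: is_nat_trans_def hom_iff)

lemma nat_functors:
  "is_nat_trans A B \<alpha> \<Longrightarrow> is_functor A B (src \<alpha>)" "is_nat_trans A B \<alpha> \<Longrightarrow> is_functor A B (tgt \<alpha>)"
  by (auto simp: is_nat_trans_def)

lemma nat_square:
  "is_nat_trans A B \<alpha> \<Longrightarrow> f \<in> Ar A \<Longrightarrow>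
    cmp B (cpt \<alpha> (cd A f)) (far (src \<alpha>) f) = cmp B (far (tgt \<alpha>) f) (cpt \<alpha> (dm A f))"
  by (auto simp: is_nat_trans_def)

lemma is_nat_transI:
  assumes "is_functor A B F" "is_functor A B G" "category A"
    and "\<And>a. a \<in> Ob A \<Longrightarrow> c a \<in> hom B (fob F a) (fob G a)"
    and "\<And>f. f \<in> Ar A \<Longrightarrow> cmp B (c (cd A f)) (far F f) = cmp B (far G f) (c (dm A f))"
  shows "is_nat_trans A B (NT F G (restrict c (Ob A)))"
  using assms(1,2,4,5) unfolding is_nat_trans_def
  by (simp add: cat_dm[OF assms(3)] cat_cd[OF assms(3)])

lemma nt_eqI:
  assumes "is_nat_trans A B \<alpha>" "is_nat_trans A B \<beta>" "src \<alpha> = src \<beta>" "tgt \<alpha> = tgt \<beta>"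
    and "\<And>a. a \<in> Ob A \<Longrightarrow> cpt \<alpha> a = cpt \<beta> a"
  shows "\<alpha> = \<beta>"
  using assms by (auto simp: is_nat_trans_def intro!: nt.expand extensionalityI[of "cpt \<alpha>"])

lemma fun_cat_simps:
  "Ob (fun_cat A B) = {F. is_functor A B F}" "Ar (fun_cat A B) = {\<alpha>. is_nat_trans A B \<alpha>}"
  by (simp_all add: fun_cat_def)

lemma fun_cat_dc [simp]:
  "dm (fun_cat A B) = src" "cd (fun_cat A B) = tgt"
  "idn (fun_cat A B) F = NT F F (\<lambda>a\<in>Ob A. idn B (fob F a))"
  "cmp (fun_cat A B) \<beta> \<alpha> = NT (src \<alpha>) (tgt \<beta>) (\<lambda>a\<in>Ob A. cmp B (cpt \<beta> a) (cpt \<alpha> a))"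
  by (simp_all add: fun_cat_def)

lemma hom_fun_cat: "\<alpha> \<in> hom (fun_cat A B) F G \<longleftrightarrow> is_nat_trans A B \<alpha> \<and> src \<alpha> = F \<and> tgt \<alpha> = G"
  by (simp add: hom_iff fun_cat_simps)

lemma nat_idn:
  assumes "category A" "category B" "is_functor A B F"
  shows "is_nat_trans A B (NT F F (\<lambda>a\<in>Ob A. idn B (fob F a)))"
  using assms
  by (intro is_nat_transI)
    (auto simp: hom_iff functor_simps cat_idn cat_unit cat_dm cat_cd)

lemma nat_cmp:
  assumes A: "category A" and B: "category B"
    and \<alpha>: "is_nat_trans A B \<alpha>" and \<beta>: "is_nat_trans A B \<beta>" and eq: "tgt \<alpha> = src \<beta>"
  shows "is_nat_trans A B (NT (src \<alpha>) (tgt \<beta>) (\<lambda>a\<in>Ob A. cmp B (cpt \<beta> a) (cpt \<alpha> a)))"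
proof (rule is_nat_transI[OF nat_functors(1)[OF \<alpha>] nat_functors(2)[OF \<beta>] A])
  fix a assume "a \<in> Ob A"
  then show "cmp B (cpt \<beta> a) (cpt \<alpha> a) \<in> hom B (fob (src \<alpha>) a) (fob (tgt \<beta>) a)"
    using nat_cpt[OF \<alpha>] nat_cpt[OF \<beta>] cat_cmp[OF B] eq by (simp add: hom_iff)
next
  fix f assume f: "f \<in> Ar A"
  note d = cat_dm[OF A f] cat_cd[OF A f]
  note 1 = functor_ar[OF nat_functors(1)[OF \<alpha>] f] functor_ar[OF nat_functors(2)[OF \<alpha>] f]
    functor_ar[OF nat_functors(2)[OF \<beta>] f] functor_ar[OF nat_functors(1)[OF \<beta>] f]
    nat_cpt[OF \<alpha>] nat_cpt[OF \<beta>]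
  have "cmp B (cmp B (cpt \<beta> (cd A f)) (cpt \<alpha> (cd A f))) (far (src \<alpha>) f)
    = cmp B (cpt \<beta> (cd A f)) (cmp B (cpt \<alpha> (cd A f)) (far (src \<alpha>) f))"
    using 1 d eq by (simp add: cat_assoc[OF B])
  also have "\<dots> = cmp B (cpt \<beta> (cd A f)) (cmp B (far (tgt \<alpha>) f) (cpt \<alpha> (dm A f)))"
    by (simp add: nat_square[OF \<alpha> f])
  also have "\<dots> = cmp B (cmp B (cpt \<beta> (cd A f)) (far (src \<beta>) f)) (cpt \<alpha> (dm A f))"
    using 1 d eq by (simp add: cat_assoc[OF B])
  also have "\<dots> = cmp B (cmp B (far (tgt \<beta>) f) (cpt \<beta> (dm A f))) (cpt \<alpha> (dm A f))"
    by (simp add: nat_square[OF \<beta> f])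
  also have "\<dots> = cmp B (far (tgt \<beta>) f) (cmp B (cpt \<beta> (dm A f)) (cpt \<alpha> (dm A f)))"
    using 1 d eq by (simp add: cat_assoc[OF B])
  finally show "cmp B (cmp B (cpt \<beta> (cd A f)) (cpt \<alpha> (cd A f))) (far (src \<alpha>) f)
    = cmp B (far (tgt \<beta>) f) (cmp B (cpt \<beta> (dm A f)) (cpt \<alpha> (dm A f)))" .
qed

lemma category_fun_cat:
  assumes A: "category A" and B: "category B"
  shows "category (fun_cat A B)"
proof
  fix F assume "F \<in> Ob (fun_cat A B)"
  then show "idn (fun_cat A B) F \<in> hom (fun_cat A B) F F"
    using nat_idn[OF A B] by (simp add: hom_fun_cat fun_cat_simps)
next
  fix \<alpha> F G \<beta> H
  assume "\<alpha> \<in> hom (fun_cat A B) F G" "\<beta> \<in> hom (fun_cat A B) G H"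
  then show "cmp (fun_cat A B) \<beta> \<alpha> \<in> hom (fun_cat A B) F H"
    using nat_cmp[OF A B] by (auto simp add: hom_fun_cat)
next
  fix \<alpha> F G
  assume h: "\<alpha> \<in> hom (fun_cat A B) F G"
  show "cmp (fun_cat A B) \<alpha> (idn (fun_cat A B) F) = \<alpha>"
    using h nat_cmp[OF A B nat_idn[OF A B]]
    by (intro nt_eqI[of A B]) (auto simp: hom_fun_cat nat_functors nat_cpt cat_unit[OF B])
  show "cmp (fun_cat A B) (idn (fun_cat A B) G) \<alpha> = \<alpha>"
    using h nat_cmp[OF A B _ nat_idn[OF A B]]
    by (intro nt_eqI[of A B]) (auto simp: hom_fun_cat nat_functors nat_cpt cat_unit[OF B])
next
  fix \<alpha> F G \<beta> H \<gamma> K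
  assume "\<alpha> \<in> hom (fun_cat A B) F G" "\<beta> \<in> hom (fun_cat A B) G H" "\<gamma> \<in> hom (fun_cat A B) H K"
  then show "cmp (fun_cat A B) \<gamma> (cmp (fun_cat A B) \<beta> \<alpha>)
    = cmp (fun_cat A B) (cmp (fun_cat A B) \<gamma> \<beta>) \<alpha>"
    by (auto simp: hom_fun_cat nat_cpt cat_assoc[OF B] intro!: restrict_ext)
qed (auto simp: fun_cat_simps nat_functors)

subsection \<open>Composition and whiskering\<close>

lemma fun_comp_simps [simp]:
  "a \<in> Ob A \<Longrightarrow> fob (fun_comp A G F) a = fob G (fob F a)"
  "f \<in> Ar A \<Longrightarrow> far (fun_comp A G F) f = far G (far F f)"
  by (simp_all add: fun_comp_def)

lemma whisk_left_simps [simp]: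
  "src (whisk_left A G \<alpha>) = fun_comp A G (src \<alpha>)" "tgt (whisk_left A G \<alpha>) = fun_comp A G (tgt \<alpha>)"
  "a \<in> Ob A \<Longrightarrow> cpt (whisk_left A G \<alpha>) a = far G (cpt \<alpha> a)"
  by (simp_all add: whisk_left_def)

lemma whisk_right_simps [simp]:
  "src (whisk_right A \<alpha> F) = fun_comp A (src \<alpha>) F" "tgt (whisk_right A \<alpha> F) = fun_comp A (tgt \<alpha>) F"
  "a \<in> Ob A \<Longrightarrow> cpt (whisk_right A \<alpha> F) a = cpt \<alpha> (fob F a)"
  by (simp_all add: whisk_right_def)

lemma functor_fun_comp:
  assumes "category A" "is_functor A B F" "is_functor B C G"
  shows "is_functor A C (fun_comp A G F)"
  unfolding fun_comp_def using assms
  by (intro is_functorI) (auto simp: hom_iff functor_simps)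

lemma id_fun_simps [simp]: "a \<in> Ob A \<Longrightarrow> fob (id_fun A) a = a" "f \<in> Ar A \<Longrightarrow> far (id_fun A) f = f"
  by (simp_all add: id_fun_def)

lemma functor_id: "category A \<Longrightarrow> is_functor A A (id_fun A)"
  unfolding id_fun_def by (intro is_functorI) (auto simp: hom_iff)

lemma fun_comp_id:
  assumes "category A" "category B" "is_functor A B F"
  shows "fun_comp A F (id_fun A) = F" "fun_comp A (id_fun B) F = F"
proof -
  have 1: "is_functor A B (fun_comp A F (id_fun A))" "is_functor A B (fun_comp A (id_fun B) F)"
    using assms functor_fun_comp functor_id by metis+
  show "fun_comp A F (id_fun A) = F"
    by (rule func_eqI[OF 1(1) assms(3)]) simp_all
  show "fun_comp A (id_fun B) F = F"
    by (rule func_eqI[OF 1(2) assms(3)]) (simp_all add: functor_simps[OF assms(3)])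
qed

lemma fun_comp_assoc:
  assumes "is_functor A B F"
  shows "fun_comp A H (fun_comp A G F) = fun_comp A (fun_comp B H G) F"
  using assms by (auto simp: fun_comp_def functor_simps intro!: restrict_ext)

lemma nat_whisk_left:
  assumes "category A" "is_nat_trans A B \<alpha>" "is_functor B C G"
  shows "is_nat_trans A C (whisk_left A G \<alpha>)"
proof -
  note f = nat_functors[OF assms(2)]
  show ?thesis unfolding whisk_left_def
  proof (rule is_nat_transI)
    fix u assume u: "u \<in> Ar A"
    note d = cat_dm[OF assms(1) u] cat_cd[OF assms(1) u]
    show "cmp C (far G (cpt \<alpha> (cd A u))) (far (fun_comp A G (src \<alpha>)) u) =
         cmp C (far (fun_comp A G (tgt \<alpha>)) u) (far G (cpt \<alpha> (dm A u)))"
      using u d assms f nat_square[OF assms(2) u] nat_cpt[OF assms(2)]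
      by (simp add: functor_ar[OF f(1)] functor_ar[OF f(2)] flip: functor_cmp[OF assms(3)])
  qed (use assms f in \<open>auto simp: functor_fun_comp hom_iff functor_ar[OF assms(3)] nat_cpt
        intro: functor_fun_comp\<close>)
qed

lemma nat_whisk_right:
  assumes "category A" "is_nat_trans B C \<alpha>" "is_functor A B F"
  shows "is_nat_trans A C (whisk_right A \<alpha> F)"
  unfolding whisk_right_def
proof (rule is_nat_transI)
  fix u assume u: "u \<in> Ar A"
  note d = cat_dm[OF assms(1) u] cat_cd[OF assms(1) u]
  show "cmp C (cpt \<alpha> (fob F (cd A u))) (far (fun_comp A (src \<alpha>) F) u)
    = cmp C (far (fun_comp A (tgt \<alpha>) F) u) (cpt \<alpha> (fob F (dm A u)))"
    using u nat_square[OF assms(2) functor_ar(1)[OF assms(3) u]] functor_ar[OF assms(3) u] by simp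
qed (use assms nat_functors[OF assms(2)] in
    \<open>auto simp: hom_iff functor_ob nat_cpt intro: functor_fun_comp\<close>)

lemma whisk_right_right:
  assumes "is_functor A B F"
  shows "whisk_right A (whisk_right B \<alpha> G) F = whisk_right A \<alpha> (fun_comp A G F)"
  using assms by (auto simp: whisk_right_def fun_comp_assoc functor_simps intro!: restrict_ext)

lemma whisk_left_right:
  assumes "is_functor A B F"
  shows "whisk_left A G (whisk_right A \<alpha> F) = whisk_right A (whisk_left B G \<alpha>) F"
  using assms
  by (auto simp: whisk_right_def whisk_left_def fun_comp_assoc functor_simps intro!: restrict_ext)

lemma whisk_left_left:
  assumes "is_nat_trans A B \<alpha>"
  shows "whisk_left A H (whisk_left A G \<alpha>) = whisk_left A (fun_comp B H G) \<alpha>"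
  using assms fun_comp_assoc[OF nat_functors(1)[OF assms], of H G]
    fun_comp_assoc[OF nat_functors(2)[OF assms], of H G]
  by (auto simp: whisk_left_def nat_cpt intro!: restrict_ext)

lemma whisk_id:
  assumes "category A" "category B" "is_nat_trans A B \<alpha>"
  shows "whisk_right A \<alpha> (id_fun A) = \<alpha>" "whisk_left A (id_fun B) \<alpha> = \<alpha>"
proof -
  note f = fun_comp_id[OF assms(1,2) nat_functors(1)[OF assms(3)]]
     fun_comp_id[OF assms(1,2) nat_functors(2)[OF assms(3)]]
  show "whisk_right A \<alpha> (id_fun A) = \<alpha>"
    by (rule nt_eqI[OF nat_whisk_right assms(3)]) (use assms functor_id f in auto)
  show "whisk_left A (id_fun B) \<alpha> = \<alpha>"
    by (rule nt_eqI[OF nat_whisk_left assms(3)]) (use assms functor_id f in \<open>auto simp: nat_cpt\<close>)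
qed

lemma whisk_right_idn:
  "is_functor A B F \<Longrightarrow> whisk_right A (idn (fun_cat B C) G) F = idn (fun_cat A C) (fun_comp A G F)"
  by (auto simp: whisk_right_def functor_simps)

lemma whisk_right_cmp:
  "is_functor A B F \<Longrightarrow> whisk_right A (cmp (fun_cat B C) \<beta> \<alpha>) F
    = cmp (fun_cat A C) (whisk_right A \<beta> F) (whisk_right A \<alpha> F)"
  by (auto simp: whisk_right_def functor_simps)

lemma whisk_left_idn:
  "is_functor A B F \<Longrightarrow> is_functor B C G \<Longrightarrow>
   whisk_left A G (idn (fun_cat A B) F) = idn (fun_cat A C) (fun_comp A G F)"
  by (auto simp: whisk_left_def functor_simps)

lemma whisk_left_cmp:
  "is_nat_trans A B \<alpha> \<Longrightarrow> is_nat_trans A B \<beta> \<Longrightarrow> tgt \<alpha> = src \<beta> \<Longrightarrow> is_functor B C G \<Longrightarrow>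
   whisk_left A G (cmp (fun_cat A B) \<beta> \<alpha>) = cmp (fun_cat A C) (whisk_left A G \<beta>) (whisk_left A G \<alpha>)"
  by (auto simp: whisk_left_def functor_simps nat_cpt)

lemma whisk_interchange:
  assumes "is_nat_trans A B \<alpha>" "is_nat_trans B C \<beta>"
  shows "cmp (fun_cat A C) (whisk_right A \<beta> (tgt \<alpha>)) (whisk_left A (src \<beta>) \<alpha>)
    = cmp (fun_cat A C) (whisk_left A (tgt \<beta>) \<alpha>) (whisk_right A \<beta> (src \<alpha>))"
  using nat_square[OF assms(2) nat_cpt(1)[OF assms(1)]] nat_cpt[OF assms(1)]
  by (auto intro!: restrict_ext)

subsection \<open>Composition with a functor, as a functor of functor categories\<close>

lemma post_simps:
  "is_functor J A X \<Longrightarrow> fob (post J A F) X = fun_comp J F X"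
  "is_nat_trans J A \<phi> \<Longrightarrow> far (post J A F) \<phi> = whisk_left J F \<phi>"
  by (simp_all add: post_def fun_cat_simps)

lemma post_nt_simps:
  "src (post_nt J A \<alpha>) = post J A (src \<alpha>)" "tgt (post_nt J A \<alpha>) = post J A (tgt \<alpha>)"
  "is_functor J A X \<Longrightarrow> cpt (post_nt J A \<alpha>) X = whisk_right J \<alpha> X"
  by (simp_all add: post_nt_def fun_cat_simps)

lemma functor_post:
  assumes "category J" "category A" "is_functor A B F"
  shows "is_functor (fun_cat J A) (fun_cat J B) (post J A F)"
  unfolding post_def
proof (rule is_functorI[OF category_fun_cat])
  fix X assume "X \<in> Ob (fun_cat J A)"
  then show "fun_comp J F X \<in> Ob (fun_cat J B)"
    "whisk_left J F (idn (fun_cat J A) X) = idn (fun_cat J B) (fun_comp J F X)"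
    using assms functor_fun_comp whisk_left_idn by (auto simp: fun_cat_simps simp del: fun_cat_dc)
next
  fix \<alpha> assume "\<alpha> \<in> Ar (fun_cat J A)"
  then show "whisk_left J F \<alpha> \<in> hom (fun_cat J B) (fun_comp J F (dm (fun_cat J A) \<alpha>))
    (fun_comp J F (cd (fun_cat J A) \<alpha>))"
    using assms nat_whisk_left by (auto simp: fun_cat_simps hom_fun_cat)
next
  fix \<alpha> \<beta> assume "\<alpha> \<in> Ar (fun_cat J A)" "\<beta> \<in> Ar (fun_cat J A)" "cd (fun_cat J A) \<alpha>
      = dm (fun_cat J A) \<beta>"
  then show "whisk_left J F (cmp (fun_cat J A) \<beta> \<alpha>) =
           cmp (fun_cat J B) (whisk_left J F \<beta>) (whisk_left J F \<alpha>)"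
    using whisk_left_cmp[OF _ _ _ assms(3)] by (auto simp: fun_cat_simps simp del: fun_cat_dc(3,4))
qed (use assms in auto)

lemma nat_post:
  assumes "category J" "category A" "is_nat_trans A B \<alpha>"
  shows "is_nat_trans (fun_cat J A) (fun_cat J B) (post_nt J A \<alpha>)"
  unfolding post_nt_def
proof (rule is_nat_transI)
  note f = nat_functors[OF assms(3)]
  show "is_functor (fun_cat J A) (fun_cat J B) (post J A (src \<alpha>))"
       "is_functor (fun_cat J A) (fun_cat J B) (post J A (tgt \<alpha>))"
    using functor_post assms f by blast+
  show "category (fun_cat J A)" using assms category_fun_cat by blast
  show "whisk_right J \<alpha> X \<in> hom (fun_cat J B) (fob (post J A (src \<alpha>)) X) (fob (post J A (tgt \<alpha>)) X)"
    if "X \<in> Ob (fun_cat J A)" for X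
    using that nat_whisk_right[OF assms(1,3)] by (auto simp: hom_fun_cat post_simps fun_cat_simps)
  fix \<phi> assume "\<phi> \<in> Ar (fun_cat J A)"
  then show "cmp (fun_cat J B) (whisk_right J \<alpha> (cd (fun_cat J A) \<phi>)) (far (post J A (src \<alpha>)) \<phi>) =
         cmp (fun_cat J B) (far (post J A (tgt \<alpha>)) \<phi>) (whisk_right J \<alpha> (dm (fun_cat J A) \<phi>))"
    using whisk_interchange[OF _ assms(3)] by (simp add: post_simps fun_cat_simps)
qed

lemma post_fun_comp:
  assumes "category J" "category A" "is_functor A B F" "is_functor B C G"
  shows "post J A (fun_comp A G F) = fun_comp (fun_cat J A) (post J B G) (post J A F)"
proof -
  have 1: "is_functor (fun_cat J A) (fun_cat J C) (post J A (fun_comp A G F))"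
    using assms functor_post functor_fun_comp by metis
  have 2: "fob (post J A (fun_comp A G F)) X = fob (post J B G) (fob (post J A F) X)"
    if "is_functor J A X" for X
    using that assms by (simp add: post_simps functor_fun_comp fun_comp_assoc)
  have 3: "far (post J A (fun_comp A G F)) X = far (post J B G) (far (post J A F) X)"
    if "is_nat_trans J A X" for X
    using that assms by (simp add: post_simps whisk_left_left nat_whisk_left)
  show ?thesis using 2 3
    by (simp add: fun_comp_def[of "fun_cat J A"] post_def fun_cat_simps cong: restrict_cong)
qed

lemma post_id: "category J \<Longrightarrow> category A \<Longrightarrow> post J A (id_fun A) = id_fun (fun_cat J A)"
  by (auto simp: post_def id_fun_def[of "fun_cat J A"] fun_cat_simps fun_comp_id whisk_id
     intro!: restrict_ext)

lemma post_nt_whisk_right: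
  assumes "category J" "category A" "is_functor A B F" "is_nat_trans B C \<alpha>"
  shows "post_nt J A (whisk_right A \<alpha> F) = whisk_right (fun_cat J A) (post_nt J B \<alpha>) (post J A F)"
  using assms post_fun_comp[OF assms(1-3) nat_functors(1)[OF assms(4)]]
    post_fun_comp[OF assms(1-3) nat_functors(2)[OF assms(4)]]
  by (auto simp: post_nt_def whisk_right_def[of "fun_cat J A"] fun_cat_simps functor_fun_comp
     post_simps whisk_right_right intro!: restrict_ext)

lemma post_nt_whisk_left:
  assumes "category J" "category A" "is_functor B C F" "is_nat_trans A B \<alpha>"
  shows "post_nt J A (whisk_left A F \<alpha>) = whisk_left (fun_cat J A) (post J B F) (post_nt J A \<alpha>)"
  using assms post_fun_comp[OF assms(1,2) nat_functors(1)[OF assms(4)] assms(3)]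
    post_fun_comp[OF assms(1,2) nat_functors(2)[OF assms(4)] assms(3)]
  by (auto simp: post_nt_def whisk_left_def[of "fun_cat J A"] fun_cat_simps
     post_simps nat_whisk_right whisk_left_right intro!: restrict_ext)

lemma post_nt_idn:
  assumes "category J" "category A" "category B" "is_functor A B F"
  shows "post_nt J A (idn (fun_cat A B) F) = idn (fun_cat (fun_cat J A) (fun_cat J B)) (post J A F)"
  using assms
  by (auto simp: post_nt_def fun_cat_simps post_simps whisk_right_def functor_simps intro!:
      restrict_ext)

lemma post_nt_cmp:
  assumes "category J" "category A"
  shows "post_nt J A (cmp (fun_cat A B) \<beta> \<alpha>)
    = cmp (fun_cat (fun_cat J A) (fun_cat J B)) (post_nt J A \<beta>) (post_nt J A \<alpha>)"
  using assms
  by (auto simp: post_nt_def fun_cat_simps whisk_right_def functor_simps intro!: restrict_ext)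

section \<open>Paths in a localization\<close>

lemma path_append: "is_path C W a p b \<Longrightarrow> is_path C W b q c \<Longrightarrow> is_path C W a (p @ q) c"
  by (induction C W a p b rule: is_path.induct) auto

lemma path_ob:
  assumes "category C" "is_path C W a p b" shows "a \<in> Ob C" "b \<in> Ob C"
proof -
  have "a \<in> Ob C \<and> b \<in> Ob C" using assms(2)
  proof (induction p arbitrary: a)
    case (Cons x p)
    then show ?case using assms(1) by (cases x) (auto simp: cat_dm cat_cd)
  qed auto
  then show "a \<in> Ob C" "b \<in> Ob C" by auto
qed

lemma path_arrows: "is_path C W a p b \<Longrightarrow> x \<in> set p \<Longrightarrow> set_step x \<subseteq> Ar C"
  by (induction C W a p b rule: is_path.induct) auto

lemma loc_eq_path:
  assumes "category C" "loc_eq C W a b p q"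
  shows "is_path C W a p b \<and> is_path C W a q b"
  using assms(2)
  by induction
    (use assms(1) in \<open>auto intro: path_append simp: cat_idn cat_cmp cat_dm cat_cd hom_iff\<close>)

lemmas [trans] = loc_eq.trans

lemma loc_ctx:
  assumes "is_path C W a p b" "loc_eq C W b c x y" "is_path C W c q d"
  shows "loc_eq C W a d (p @ x @ q) (p @ y @ q)"
  by (rule loc_eq.append[OF loc_eq.refl[OF assms(1)] loc_eq.append[OF assms(2) loc_eq.refl[OF
      assms(3)]]])

lemma loc_left: "is_path C W a p b \<Longrightarrow> loc_eq C W b c x y \<Longrightarrow> loc_eq C W a c (p @ x) (p @ y)"
  by (intro loc_eq.append loc_eq.refl)

lemma loc_right: "loc_eq C W a b x y \<Longrightarrow> is_path C W b q c \<Longrightarrow> loc_eq C W a c (x @ q) (y @ q)"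
  by (intro loc_eq.append loc_eq.refl)

subsection \<open>Invertible paths\<close>

text \<open>The paths \<open>p\<close> and \<open>q\<close> define mutually inverse morphisms of the localization.\<close>

definition inv_paths :: "('o, 'm) cat \<Rightarrow> 'm set \<Rightarrow> 'o \<Rightarrow> 'o \<Rightarrow> 'm step list \<Rightarrow> 'm step list \<Rightarrow> bool" where
  "inv_paths C W a b p q \<longleftrightarrow> is_path C W a p b \<and> is_path C W b q a \<and>
    loc_eq C W a a (p @ q) [] \<and> loc_eq C W b b (q @ p) []"

lemma inv_paths_sym: "inv_paths C W a b p q \<Longrightarrow> inv_paths C W b a q p"
  by (auto simp: inv_paths_def)

lemma inv_paths_append:
  assumes "inv_paths C W a b p q" "inv_paths C W b c p' q'"
  shows "inv_paths C W a c (p @ p') (q' @ q)"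
proof -
  have "loc_eq C W a a (p @ (p' @ q') @ q) (p @ [] @ q)"
    by (rule loc_ctx) (use assms in \<open>auto simp: inv_paths_def\<close>)
  moreover have "loc_eq C W c c (q' @ (q @ p) @ p') (q' @ [] @ p')"
    by (rule loc_ctx) (use assms in \<open>auto simp: inv_paths_def\<close>)
  ultimately show ?thesis using assms
    by (auto simp: inv_paths_def intro: path_append loc_eq.trans)
qed

lemma inv_paths_cancel:
  assumes "inv_paths C W a b p q" "is_path C W b x c" "is_path C W b y c"
    and "loc_eq C W a c (p @ x) (p @ y)"
  shows "loc_eq C W b c x y"
proof -
  have q: "is_path C W b q a" "loc_eq C W b b (q @ p) []"
    using assms(1) by (auto simp: inv_paths_def)
  have "loc_eq C W b c ((q @ p) @ x) ([] @ x)" "loc_eq C W b c ((q @ p) @ y) ([] @ y)"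
    by (rule loc_right[OF q(2)], fact)+
  moreover have "loc_eq C W b c (q @ p @ x) (q @ p @ y)" by (rule loc_left[OF q(1) assms(4)])
  ultimately show ?thesis by simp (meson loc_eq.sym loc_eq.trans)
qed

lemma inv_paths_cancel_right:
  assumes "inv_paths C W b c p q" "is_path C W a x b" "is_path C W a y b"
    and "loc_eq C W a c (x @ p) (y @ p)"
  shows "loc_eq C W a b x y"
proof -
  have q: "is_path C W c q b" "loc_eq C W b b (p @ q) []"
    using assms(1) by (auto simp: inv_paths_def)
  have "loc_eq C W a b (x @ p @ q) (x @ [])" "loc_eq C W a b (y @ p @ q) (y @ [])"
    by (rule loc_left[OF _ q(2)], fact)+
  moreover have "loc_eq C W a b ((x @ p) @ q) ((y @ p) @ q)" by (rule loc_right[OF assms(4) q(1)])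
  ultimately show ?thesis by simp (meson loc_eq.sym loc_eq.trans)
qed

lemma inv_paths_eq:
  assumes C: "category C" and "inv_paths C W a b p q" "loc_eq C W a b p p'"
  shows "inv_paths C W a b p' q"
proof -
  have q: "is_path C W b q a" and pq: "loc_eq C W a a (p @ q) []" "loc_eq C W b b (q @ p) []"
    using assms(2) by (auto simp: inv_paths_def)
  have "loc_eq C W a a (p' @ q) (p @ q)" "loc_eq C W b b (q @ p') (q @ p)"
    using loc_right[OF assms(3) q] loc_left[OF q assms(3)] by (auto intro: loc_eq.sym)
  then show ?thesis using pq q loc_eq_path[OF C assms(3)]
    by (auto simp: inv_paths_def intro: loc_eq.trans)
qed

text \<open>A factor of an invertible path is invertible if the other two factors are.\<close>

lemma inv_paths_factor:
  assumes C: "category C" and "inv_paths C W a b p p'" "inv_paths C W c d r r'"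
    "is_path C W b x c" "inv_paths C W a d (p @ x @ r) y"
  shows "inv_paths C W b c x (r @ y @ p)"
proof -
  have 1: "inv_paths C W b c (p' @ (p @ x @ r) @ r') (r @ y @ p)"
    using inv_paths_append[OF inv_paths_append[OF inv_paths_sym[OF assms(2)] assms(5)]
        inv_paths_sym[OF assms(3)]] by simp
  have "loc_eq C W b c ((p' @ p) @ x @ (r @ r')) ([] @ x @ [])"
    using assms by (intro loc_eq.append loc_eq.refl) (auto simp: inv_paths_def)
  then show ?thesis using inv_paths_eq[OF C 1] by simp
qed

text \<open>The reversed path; for a zigzag it represents the inverse morphism.\<close>

definition inv_path :: "'m step list \<Rightarrow> 'm step list" where
  "inv_path p = rev (map inv_step p)"

lemma inv_step_inv: "inv_step (inv_step x) = x"
  by (cases x) auto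

lemma inv_path_simps [simp]: "inv_path [] = []" "inv_path (p @ q) = inv_path q @ inv_path p"
    "inv_path (inv_path p) = p" "inv_path [Fwd f] = [Bwd f]" "inv_path [Bwd f] = [Fwd f]"
  by (auto simp: inv_path_def rev_map inv_step_inv o_def)

lemma map_inv_path: "map_zigzag h (inv_path p) = inv_path (map_zigzag h p)"
proof -
  have "map_step h (inv_step x) = inv_step (map_step h x)" for x by (cases x) auto
  then show ?thesis by (auto simp: inv_path_def rev_map)
qed

lemma zigzag_append: "is_zigzag C W a p b \<Longrightarrow> is_zigzag C W b q c \<Longrightarrow> is_zigzag C W a (p @ q) c"
  by (auto simp: is_zigzag_def intro: path_append)

lemma zigzag_inv:
  assumes C: "category C" and p: "is_zigzag C W a p b"
  shows "is_zigzag C W b (inv_path p) a \<and> inv_paths C W a b p (inv_path p)"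
  using p
proof (induction p arbitrary: a)
  case Nil
  then show ?case by (auto simp: is_zigzag_def inv_path_def inv_paths_def intro: loc_eq.refl)
next
  case (Cons x p)
  obtain c where c: "is_zigzag C W a [x] c" "is_zigzag C W c (inv_path [x]) a"
      "inv_paths C W a c [x] (inv_path [x])" "is_zigzag C W c p b"
  proof (cases x)
    case (Fwd f)
    then show ?thesis using Cons.prems that[of "cd C f"]
        loc_eq.inv_right[of f C a "cd C f" W] loc_eq.inv_left[of f C a "cd C f" W]
      by (auto simp: is_zigzag_def inv_paths_def hom_iff cat_dm[OF C] cat_cd[OF C])
  next
    case (Bwd f)
    then show ?thesis using Cons.prems that[of "dm C f"]
        loc_eq.inv_right[of f C "dm C f" a W] loc_eq.inv_left[of f C "dm C f" a W]
      by (auto simp: is_zigzag_def inv_paths_def hom_iff cat_dm[OF C] cat_cd[OF C])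
  qed
  then show ?case
    using inv_paths_append[OF c(3) conjunct2[OF Cons.IH[OF c(4)]]]
      zigzag_append[OF conjunct1[OF Cons.IH[OF c(4)]] c(2)]
    by (simp flip: inv_path_simps(2))
qed

lemma inv_paths_iso:
  assumes "category C" "f \<in> hom C a b" "inv_paths C W a b [Fwd f] q"
  shows "is_iso (localization C W) (loc_mor C W a b [Fwd f])"
proof -
  let ?L = "localization C W"
  have q: "is_path C W b q a" "loc_eq C W a a ([Fwd f] @ q) []" "loc_eq C W b b (q @ [Fwd f]) []"
    and p: "is_path C W a [Fwd f] b"
    using assms(3) by (auto simp: inv_paths_def)
  have "cmp ?L (loc_mor C W b a q) (loc_mor C W a b [Fwd f]) = idn ?L a"
       "cmp ?L (loc_mor C W a b [Fwd f]) (loc_mor C W b a q) = idn ?L b"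
    using cmp_loc_mor[OF p q(1)] cmp_loc_mor[OF q(1) p] loc_mor_eq[OF q(2)] loc_mor_eq[OF q(3)]
    by (simp_all add: localization_def)
  moreover have "loc_mor C W b a q \<in> hom ?L b a" "loc_mor C W a b [Fwd f] \<in> hom ?L a b"
    using p q by (auto simp: localization_def hom_def simp del: is_path.simps) (auto simp:
        loc_mor_def)
  ultimately show ?thesis
    unfolding is_iso_def by (intro conjI bexI[of _ "loc_mor C W b a q"]) (simp_all add: hom_def)
qed

subsection \<open>Maps of relative categories\<close>

text \<open>A functor preserving the distinguished classes, given by its actions \<open>h\<close> on objects and \<open>k\<close>
  on arrows. These are arbitrary functions off the objects and arrows of \<open>A\<close>, unlike the data of
  a \<open>func\<close>; this lets whiskering, \<open>post_nt\<close> and evaluation be used directly as maps of paths.\<close>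

definition rel_map :: "('a, 'f) cat \<Rightarrow> 'f set \<Rightarrow> ('o, 'm) cat \<Rightarrow> 'm set \<Rightarrow> ('a \<Rightarrow> 'o) \<Rightarrow> ('f \<Rightarrow> 'm) \<Rightarrow> bool"
  where "rel_map A V B W h k \<longleftrightarrow>
    (\<forall>a\<in>Ob A. h a \<in> Ob B) \<and>
    (\<forall>f\<in>Ar A. k f \<in> hom B (h (dm A f)) (h (cd A f))) \<and>
    (\<forall>a\<in>Ob A. k (idn A a) = idn B (h a)) \<and>
    (\<forall>f\<in>Ar A. \<forall>g\<in>Ar A. cd A f = dm A g \<longrightarrow> k (cmp A g f) = cmp B (k g) (k f)) \<and>
    (\<forall>w\<in>V. k w \<in> W)"

lemma rel_map_path:
  assumes "rel_map A V B W h k" "is_path A V a p b"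
  shows "is_path B W (h a) (map_zigzag k p) (h b)"
  using assms(2)
proof (induction p arbitrary: a)
  case (Cons x p)
  then show ?case using assms(1) by (cases x) (auto simp: rel_map_def hom_iff)
qed (use assms(1) in \<open>auto simp: rel_map_def\<close>)

lemma rel_map_zigzag:
  assumes "rel_map A V B W h k" "is_zigzag A V a p b"
  shows "is_zigzag B W (h a) (map_zigzag k p) (h b)"
proof -
  have "f \<in> W" if "Fwd f \<in> map_step k ` set p" for f
  proof -
    from that obtain x where x: "x \<in> set p" "Fwd f = map_step k x" by blast
    then obtain g where g: "x = Fwd g" "f = k g" by - (cases x, auto)
    then have "g \<in> V" using x assms(2) by (simp add: is_zigzag_def)
    then show ?thesis using assms(1) g by (simp add: rel_map_def)
  qed
  then show ?thesis using rel_map_path[OF assms(1)] assms(2) by (auto simp: is_zigzag_def)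
qed

lemma rel_map_loc_eq:
  assumes "rel_map A V B W h k" "loc_eq A V a b p q"
  shows "loc_eq B W (h a) (h b) (map_zigzag k p) (map_zigzag k q)"
  using assms(2)
proof induction
  case (refl a p b)
  then show ?case using assms(1) rel_map_path loc_eq.refl by metis
next
  case (cmp f a b g c)
  then have "k (cmp A g f) = cmp B (k g) (k f)" "k f \<in> hom B (h a) (h b)" "k g \<in> hom B (h b) (h c)"
    using assms(1) by (auto simp: rel_map_def hom_iff)
  then show ?case by (simp add: loc_eq.cmp)
next
  case (idn a)
  then show ?case using assms(1) loc_eq.idn[of "h a" B W] by (auto simp: rel_map_def)
next
  case (inv_right w a b)
  then have "k w \<in> hom B (h a) (h b)" "k w \<in> W" using assms(1) by (auto simp: rel_map_def hom_iff)
  then show ?case by (simp add: loc_eq.inv_right)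
next
  case (inv_left w a b)
  then have "k w \<in> hom B (h a) (h b)" "k w \<in> W" using assms(1) by (auto simp: rel_map_def hom_iff)
  then show ?case by (simp add: loc_eq.inv_left)
qed (auto intro: loc_eq.intros)

lemma rel_map_inv_paths:
  assumes "rel_map A V B W h k" "inv_paths A V a b p q"
  shows "inv_paths B W (h a) (h b) (map_zigzag k p) (map_zigzag k q)"
  using assms(2) rel_map_path[OF assms(1)] rel_map_loc_eq[OF assms(1)]
  unfolding inv_paths_def by (metis map_append list.map(1))

text \<open>The same notion for a bundled functor.\<close>

definition rel_functor :: "('a, 'f) cat \<Rightarrow> 'f set \<Rightarrow> ('o, 'm) cat \<Rightarrow> 'm set \<Rightarrow> ('a, 'f, 'o, 'm) func \<Rightarrow>
    bool"
  where "rel_functor A V B W F \<longleftrightarrow> is_functor A B F \<and> (\<forall>w\<in>V. far F w \<in> W)"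

text \<open>A 2-cell \<open>F \<Rightarrow> G\<close> is given by a path in the functor category, read from left to right, so
  vertical composites appear in diagrammatic order. \<open>WL A G p\<close> and \<open>WR A K p\<close> are the whiskered
  2-cells \<open>G p\<close> and \<open>p\<^sub>K\<close>, and \<open>PN J A p\<close> is the 2-cell induced by \<open>p\<close> between functors of
  \<open>J\<close>-indexed diagrams.\<close>

abbreviation WL where "WL A G p \<equiv> map_zigzag (\<lambda>\<alpha>. whisk_left A G \<alpha>) p"
abbreviation WR where "WR A K p \<equiv> map_zigzag (\<lambda>\<alpha>. whisk_right A \<alpha> K) p"
abbreviation PN where "PN J A p \<equiv> map_zigzag (\<lambda>\<alpha>. post_nt J A \<alpha>) p"

abbreviation cell where
  "cell A D E F p G \<equiv> is_path (fun_cat A D) (objectwise A D E) F p G"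

lemma objectwise_iff: "\<alpha> \<in> objectwise A D E \<longleftrightarrow> is_nat_trans A D \<alpha> \<and> (\<forall>a\<in>Ob A. cpt \<alpha> a \<in> E)"
  by (simp add: objectwise_def fun_cat_simps)

lemma rel_map_WR:
  assumes "category A" "is_functor A B K"
  shows "rel_map (fun_cat B C) (objectwise B C W) (fun_cat A C) (objectwise A C W)
    (\<lambda>G. fun_comp A G K) (\<lambda>\<alpha>. whisk_right A \<alpha> K)"
  using assms functor_fun_comp nat_whisk_right whisk_right_idn[OF assms(2)]
    whisk_right_cmp[OF assms(2)]
  by (auto simp: rel_map_def fun_cat_simps hom_fun_cat objectwise_iff functor_ob
      simp del: fun_cat_dc(3,4))

lemma rel_map_WL:
  assumes "category A" "rel_functor B V C W G"
  shows "rel_map (fun_cat A B) (objectwise A B V) (fun_cat A C) (objectwise A C W)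
    (\<lambda>F. fun_comp A G F) (\<lambda>\<alpha>. whisk_left A G \<alpha>)"
proof -
  have G: "is_functor B C G" "\<And>w. w \<in> V \<Longrightarrow> far G w \<in> W" using assms by (auto simp: rel_functor_def)
  show ?thesis
    using assms(1) functor_fun_comp[OF _ _ G(1)] nat_whisk_left[OF _ _ G(1)]
       whisk_left_idn[OF _ G(1)]  whisk_left_cmp[OF _ _ _ G(1)] G(2)
    by (auto simp: rel_map_def fun_cat_simps hom_fun_cat objectwise_iff simp del: fun_cat_dc(3,4))
qed

lemma rel_map_post:
  assumes "category J" "category A" "category B"
  shows "rel_map (fun_cat A B) (objectwise A B W) (fun_cat (fun_cat J A) (fun_cat J B))
    (objectwise (fun_cat J A) (fun_cat J B) (objectwise J B W)) (post J A) (\<lambda>\<alpha>. post_nt J A \<alpha>)"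
  using assms functor_post nat_post post_nt_idn post_nt_cmp nat_whisk_right
  by (auto simp: rel_map_def fun_cat_simps hom_fun_cat objectwise_iff post_nt_simps functor_ob
      simp del: fun_cat_dc(3,4))

lemma rel_map_eval:
  assumes "a \<in> Ob A"
  shows "rel_map (fun_cat A B) (objectwise A B W) B W (\<lambda>F. fob F a) (\<lambda>\<alpha>. cpt \<alpha> a)"
  using assms by (auto simp: rel_map_def fun_cat_simps hom_iff functor_ob nat_cpt objectwise_iff)

lemma rel_functor_comp:
  "category A \<Longrightarrow> rel_functor A V B W F \<Longrightarrow> rel_functor B W C X G \<Longrightarrow> V \<subseteq> Ar A \<Longrightarrow>
    rel_functor A V C X (fun_comp A G F)"
  by (auto simp: rel_functor_def subset_eq intro: functor_fun_comp)

lemma rel_functor_id: "category A \<Longrightarrow> V \<subseteq> Ar A \<Longrightarrow> rel_functor A V A V (id_fun A)"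
  by (auto simp: rel_functor_def subset_eq intro: functor_id)

lemma objectwise_ar: "objectwise A D E \<subseteq> Ar (fun_cat A D)"
  by (auto simp: objectwise_def)

lemma rel_functor_post:
  "category J \<Longrightarrow> category A \<Longrightarrow> rel_functor A V B W F \<Longrightarrow>
    rel_functor (fun_cat J A) (objectwise J A V) (fun_cat J B) (objectwise J B W) (post J A F)"
  by (auto simp: rel_functor_def functor_post objectwise_iff post_simps nat_whisk_left)

subsection \<open>The interchange law for 2-cells\<close>

lemma loc_eq_square:
  assumes C: "category C"
    and "f \<in> hom C a b" "g \<in> hom C b d" "f' \<in> hom C a c" "g' \<in> hom C c d"
    and "cmp C g f = cmp C g' f'"
  shows "loc_eq C W a d [Fwd f, Fwd g] [Fwd f', Fwd g']"
  using loc_eq.cmp[OF assms(2,3), of W] loc_eq.cmp[OF assms(4,5), of W] assms(6)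
  by (metis loc_eq.sym loc_eq.trans)

text \<open>A commuting square remains commuting after two parallel invertible sides are inverted.\<close>

lemma loc_eq_flip:
  assumes C: "category C" and p: "inv_paths C W a b p p'" and q: "inv_paths C W c d q q'"
    and x: "is_path C W a x c" and y: "is_path C W b y d" and eq: "loc_eq C W a d (p @ y) (x @ q)"
  shows "loc_eq C W b c (y @ q') (p' @ x)"
proof (rule inv_paths_cancel[OF p])
  have 1: "is_path C W d q' c" "loc_eq C W c c (q @ q') []" "loc_eq C W a a (p @ p') []"
    using p q by (auto simp: inv_paths_def)
  have "loc_eq C W a c ((p @ y) @ q') ((x @ q) @ q')"
    by (rule loc_right[OF eq 1(1)])
  also have "loc_eq C W a c ((x @ q) @ q') (x @ [])" using loc_left[OF x 1(2)] by simp
  also have "loc_eq C W a c (x @ []) ((p @ p') @ x)"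
    using loc_right[OF 1(3) x] by (auto intro: loc_eq.sym)
  finally show "loc_eq C W a c (p @ y @ q') (p @ p' @ x)" by simp
qed (use p q x y in \<open>auto simp: inv_paths_def intro: path_append\<close>)

lemma interchange_step:
  assumes A: "category A" and B: "category B" and C: "category C"
    and \<alpha>: "is_nat_trans A B \<alpha>" and q: "cell B C W H q K"
  shows "nat_eq A C W (fun_comp A H (src \<alpha>)) (fun_comp A K (tgt \<alpha>))
    ([Fwd (whisk_left A H \<alpha>)] @ WR A (tgt \<alpha>) q) (WR A (src \<alpha>) q @ [Fwd (whisk_left A K \<alpha>)])"
  using q
proof (induction q arbitrary: H)
  case Nil
  then show ?case using A \<alpha> nat_whisk_left[OF A \<alpha>] functor_fun_comp[OF A nat_functors(2)[OF \<alpha>]]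
    by (auto simp: fun_cat_simps intro!: loc_eq.refl)
next
  case (Cons x q)
  note AC = category_fun_cat[OF A C]
  obtain \<beta> L where x: "x = Fwd \<beta> \<or> x = Bwd \<beta>" and b: "cell B C W H [x] L" "cell B C W L q K"
      and \<beta>: "is_nat_trans B C \<beta>"
    using Cons.prems by (cases x) (auto simp: fun_cat_simps nat_functors)
  have HL: "is_functor B C H" "is_functor B C L"
    using path_ob[OF category_fun_cat[OF B C] b(1)] by (auto simp: fun_cat_simps)
  note st = nat_functors[OF \<alpha>]
  have pM: "cell A C W (fun_comp A M (src \<alpha>)) [Fwd (whisk_left A M \<alpha>)] (fun_comp A M (tgt \<alpha>))"
    if "is_functor B C M" for M
    using nat_whisk_left[OF A \<alpha> that] functor_fun_comp[OF A st(2) that] by (simp add: fun_cat_simps)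
  have sq: "nat_eq A C W (fun_comp A H (src \<alpha>)) (fun_comp A L (tgt \<alpha>))
    ([Fwd (whisk_left A H \<alpha>)] @ WR A (tgt \<alpha>) [x]) (WR A (src \<alpha>) [x] @ [Fwd (whisk_left A L \<alpha>)])"
  proof (cases "x = Fwd \<beta>")
    case True
    then show ?thesis using b \<beta> A \<alpha> HL st
      by (auto intro!: loc_eq_square[OF AC] whisk_interchange nat_whisk_left nat_whisk_right
          simp: hom_fun_cat simp del: fun_cat_dc(3,4))
  next
    case False
    then have x: "x = Bwd \<beta>" using x by blast
    have z: "is_zigzag (fun_cat B C) (objectwise B C W) L [Fwd \<beta>] H"
      using b x HL by (auto simp: is_zigzag_def fun_cat_simps)
    have i: "inv_paths (fun_cat A C) (objectwise A C W) (fun_comp A L F) (fun_comp A H F)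
        [Fwd (whisk_right A \<beta> F)] [Bwd (whisk_right A \<beta> F)]" if "is_functor A B F" for F
      using rel_map_inv_paths[OF rel_map_WR[OF A that] conjunct2[OF zigzag_inv[OF
        category_fun_cat[OF B C] z]]]
      by simp
    have "nat_eq A C W (fun_comp A L (src \<alpha>)) (fun_comp A H (tgt \<alpha>))
      ([Fwd (whisk_right A \<beta> (src \<alpha>))] @ [Fwd (whisk_left A H \<alpha>)])
      ([Fwd (whisk_left A L \<alpha>)] @ [Fwd (whisk_right A \<beta> (tgt \<alpha>))])"
      using b x \<beta> A \<alpha> HL st whisk_interchange[OF \<alpha> \<beta>]
      by (auto intro!: loc_eq_square[OF AC] nat_whisk_left nat_whisk_right
          simp: hom_fun_cat simp del: fun_cat_dc(3,4))
    from loc_eq_flip[OF AC i[OF st(1)] i[OF st(2)] pM[OF HL(2)] pM[OF HL(1)] this]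
    show ?thesis using x by simp
  qed
  have 1: "cell A C W (fun_comp A H (src \<alpha>)) (WR A (src \<alpha>) [x]) (fun_comp A L (src \<alpha>))"
    by (rule rel_map_path[OF rel_map_WR[OF A st(1)] b(1)])
  have 2: "cell A C W (fun_comp A L (tgt \<alpha>)) (WR A (tgt \<alpha>) q) (fun_comp A K (tgt \<alpha>))"
    by (rule rel_map_path[OF rel_map_WR[OF A st(2)] b(2)])
  have "nat_eq A C W (fun_comp A H (src \<alpha>)) (fun_comp A K (tgt \<alpha>))
      ([Fwd (whisk_left A H \<alpha>)] @ WR A (tgt \<alpha>) [x] @ WR A (tgt \<alpha>) q)
      (WR A (src \<alpha>) [x] @ [Fwd (whisk_left A L \<alpha>)] @ WR A (tgt \<alpha>) q)"
    using loc_right[OF sq 2] by (simp only: append_assoc)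
  also have "nat_eq A C W (fun_comp A H (src \<alpha>)) (fun_comp A K (tgt \<alpha>))
      (WR A (src \<alpha>) [x] @ [Fwd (whisk_left A L \<alpha>)] @ WR A (tgt \<alpha>) q)
      (WR A (src \<alpha>) [x] @ WR A (src \<alpha>) q @ [Fwd (whisk_left A K \<alpha>)])"
    by (rule loc_left[OF 1 Cons.IH[OF b(2)]])
  finally show ?case by simp
qed

text \<open>Only the outer functors \<open>H\<close> and \<open>K\<close> have to preserve weak equivalences, not those visited
  by \<open>q\<close>: the whole path \<open>q\<close> is moved across one step of \<open>p\<close> at a time.\<close>

lemma interchange:
  assumes A: "category A" and B: "category B" and C: "category C"
    and H: "rel_functor B V C W H" and K: "rel_functor B V C W K"
    and p: "cell A B V F p G" and q: "cell B C W H q K"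
  shows "nat_eq A C W (fun_comp A H F) (fun_comp A K G)
    (WL A H p @ WR A G q) (WR A F q @ WL A K p)"
  using p
proof (induction p arbitrary: F)
  case Nil
  then have "is_functor A B G" "F = G" by (auto simp: fun_cat_simps)
  then show ?case using rel_map_path[OF rel_map_WR[OF A] q] by (auto intro: loc_eq.refl)
next
  case (Cons x p)
  note AB = category_fun_cat[OF A B] note AC = category_fun_cat[OF A C]
  obtain \<alpha> L where x: "x = Fwd \<alpha> \<or> x = Bwd \<alpha>" and b: "cell A B V F [x] L" "cell A B V L p G"
      and \<alpha>: "is_nat_trans A B \<alpha>"
    using Cons.prems by (cases x) (auto simp: fun_cat_simps nat_functors)
  have FL: "is_functor A B F" "is_functor A B L"
    using path_ob[OF AB b(1)] by (auto simp: fun_cat_simps)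
  have WLp: "cell A C W (fun_comp A M F') (WL A M r) (fun_comp A M G')"
    if "cell A B V F' r G'" "rel_functor B V C W M" for M r F' G'
    by (rule rel_map_path[OF rel_map_WL[OF A that(2)] that(1)])
  have WRp: "cell A C W (fun_comp A H M) (WR A M q) (fun_comp A K M)" if "is_functor A B M" for M
    by (rule rel_map_path[OF rel_map_WR[OF A that] q])
  have sq: "nat_eq A C W (fun_comp A H F) (fun_comp A K L)
    (WL A H [x] @ WR A L q) (WR A F q @ WL A K [x])"
  proof (cases "x = Fwd \<alpha>")
    case True
    then show ?thesis using interchange_step[OF A B C \<alpha> q] b by auto
  next
    case False
    then have x: "x = Bwd \<alpha>" using x by blast
    have z: "is_zigzag (fun_cat A B) (objectwise A B V) L [Fwd \<alpha>] F"
      using b x FL by (auto simp: is_zigzag_def fun_cat_simps)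
    have i: "inv_paths (fun_cat A C) (objectwise A C W) (fun_comp A M L) (fun_comp A M F)
        [Fwd (whisk_left A M \<alpha>)] [Bwd (whisk_left A M \<alpha>)]" if "rel_functor B V C W M" for M
      using rel_map_inv_paths[OF rel_map_WL[OF A that] conjunct2[OF zigzag_inv[OF AB z]]] by simp
    have "nat_eq A C W (fun_comp A H L) (fun_comp A K F)
       ([Fwd (whisk_left A H \<alpha>)] @ WR A F q) (WR A L q @ [Fwd (whisk_left A K \<alpha>)])"
      using interchange_step[OF A B C \<alpha> q] b x by auto
    from loc_eq_flip[OF AC i[OF H] i[OF K] WRp[OF FL(2)] WRp[OF FL(1)] this]
    show ?thesis using x by (auto intro: loc_eq.sym)
  qed
  have "nat_eq A C W (fun_comp A H F) (fun_comp A K G)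
      (WL A H [x] @ WL A H p @ WR A G q) (WL A H [x] @ WR A L q @ WL A K p)"
    by (rule loc_left[OF WLp[OF b(1) H] Cons.IH[OF b(2)]])
  also have "nat_eq A C W (fun_comp A H F) (fun_comp A K G)
      (WL A H [x] @ WR A L q @ WL A K p) (WR A F q @ WL A K [x] @ WL A K p)"
    using loc_right[OF sq WLp[OF b(2) K]] by (simp only: append_assoc)
  finally show ?case by simp
qed

section \<open>Adjunctions between relative categories\<close>

lemma WR_WR: "is_functor A B F \<Longrightarrow> WR A F (WR B G p) = WR A (fun_comp A G F) p"
  by (simp add: step.map_comp o_def whisk_right_right)

lemma WL_WR: "is_functor A B F \<Longrightarrow> WL A G (WR A F p) = WR A F (WL B G p)"
  by (simp add: step.map_comp o_def whisk_left_right)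

lemma path_map_cong:
  assumes "is_path C W a p b" "\<And>f. f \<in> Ar C \<Longrightarrow> h f = k f"
  shows "map_zigzag h p = map_zigzag k p"
  using path_arrows[OF assms(1)] assms(2) by (auto intro!: step.map_cong0)

lemma WL_WL: "cell A B V F p G \<Longrightarrow> WL A K (WL A H p) = WL A (fun_comp B K H) p"
  using path_map_cong[of "fun_cat A B" _ F p G "\<lambda>\<alpha>. whisk_left A K (whisk_left A H \<alpha>)"]
  by (simp add: step.map_comp o_def fun_cat_simps whisk_left_left)

lemma map_step_id: "map_step (\<lambda>x. x) = (\<lambda>x. x)"
  using step.map_id0 by (simp add: id_def)

lemma W_id:
  assumes "category A" "category B" "cell A B V F p G"
  shows "WR A (id_fun A) p = p" "WL A (id_fun B) p = p"
  using path_map_cong[OF assms(3), of "\<lambda>\<alpha>. whisk_right A \<alpha> (id_fun A)" "\<lambda>\<alpha>. \<alpha>"]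
    path_map_cong[OF assms(3), of "whisk_left A (id_fun B)" "\<lambda>\<alpha>. \<alpha>"]
  by (simp_all add: fun_cat_simps whisk_id[OF assms(1,2)] map_step_id)

lemma PN_WR:
  assumes "category J" "category A" "is_functor A B F" "cell B C W H p K"
  shows "PN J A (WR A F p) = WR (fun_cat J A) (post J A F) (PN J B p)"
  using path_map_cong[OF assms(4), of "\<lambda>\<alpha>. post_nt J A (whisk_right A \<alpha> F)"
      "\<lambda>\<alpha>. whisk_right (fun_cat J A) (post_nt J B \<alpha>) (post J A F)"]
  by (simp add: step.map_comp o_def fun_cat_simps post_nt_whisk_right[OF assms(1-3)])

lemma PN_WL:
  assumes "category J" "category A" "is_functor B C F" "cell A B W H p K"
  shows "PN J A (WL A F p) = WL (fun_cat J A) (post J B F) (PN J A p)"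
  using path_map_cong[OF assms(4), of "\<lambda>\<alpha>. post_nt J A (whisk_left A F \<alpha>)"
      "\<lambda>\<alpha>. whisk_left (fun_cat J A) (post J B F) (post_nt J A \<alpha>)"]
  by (simp add: step.map_comp o_def fun_cat_simps post_nt_whisk_left[OF assms(1-3)])

lemma cell_WR:
  "category A \<Longrightarrow> is_functor A B K \<Longrightarrow> cell B C W F p G \<Longrightarrow>
    cell A C W (fun_comp A F K) (WR A K p) (fun_comp A G K)"
  by (rule rel_map_path[OF rel_map_WR])

lemma cell_WL:
  "category A \<Longrightarrow> rel_functor B V C W H \<Longrightarrow> cell A B V F p G \<Longrightarrow>
    cell A C W (fun_comp A H F) (WL A H p) (fun_comp A H G)"
  by (rule rel_map_path[OF rel_map_WL])

lemma cell_PN: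
  "category J \<Longrightarrow> category A \<Longrightarrow> category B \<Longrightarrow> cell A B W F p G \<Longrightarrow>
    cell (fun_cat J A) (fun_cat J B) (objectwise J B W) (post J A F) (PN J A p) (post J A G)"
  by (rule rel_map_path[OF rel_map_post])

lemma eq_WR:
  "category A \<Longrightarrow> is_functor A B K \<Longrightarrow> nat_eq B C W F G p q \<Longrightarrow>
    nat_eq A C W (fun_comp A F K) (fun_comp A G K) (WR A K p) (WR A K q)"
  by (rule rel_map_loc_eq[OF rel_map_WR])

lemma eq_WL:
  "category A \<Longrightarrow> rel_functor B V C W H \<Longrightarrow> nat_eq A B V F G p q \<Longrightarrow>
    nat_eq A C W (fun_comp A H F) (fun_comp A H G) (WL A H p) (WL A H q)"
  by (rule rel_map_loc_eq[OF rel_map_WL])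

lemma eq_PN:
  "category J \<Longrightarrow> category A \<Longrightarrow> category B \<Longrightarrow> nat_eq A B W F G p q \<Longrightarrow>
    nat_eq (fun_cat J A) (fun_cat J B) (objectwise J B W) (post J A F) (post J A G)
      (PN J A p) (PN J A q)"
  by (rule rel_map_loc_eq[OF rel_map_post])

lemma rel_functorD: "rel_functor A V B W F \<Longrightarrow> is_functor A B F"
  by (simp add: rel_functor_def)

text \<open>A relative functor \<open>L : A \<rightarrow> C\<close> with right adjoint \<open>R\<close>, counit \<open>eps : L R \<Rightarrow> 1\<close> and unit
  \<open>eta : 1 \<Rightarrow> R L\<close>, of which only the triangle identity \<open>eps\<^sub>L \<circ> L eta = 1\<close> is required. This is
  what uniqueness of 2-cells into \<open>L\<close> needs; the other triangle identity is a separate hypothesis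
  where it is used.\<close>

definition half_adj where
  "half_adj A V C W L R eps eta \<longleftrightarrow> category A \<and> category C \<and> V \<subseteq> Ar A \<and> W \<subseteq> Ar C \<and>
    rel_functor A V C W L \<and> rel_functor C W A V R \<and>
    cell C C W (fun_comp C L R) eps (id_fun C) \<and>
    cell A A V (id_fun A) eta (fun_comp A R L) \<and>
    nat_eq A C W L L (WL A L eta @ WR A L eps) []"

text \<open>A 2-cell \<open>\<alpha>\<close> into a left adjoint \<open>L'\<close> can be recovered from \<open>eps \<circ> \<alpha>\<^sub>R\<close>. Its source \<open>L\<close>
  need not be an adjoint.\<close>

lemma adj_transpose:
  assumes adj: "half_adj A V C W L' R eps eta" and L: "rel_functor A V C W L"
    and \<alpha>: "cell A C W L \<alpha> L'"
  shows "nat_eq A C W L L' \<alpha> (WL A L eta @ WR A L' (WR C R \<alpha> @ eps))"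
proof -
  have A: "category A" and C: "category C" and L': "rel_functor A V C W L'"
    and R: "rel_functor C W A V R"
    and eps: "cell C C W (fun_comp C L' R) eps (id_fun C)"
    and eta: "cell A A V (id_fun A) eta (fun_comp A R L')"
    and T: "nat_eq A C W L' L' (WL A L' eta @ WR A L' eps) []"
    using adj by (auto simp: half_adj_def)
  note f = rel_functorD[OF L] rel_functorD[OF L'] rel_functorD[OF R]
  have eps': "cell A C W (fun_comp A L' (fun_comp A R L')) (WR A L' eps) L'"
    using cell_WR[OF A f(2) eps] by (simp add: fun_comp_id[OF A C f(2)] fun_comp_assoc[OF f(2)])
  have "nat_eq A C W L L' (\<alpha> @ []) (\<alpha> @ WL A L' eta @ WR A L' eps)"
    by (rule loc_left[OF \<alpha> loc_eq.sym[OF T]])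
  also have "nat_eq A C W L (fun_comp A L' (fun_comp A R L')) (\<alpha> @ WL A L' eta)
      (WL A L eta @ WR A (fun_comp A R L') \<alpha>)"
    using loc_eq.sym[OF interchange[OF A A C L L' eta \<alpha>]]
    by (simp add: fun_comp_id[OF A C f(1)] W_id[OF A C \<alpha>])
  from loc_right[OF this eps'] have "nat_eq A C W L L' (\<alpha> @ WL A L' eta @ WR A L' eps)
      (WL A L eta @ WR A (fun_comp A R L') \<alpha> @ WR A L' eps)"
    by simp
  finally show ?thesis by (simp add: WR_WR[OF f(2)] del: map_map)
qed

lemma adj_unique:
  assumes adj: "half_adj A V C W L' R eps eta" and L: "rel_functor A V C W L"
    and \<alpha>: "cell A C W L \<alpha> L'" and \<beta>: "cell A C W L \<beta> L'"
    and eq: "nat_eq C C W (fun_comp C L R) (id_fun C) (WR C R \<alpha> @ eps) (WR C R \<beta> @ eps)"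
  shows "nat_eq A C W L L' \<alpha> \<beta>"
proof -
  have A: "category A" and C: "category C" and L': "rel_functor A V C W L'"
    and eta: "cell A A V (id_fun A) eta (fun_comp A R L')"
    using adj by (auto simp: half_adj_def)
  note f = rel_functorD[OF L] rel_functorD[OF L']
  have 1: "nat_eq A C W (fun_comp A L (fun_comp A R L')) L' (WR A L' (WR C R \<alpha> @ eps))
      (WR A L' (WR C R \<beta> @ eps))"
    using eq_WR[OF A f(2) eq] by (simp add: fun_comp_id[OF A C f(2)] fun_comp_assoc[OF f(2)])
  have 2: "cell A C W L (WL A L eta) (fun_comp A L (fun_comp A R L'))"
    using cell_WL[OF A L eta] by (simp add: fun_comp_id[OF A C f(1)])
  show ?thesis
    using adj_transpose[OF adj L \<alpha>] adj_transpose[OF adj L \<beta>] loc_left[OF 2 1]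
    by (meson loc_eq.sym loc_eq.trans)
qed

text \<open>The mate of the identity of \<open>R\<close> is a 2-cell \<open>L \<Rightarrow> L R L' \<Rightarrow> L'\<close> compatible with the counits;
  of \<open>L\<close> only the counit is used.\<close>

lemma mate_compatible:
  assumes adj: "half_adj A V C W L' R eps' eta'" and L: "rel_functor A V C W L"
    and eps: "cell C C W (fun_comp C L R) eps (id_fun C)"
    and T2: "nat_eq C A V R R (WR C R eta' @ WL C R eps') []"
  defines "\<psi> \<equiv> WL A L eta' @ WR A L' eps"
  shows "cell A C W L \<psi> L'"
    and "nat_eq C C W (fun_comp C L R) (id_fun C) (WR C R \<psi> @ eps') eps"
proof -
  have A: "category A" and C: "category C" and L': "rel_functor A V C W L'"
    and W: "W \<subseteq> Ar C" and V: "V \<subseteq> Ar A" and R: "rel_functor C W A V R"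
    and eps': "cell C C W (fun_comp C L' R) eps' (id_fun C)"
    and eta': "cell A A V (id_fun A) eta' (fun_comp A R L')"
    using adj by (auto simp: half_adj_def)
  note f = rel_functorD[OF L] rel_functorD[OF L'] rel_functorD[OF R]
  have 1: "cell A C W L (WL A L eta') (fun_comp A L (fun_comp A R L'))"
    using cell_WL[OF A L eta'] by (simp add: fun_comp_id[OF A C f(1)])
  have 2: "cell A C W (fun_comp A L (fun_comp A R L')) (WR A L' eps) L'"
    using cell_WR[OF A f(2) eps] by (simp add: fun_comp_id[OF A C f(2)] fun_comp_assoc[OF f(2)])
  show "cell A C W L \<psi> L'" unfolding \<psi>_def using 1 2 by (rule path_append)
  let ?LR = "fun_comp C L R" and ?LR' = "fun_comp C L' R"
  have LR: "rel_functor C W C W ?LR" using rel_functor_comp[OF C R L W] .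
  have 3: "nat_eq C C W (fun_comp C ?LR ?LR') (id_fun C) (WR C ?LR' eps @ eps') (WL C ?LR eps'
      @ eps)"
    using loc_eq.sym[OF interchange[OF C C C LR rel_functor_id[OF C W] eps' eps]]
    by (simp add: W_id[OF C C eps] W_id[OF C C eps'] fun_comp_id[OF C C] functor_id[OF C])
  have 4: "cell C C W ?LR (WR C R (WL A L eta')) (fun_comp C ?LR ?LR')"
    using cell_WR[OF C f(3) 1]
    by (simp add: fun_comp_assoc[OF f(2)] fun_comp_assoc[OF f(3)] del: map_map)
  have 5: "nat_eq C A V R R (WR C R eta' @ WL C R eps') []" by (rule T2)
  have "nat_eq C C W ?LR (id_fun C) (WR C R (WL A L eta') @ WR C ?LR' eps @ eps')
    (WR C R (WL A L eta') @ WL C ?LR eps' @ eps)"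
    by (rule loc_left[OF 4 3])
  also have "WR C R (WL A L eta') @ WL C ?LR eps' @ eps
    = WL C L (WR C R eta' @ WL C R eps') @ eps"
    by (simp add: WL_WL[OF eps'] WL_WR[OF f(3)] del: map_map)
  also have "nat_eq C C W ?LR (id_fun C) (WL C L (WR C R eta' @ WL C R eps') @ eps) (WL C L []
      @ eps)"
    by (rule loc_right[OF eq_WL[OF C L 5] eps])
  finally show "nat_eq C C W ?LR (id_fun C) (WR C R \<psi> @ eps') eps"
    by (simp add: \<psi>_def WR_WR[OF f(3)] del: map_map)
qed

lemma mate_invertible:
  assumes adj: "half_adj A V C W L R eps eta" and adj': "half_adj A V C W L' R eps' eta'"
    and T2: "nat_eq C A V R R (WR C R eta @ WL C R eps) []"
    and T2': "nat_eq C A V R R (WR C R eta' @ WL C R eps') []"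
  shows "inv_paths (fun_cat A C) (objectwise A C W) L L'
    (WL A L eta' @ WR A L' eps) (WL A L' eta @ WR A L eps')"
proof -
  let ?p = "WL A L eta' @ WR A L' eps" and ?q = "WL A L' eta @ WR A L eps'"
  \<comment> \<open>Both \<open>p @ q\<close> and the identity of \<open>L1\<close> are compatible with the counit of \<open>L1\<close>.\<close>
  have key: "nat_eq A C W L1 L1 (p @ q) []"
    if a: "half_adj A V C W L1 R e1 n1" "rel_functor A V C W L2" "cell A C W L1 p L2"
        "cell A C W L2 q L1"
      "nat_eq C C W (fun_comp C L1 R) (id_fun C) (WR C R p @ e2) e1"
      "nat_eq C C W (fun_comp C L2 R) (id_fun C) (WR C R q @ e1) e2"
    for L1 L2 p q e1 e2 n1
  proof (rule adj_unique[OF a(1)])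
    have A: "category A" and C: "category C" and L1: "rel_functor A V C W L1"
      and R: "rel_functor C W A V R" and e1: "cell C C W (fun_comp C L1 R) e1 (id_fun C)"
      using a(1) by (auto simp: half_adj_def)
    show "rel_functor A V C W L1" "cell A C W L1 (p @ q) L1" "cell A C W L1 [] L1"
      using L1 a by (auto intro: path_append simp: fun_cat_simps rel_functor_def)
    have "nat_eq C C W (fun_comp C L1 R) (id_fun C) (WR C R p @ WR C R q @ e1) (WR C R p @ e2)"
      using cell_WR[OF C rel_functorD[OF R] a(3)] a(6) by (rule loc_left)
    also note a(5)
    finally show "nat_eq C C W (fun_comp C L1 R) (id_fun C) (WR C R (p @ q) @ e1) (WR C R [] @ e1)"
      by simp
  qed
  have L: "rel_functor A V C W L" "rel_functor A V C W L'"
    and e: "cell C C W (fun_comp C L R) eps (id_fun C)"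
        "cell C C W (fun_comp C L' R) eps' (id_fun C)"
    using adj adj' by (auto simp: half_adj_def)
  note p = mate_compatible[OF adj' L(1) e(1) T2'] and q = mate_compatible[OF adj L(2) e(2) T2]
  show ?thesis unfolding inv_paths_def
    using p q key[OF adj L(2) p(1) q(1) p(2) q(2)] key[OF adj' L(1) q(1) p(1) q(2) p(2)] by blast
qed

text \<open>Composition of adjunctions.\<close>

lemma half_adj_comp:
  assumes 1: "half_adj A V B U P Q e1 n1" and 2: "half_adj B U C W S R e n"
  shows "half_adj A V C W (fun_comp A S P) (fun_comp C Q R)
    (WL C S (WR C R e1) @ e) (n1 @ WL A Q (WR A P n))"
proof -
  have A: "category A" and B: "category B" and P: "rel_functor A V B U P"
    and U: "U \<subseteq> Ar B" and V: "V \<subseteq> Ar A" and Q: "rel_functor B U A V Q"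
    and e1: "cell B B U (fun_comp B P Q) e1 (id_fun B)"
    and n1: "cell A A V (id_fun A) n1 (fun_comp A Q P)"
    and T1: "nat_eq A B U P P (WL A P n1 @ WR A P e1) []"
    using 1 by (auto simp: half_adj_def)
  have C: "category C" and S: "rel_functor B U C W S"
    and W: "W \<subseteq> Ar C" and R: "rel_functor C W B U R"
    and e: "cell C C W (fun_comp C S R) e (id_fun C)"
    and n: "cell B B U (id_fun B) n (fun_comp B R S)"
    and T: "nat_eq B C W S S (WL B S n @ WR B S e) []"
    using 2 by (auto simp: half_adj_def)
  note f = rel_functorD[OF P] rel_functorD[OF Q] rel_functorD[OF R] rel_functorD[OF S]
  let ?SP = "fun_comp A S P" and ?QR = "fun_comp C Q R"
  have SP: "rel_functor A V C W ?SP" using rel_functor_comp[OF A P S V] .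
  have QR: "rel_functor C W A V ?QR" using rel_functor_comp[OF C R Q W] .
  note f' = rel_functorD[OF SP] rel_functorD[OF QR]
  have e1': "cell C B U (fun_comp C (fun_comp B P Q) R) (WR C R e1) R"
    using cell_WR[OF C f(3) e1] by (simp add: fun_comp_id[OF C B f(3)])
  have e1'': "cell C C W (fun_comp C ?SP ?QR) (WL C S (WR C R e1)) (fun_comp C S R)"
    using cell_WL[OF C S e1']
    by (simp add: fun_comp_assoc[OF f(3)] fun_comp_assoc[OF f(2)] del: map_map)
  have n': "cell A B U P (WR A P n) (fun_comp A (fun_comp B R S) P)"
    using cell_WR[OF A f(1) n] by (simp add: fun_comp_id[OF A B f(1)])
  have n'': "cell A A V (fun_comp A Q P) (WL A Q (WR A P n)) (fun_comp A ?QR ?SP)"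
    using cell_WL[OF A Q n']
    by (simp add: fun_comp_assoc[OF f(1)] fun_comp_assoc[OF f(4)] del: map_map)
  have PQ: "rel_functor B U B U (fun_comp B P Q)" using rel_functor_comp[OF B Q P U] .
  have RSP: "is_functor A B (fun_comp A (fun_comp B R S) P)"
    using functor_fun_comp[OF A f(1) functor_fun_comp[OF B f(4,3)]] .
  \<comment> \<open>Interchange moves the unit of the second adjunction past the counit of the first.\<close>
  have i: "nat_eq A B U (fun_comp A (fun_comp B P Q) P) (fun_comp A (fun_comp B R S) P)
     (WL A (fun_comp B P Q) (WR A P n) @ WR A (fun_comp A (fun_comp B R S) P) e1) (WR A P e1
         @ WR A P n)"
    using interchange[OF A B B PQ rel_functor_id[OF B U] n' e1]
    by (simp add: W_id[OF A B n'] fun_comp_id[OF A B f(1)] fun_comp_id[OF A B RSP] del: map_map)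
  have a1: "cell A B U P (WL A P n1) (fun_comp A (fun_comp B P Q) P)"
    using cell_WL[OF A P n1] by (simp add: fun_comp_id[OF A B f(1)] fun_comp_assoc[OF f(1)])
  have "nat_eq A B U P (fun_comp A (fun_comp B R S) P)
    (WL A P n1 @ WL A (fun_comp B P Q) (WR A P n) @ WR A (fun_comp A (fun_comp B R S) P) e1)
    (WL A P n1 @ WR A P e1 @ WR A P n)"
    by (rule loc_left[OF a1 i])
  also have "nat_eq A B U P (fun_comp A (fun_comp B R S) P) (WL A P n1 @ WR A P e1
      @ WR A P n) (WR A P n)"
    using loc_right[OF T1 n'] by simp
  finally have j: "nat_eq A B U P (fun_comp A (fun_comp B R S) P)
    (WL A P n1 @ WL A (fun_comp B P Q) (WR A P n) @ WR A (fun_comp A (fun_comp B R S) P) e1) (WR A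
        P n)" .
  have k: "cell A C W (fun_comp A S (fun_comp A (fun_comp B R S) P)) (WR A ?SP e) ?SP"
    using cell_WR[OF A f'(1) e]
    by (simp add: fun_comp_id[OF A C f'(1)] fun_comp_id[OF B C f(4)]
        fun_comp_assoc[OF f(1)] fun_comp_assoc[OF f(4)] del: map_map)
  have "nat_eq A C W ?SP ?SP
    (WL A S (WL A P n1 @ WL A (fun_comp B P Q) (WR A P n)
        @ WR A (fun_comp A (fun_comp B R S) P) e1) @ WR A ?SP e)
    (WL A S (WR A P n) @ WR A ?SP e)"
    by (rule loc_right[OF eq_WL[OF A S j] k])
  also have "WL A S (WR A P n) @ WR A ?SP e = WR A P (WL B S n @ WR B S e)"
    by (simp add: WR_WR[OF f(1)] WL_WR[OF f(1)] del: map_map)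
  also have "nat_eq A C W ?SP ?SP (WR A P (WL B S n @ WR B S e)) (WR A P [])"
    by (rule eq_WR[OF A f(1) T])
  finally have tri: "nat_eq A C W ?SP ?SP
    (WL A S (WL A P n1 @ WL A (fun_comp B P Q) (WR A P n)
        @ WR A (fun_comp A (fun_comp B R S) P) e1) @ WR A ?SP e) []"
    by simp
  have E1: "WL A S (WL A P n1) = WL A ?SP n1" by (rule WL_WL[OF n1])
  have E2: "WL A S (WL A (fun_comp B P Q) (WR A P n)) = WL A ?SP (WL A Q (WR A P n))"
    by (simp only: WL_WL[OF n'] fun_comp_assoc[OF f(2)])
  have E3: "WL A S (WR A (fun_comp A (fun_comp B R S) P) e1) = WR A ?SP (WL C S (WR C R e1))"
    by (simp only: WL_WR[OF RSP] WL_WR[OF f(3)] WR_WR[OF f'(1)] fun_comp_assoc[OF f(1)])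
  show ?thesis unfolding half_adj_def
    using A C V W SP QR path_append[OF e1'' e] path_append[OF n1 n''] tri
    by (simp add: E1 E2 E3 del: map_map)
qed

lemma half_adj_post:
  assumes J: "category J" and 1: "half_adj A V C W L R eps eta"
  shows "half_adj (fun_cat J A) (objectwise J A V) (fun_cat J C) (objectwise J C W)
    (post J A L) (post J C R) (PN J C eps) (PN J A eta)"
proof -
  have A: "category A" and C: "category C" and L: "rel_functor A V C W L"
    and W: "W \<subseteq> Ar C" and V: "V \<subseteq> Ar A" and R: "rel_functor C W A V R"
    and eps: "cell C C W (fun_comp C L R) eps (id_fun C)"
    and eta: "cell A A V (id_fun A) eta (fun_comp A R L)"
    and T: "nat_eq A C W L L (WL A L eta @ WR A L eps) []"
    using 1 by (auto simp: half_adj_def)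
  note f = rel_functorD[OF L] rel_functorD[OF R]
  show ?thesis unfolding half_adj_def
  proof (intro conjI)
    show "cell (fun_cat J C) (fun_cat J C) (objectwise J C W)
        (fun_comp (fun_cat J C) (post J A L) (post J C R)) (PN J C eps) (id_fun (fun_cat J C))"
      using cell_PN[OF J C C eps] by (simp add: post_fun_comp[OF J C f(2,1)] post_id[OF J C])
    show "cell (fun_cat J A) (fun_cat J A) (objectwise J A V) (id_fun (fun_cat J A)) (PN J A eta)
        (fun_comp (fun_cat J A) (post J C R) (post J A L))"
      using cell_PN[OF J A A eta] by (simp add: post_fun_comp[OF J A f] post_id[OF J A])
    show "nat_eq (fun_cat J A) (fun_cat J C) (objectwise J C W) (post J A L) (post J A L)
        (WL (fun_cat J A) (post J A L) (PN J A eta)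
          @ WR (fun_cat J A) (post J A L) (PN J C eps)) []"
      using eq_PN[OF J A C T]
      by (simp add: PN_WL[OF J A f(1) eta] PN_WR[OF J A f(1) eps] del: map_map)
  qed (use J A C L R in \<open>simp_all add: category_fun_cat objectwise_ar rel_functor_post\<close>)
qed

section \<open>Constant objects, precomposition and diagonals\<close>

lemma functor_const:
  assumes "category J" "category D" "A \<in> Ob D"
  shows "is_functor J D (const_fun J D A)"
  unfolding const_fun_def using assms
  by (intro is_functorI) (auto simp: hom_iff cat_idn cat_unit)

lemma const_fun_simps [simp]:
  "j \<in> Ob J \<Longrightarrow> fob (const_fun J D A) j = A" "u \<in> Ar J \<Longrightarrow> far (const_fun J D A) u = idn D A"
  by (simp_all add: const_fun_def)

lemma nat_const:
  assumes "category J" "category D" "f \<in> Ar D"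
  shows "is_nat_trans J D (NT (const_fun J D (dm D f)) (const_fun J D (cd D f)) (\<lambda>j\<in>Ob J. f))"
  using assms functor_const[OF assms(1,2)]
  by (intro is_nat_transI) (auto simp: hom_iff cat_dm cat_cd cat_unit)

lemma diag_fun_simps [simp]:
  "A \<in> Ob D \<Longrightarrow> fob (diag_fun J D) A = const_fun J D A"
  "f \<in> Ar D \<Longrightarrow> far (diag_fun J D) f
    = NT (const_fun J D (dm D f)) (const_fun J D (cd D f)) (\<lambda>j\<in>Ob J. f)"
  by (simp_all add: diag_fun_def)

lemma functor_diag_fun:
  assumes "category J" "category D"
  shows "is_functor D (fun_cat J D) (diag_fun J D)"
  unfolding diag_fun_def
  using assms functor_const[OF assms] nat_const[OF assms]
  by (intro is_functorI)
    (auto simp: fun_cat_simps hom_fun_cat cat_cmp cat_idn intro!: restrict_ext)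

lemma rel_functor_diag_fun:
  assumes "category J" "category D" "E \<subseteq> Ar D"
  shows "rel_functor D E (fun_cat J D) (objectwise J D E) (diag_fun J D)"
  using functor_diag_fun[OF assms(1,2)] assms nat_const[OF assms(1,2)]
  by (auto simp: rel_functor_def objectwise_iff subset_eq)

lemma fun_comp_const:
  assumes "category J" "category A" "is_functor A B F" "a \<in> Ob A"
  shows "fun_comp J F (const_fun J A a) = const_fun J B (fob F a)"
  using assms by (auto simp: fun_comp_def const_fun_def functor_simps cat_dm cat_cd intro!:
      restrict_ext)

text \<open>The constant functor is natural: \<open>F\<close> applied to a constant diagram is constant.\<close>

lemma post_diag_fun:
  assumes "category J" "category A" "is_functor A B F"
  shows "fun_comp A (post J A F) (diag_fun J A) = fun_comp A (diag_fun J B) F"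
  unfolding fun_comp_def[of A]
  using assms functor_const[OF assms(1,2)] nat_const[OF assms(1,2)]
  by (auto simp: functor_simps post_simps fun_comp_const[OF assms] cat_dm cat_cd whisk_left_def
     intro!: restrict_ext)

lemma post_nt_diag_fun:
  assumes "category J" "category A" "is_nat_trans A B \<alpha>"
  shows "whisk_right A (post_nt J A \<alpha>) (diag_fun J A) = whisk_left A (diag_fun J B) \<alpha>"
  using assms post_diag_fun[OF assms(1,2) nat_functors(1)[OF assms(3)]]
    post_diag_fun[OF assms(1,2) nat_functors(2)[OF assms(3)]] functor_const[OF assms(1,2)]
    fun_comp_const[OF assms(1,2) nat_functors(1)[OF assms(3)]]
    fun_comp_const[OF assms(1,2) nat_functors(2)[OF assms(3)]]
  by (auto simp: whisk_right_def whisk_left_def post_nt_simps nat_cpt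
       cong: restrict_cong intro!: restrict_ext)

text \<open>\<open>pre A B D K : Fun(B,D) \<rightarrow> Fun(A,D)\<close> is precomposition with \<open>K : A \<rightarrow> B\<close>, and
  \<open>pre_nt A B D \<alpha>\<close> is the transformation \<open>pre K \<rightarrow> pre K'\<close> induced by \<open>\<alpha> : K \<rightarrow> K'\<close>.\<close>

definition pre where
  "pre A B D K = Func (\<lambda>X\<in>Ob (fun_cat B D). fun_comp A X K)
      (\<lambda>\<phi>\<in>Ar (fun_cat B D). whisk_right A \<phi> K)"

definition pre_nt where
  "pre_nt A B D \<alpha> = NT (pre A B D (src \<alpha>)) (pre A B D (tgt \<alpha>))
      (\<lambda>X\<in>Ob (fun_cat B D). whisk_left A X \<alpha>)"

lemma pre_simps:
  "is_functor B D X \<Longrightarrow> fob (pre A B D K) X = fun_comp A X K"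
  "is_nat_trans B D \<phi> \<Longrightarrow> far (pre A B D K) \<phi> = whisk_right A \<phi> K"
  "src (pre_nt A B D \<alpha>) = pre A B D (src \<alpha>)" "tgt (pre_nt A B D \<alpha>) = pre A B D (tgt \<alpha>)"
  "is_functor B D X \<Longrightarrow> cpt (pre_nt A B D \<alpha>) X = whisk_left A X \<alpha>"
  by (simp_all add: pre_def pre_nt_def fun_cat_simps)

lemma functor_pre:
  assumes "category A" "category B" "category D" "is_functor A B K"
  shows "is_functor (fun_cat B D) (fun_cat A D) (pre A B D K)"
  unfolding pre_def using assms functor_fun_comp[OF assms(1,4)] nat_whisk_right[OF assms(1) _
      assms(4)]
    whisk_right_cmp[OF assms(4)] whisk_right_idn[OF assms(4)]
  by (intro is_functorI category_fun_cat)
    (auto simp: fun_cat_simps hom_fun_cat simp del: fun_cat_dc(3,4))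

lemma nat_pre:
  assumes "category A" "category B" "category D" "is_nat_trans A B \<alpha>"
  shows "is_nat_trans (fun_cat B D) (fun_cat A D) (pre_nt A B D \<alpha>)"
  unfolding pre_nt_def
proof (rule is_nat_transI)
  note f = nat_functors[OF assms(4)]
  show "is_functor (fun_cat B D) (fun_cat A D) (pre A B D (src \<alpha>))"
       "is_functor (fun_cat B D) (fun_cat A D) (pre A B D (tgt \<alpha>))"
    using functor_pre assms f by blast+
  show "category (fun_cat B D)" using assms category_fun_cat by blast
  show "whisk_left A X \<alpha> \<in> hom (fun_cat A D) (fob (pre A B D (src \<alpha>)) X) (fob (pre A B D (tgt \<alpha>))
      X)"
    if "X \<in> Ob (fun_cat B D)" for X
    using that nat_whisk_left[OF assms(1,4)] by (auto simp: hom_fun_cat pre_simps fun_cat_simps)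
  fix \<phi> assume "\<phi> \<in> Ar (fun_cat B D)"
  then show "cmp (fun_cat A D) (whisk_left A (cd (fun_cat B D) \<phi>) \<alpha>) (far (pre A B D (src \<alpha>)) \<phi>) =
         cmp (fun_cat A D) (far (pre A B D (tgt \<alpha>)) \<phi>) (whisk_left A (dm (fun_cat B D) \<phi>) \<alpha>)"
    using whisk_interchange[OF assms(4), of D \<phi>] by (simp add: pre_simps fun_cat_simps)
qed

lemma pre_nt_idn:
  assumes "category A" "category B" "category D" "is_functor A B K"
  shows "pre_nt A B D (idn (fun_cat A B) K) = idn (fun_cat (fun_cat B D) (fun_cat A D)) (pre A B D
      K)"
  using assms
  by (auto simp: pre_nt_def fun_cat_simps pre_simps whisk_left_def functor_simps intro!:
      restrict_ext)

lemma pre_nt_cmp: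
  assumes "is_nat_trans A B \<alpha>" "is_nat_trans A B \<beta>" "tgt \<alpha> = src \<beta>"
  shows "pre_nt A B D (cmp (fun_cat A B) \<beta> \<alpha>)
    = cmp (fun_cat (fun_cat B D) (fun_cat A D)) (pre_nt A B D \<beta>) (pre_nt A B D \<alpha>)"
  using assms
  by (auto simp: pre_nt_def fun_cat_simps pre_simps whisk_left_def functor_simps nat_cpt
     intro!: restrict_ext)

text \<open>The functor \<open>Fun(B,D) \<rightarrow> Fun(Fun(J,B), Fun(J,D))\<close>, \<open>X \<mapsto> post J B X\<close>.\<close>

definition post_fun where
  "post_fun J B D = Func (\<lambda>X\<in>Ob (fun_cat B D). post J B X) (\<lambda>\<phi>\<in>Ar (fun_cat B D). post_nt J B \<phi>)"

lemma post_fun_simps: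
  "is_functor B D X \<Longrightarrow> fob (post_fun J B D) X = post J B X"
  "is_nat_trans B D \<phi> \<Longrightarrow> far (post_fun J B D) \<phi> = post_nt J B \<phi>"
  by (simp_all add: post_fun_def fun_cat_simps)

lemma functor_post_fun:
  assumes "category J" "category B" "category D"
  shows "is_functor (fun_cat B D) (fun_cat (fun_cat J B) (fun_cat J D)) (post_fun J B D)"
  unfolding post_fun_def
  using assms functor_post nat_post post_nt_idn post_nt_cmp
  by (intro is_functorI category_fun_cat)
    (auto simp: fun_cat_simps hom_fun_cat post_nt_simps simp del: fun_cat_dc(3,4))

lemma category_delta: "category delta_cat"
proof
  fix f :: dmor and a b c d g h
  show "f \<in> hom delta_cat a b \<Longrightarrow> g \<in> hom delta_cat b c \<Longrightarrow> cmp delta_cat g f \<in> hom delta_cat a c"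
    by (cases f; cases g)
      (auto simp: delta_cat_def hom_iff compose_def mono_on_def PiE_iff extensional_def subset_eq)
  show "f \<in> hom delta_cat a b \<Longrightarrow> cmp delta_cat f (idn delta_cat a) = f"
    by (cases f) (auto simp: delta_cat_def hom_iff PiE_iff extensional_def compose_def)
  show "f \<in> hom delta_cat a b \<Longrightarrow> cmp delta_cat (idn delta_cat b) f = f"
    by (cases f) (auto simp: delta_cat_def hom_iff PiE_iff extensional_def compose_def)
  show "f \<in> hom delta_cat a b \<Longrightarrow> g \<in> hom delta_cat b c \<Longrightarrow> h \<in> hom delta_cat c d \<Longrightarrow>
      cmp delta_cat h (cmp delta_cat g f) = cmp delta_cat (cmp delta_cat h g) f"
    by (cases f; cases g; cases h)
      (auto simp: delta_cat_def hom_iff PiE_iff extensional_def compose_def)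
qed (auto simp: delta_cat_def hom_iff mono_on_def)

lemmas category_dop = category_op[OF category_delta]

lemma Ob_dop [simp]: "Ob delta_op = UNIV" "n \<in> Ob delta_op"
  by (simp_all add: op_cat_simps delta_cat_def)

text \<open>The diagonal of a single bisimplicial object.\<close>

definition diag_ob where
  "diag_ob D Z = Func (\<lambda>n\<in>Ob delta_op. fob (fob Z n) n)
           (\<lambda>u\<in>Ar delta_op. cmp D (cpt (far Z u) (cd delta_op u)) (far (fob Z (dm delta_op u)) u))"

lemma diagonal_simps:
  "is_functor delta_op (simp_cat D) Z \<Longrightarrow> fob (diagonal D) Z = diag_ob D Z"
  "is_nat_trans delta_op (simp_cat D) \<phi> \<Longrightarrow> far (diagonal D) \<phi>
    = NT (diag_ob D (src \<phi>)) (diag_ob D (tgt \<phi>)) (\<lambda>n\<in>Ob delta_op. cpt (cpt \<phi> n) n)"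
  by (simp_all add: diagonal_def diag_ob_def Let_def fun_cat_simps)

lemma diag_ob_simps:
  "fob (diag_ob D Z) n = fob (fob Z n) n"
  "u \<in> Ar delta_op \<Longrightarrow> far (diag_ob D Z) u
    = cmp D (cpt (far Z u) (cd delta_op u)) (far (fob Z (dm delta_op u)) u)"
  by (simp_all add: diag_ob_def)

lemma functor_diag_ob:
  assumes D: "category D" and Z: "is_functor delta_op (simp_cat D) Z"
  shows "is_functor delta_op D (diag_ob D Z)"
proof -
  note J = category_dop
  have Zn: "is_functor delta_op D (fob Z n)" for n
    using functor_ob[OF Z, of n] by (simp add: fun_cat_simps)
  have Zu: "is_nat_trans delta_op D (far Z u)" "src (far Z u) = fob Z (dm delta_op u)"
    "tgt (far Z u) = fob Z (cd delta_op u)" if "u \<in> Ar delta_op" for u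
    using functor_ar[OF Z that] by (simp_all add: fun_cat_simps)
  note f = functor_simps[OF Zn]
  have Zc: "cpt (far Z u) n \<in> Ar D" "dm D (cpt (far Z u) n) = fob (fob Z (dm delta_op u)) n"
    "cd D (cpt (far Z u) n) = fob (fob Z (cd delta_op u)) n" if "u \<in> Ar delta_op" for u n
    using nat_cpt[OF Zu(1)[OF that], of n] Zu[OF that] by auto
  show ?thesis unfolding diag_ob_def
  proof (rule is_functorI[OF J])
    fix u assume u: "u \<in> Ar delta_op"
    show "cmp D (cpt (far Z u) (cd delta_op u)) (far (fob Z (dm delta_op u)) u) \<in>
         hom D (fob (fob Z (dm delta_op u)) (dm delta_op u)) (fob (fob Z (cd delta_op u)) (cd
           delta_op u))"
      using u Zc[OF u] f by (simp add: hom_iff cat_cmp[OF D])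
  next
    fix n
    show "cmp D (cpt (far Z (idn delta_op n)) (cd delta_op (idn delta_op n)))
          (far (fob Z (dm delta_op (idn delta_op n))) (idn delta_op n)) = idn D (fob (fob Z n) n)"
      using functor_idn[OF Z, of n] f by (simp add: cat_idn[OF J] cat_unit[OF D] cat_idn[OF D])
  next
    fix u v assume uv: "u \<in> Ar delta_op" "v \<in> Ar delta_op" "cd delta_op u = dm delta_op v"
    let ?n = "dm delta_op u" and ?l = "cd delta_op v"
    let ?m = "dm delta_op v"
    have "cpt (far Z (cmp delta_op v u)) ?l = cmp D (cpt (far Z v) ?l) (cpt (far Z u) ?l)"
      using functor_cmp[OF Z uv] by simp
    moreover have "far (fob Z ?n) (cmp delta_op v u) = cmp D (far (fob Z ?n) v) (far (fob Z ?n) u)"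
      using uv f by simp
    \<comment> \<open>Horizontal and vertical operators of \<open>Z\<close> commute.\<close>
    moreover have "cmp D (cpt (far Z u) ?l) (far (fob Z ?n) v)
      = cmp D (far (fob Z ?m) v) (cpt (far Z u) ?m)"
      using nat_square[OF Zu(1)[OF uv(1)] uv(2)] Zu[OF uv(1)] uv by simp
    then have "cmp D (cpt (far Z u) ?l) (cmp D (far (fob Z ?n) v) (far (fob Z ?n) u))
      = cmp D (far (fob Z ?m) v) (cmp D (cpt (far Z u) ?m) (far (fob Z ?n) u))"
      using uv Zc f by (simp add: cat_assoc[OF D])
    ultimately show "cmp D (cpt (far Z (cmp delta_op v u)) (cd delta_op (cmp delta_op v u)))
        (far (fob Z (dm delta_op (cmp delta_op v u))) (cmp delta_op v u)) =
       cmp D (cmp D (cpt (far Z v) (cd delta_op v)) (far (fob Z (dm delta_op v)) v))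
        (cmp D (cpt (far Z u) (cd delta_op u)) (far (fob Z (dm delta_op u)) u))"
      using uv Zc f by (simp add: cat_cmp[OF J] cat_cmp[OF D] flip: cat_assoc[OF D])
  qed (use Zn f in auto)
qed

lemma nat_diagonal:
  assumes D: "category D" and \<phi>: "is_nat_trans delta_op (simp_cat D) \<phi>"
  shows "is_nat_trans delta_op D (far (diagonal D) \<phi>)"
proof -
  note J = category_dop
  note f = nat_functors[OF \<phi>]
  have Zn: "is_functor delta_op D (fob Z n)" if "is_functor delta_op (simp_cat D) Z" for Z n
    using functor_ob[OF that, of n] by (simp add: fun_cat_simps)
  have Zc: "cpt (far Z u) n \<in> Ar D" "dm D (cpt (far Z u) n) = fob (fob Z (dm delta_op u)) n"
    "cd D (cpt (far Z u) n) = fob (fob Z (cd delta_op u)) n"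
    if "u \<in> Ar delta_op" "is_functor delta_op (simp_cat D) Z" for u n Z
    using functor_ar[OF that(2,1)] nat_cpt[of delta_op D "far Z u" n]
    by (auto simp: fun_cat_simps)
  have c: "is_nat_trans delta_op D (cpt \<phi> n)" "src (cpt \<phi> n) = fob (src \<phi>) n" "tgt (cpt \<phi> n)
      = fob (tgt \<phi>) n" for n
    using nat_cpt[OF \<phi>, of n] by (simp_all add: fun_cat_simps)
  have cc: "cpt (cpt \<phi> n) m \<in> Ar D" "dm D (cpt (cpt \<phi> n) m) = fob (fob (src \<phi>) n) m"
    "cd D (cpt (cpt \<phi> n) m) = fob (fob (tgt \<phi>) n) m" for n m
    using nat_cpt[OF c(1), of m n] c by auto
  show ?thesis unfolding diagonal_simps(2)[OF \<phi>]
  proof (rule is_nat_transI[OF functor_diag_ob[OF D f(1)] functor_diag_ob[OF D f(2)] J])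
    fix u assume u: "u \<in> Ar delta_op"
    let ?n = "dm delta_op u" and ?m = "cd delta_op u"
    let ?X = "src \<phi>" and ?Y = "tgt \<phi>"
    note g = functor_ar[OF Zn[OF f(1)] u] functor_ar[OF Zn[OF f(2)] u] Zc[OF u f(1)] Zc[OF u f(2)]
        cc
    have 1: "cmp D (cpt (cpt \<phi> ?m) k) (cpt (far ?X u) k)
        = cmp D (cpt (far ?Y u) k) (cpt (cpt \<phi> ?n) k)" for k
    proof -
      have "cpt (cmp (simp_cat D) (cpt \<phi> ?m) (far ?X u)) k
        = cpt (cmp (simp_cat D) (far ?Y u) (cpt \<phi> ?n)) k"
        using nat_square[OF \<phi> u] by simp
      then show ?thesis by simp
    qed
    have 2: "cmp D (cpt (cpt \<phi> ?n) ?m) (far (fob ?X ?n) u)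
        = cmp D (far (fob ?Y ?n) u) (cpt (cpt \<phi> ?n) ?n)"
      using nat_square[OF c(1) u, of ?n] c by simp
    have "cmp D (cpt (cpt \<phi> ?m) ?m) (cmp D (cpt (far ?X u) ?m) (far (fob ?X ?n) u))
      = cmp D (cpt (far ?Y u) ?m) (cmp D (cpt (cpt \<phi> ?n) ?m) (far (fob ?X ?n) u))"
      using g 1 by (simp add: cat_assoc[OF D])
    also have "\<dots> = cmp D (cmp D (cpt (far ?Y u) ?m) (far (fob ?Y ?n) u)) (cpt (cpt \<phi> ?n) ?n)"
      using g 2 by (simp add: cat_assoc[OF D])
    finally show "cmp D (cpt (cpt \<phi> (cd delta_op u)) (cd delta_op u)) (far (diag_ob D (src \<phi>)) u) =
         cmp D (far (diag_ob D (tgt \<phi>)) u) (cpt (cpt \<phi> (dm delta_op u)) (dm delta_op u))"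
      using u by (simp add: diag_ob_simps)
  qed (simp add: hom_iff diag_ob_simps cc)
qed

lemma diagonal_cpt: "is_nat_trans delta_op (simp_cat D) \<phi> \<Longrightarrow> cpt (far (diagonal D) \<phi>) n
    = cpt (cpt \<phi> n) n"
  "is_nat_trans delta_op (simp_cat D) \<phi> \<Longrightarrow> src (far (diagonal D) \<phi>) = diag_ob D (src \<phi>)"
  "is_nat_trans delta_op (simp_cat D) \<phi> \<Longrightarrow> tgt (far (diagonal D) \<phi>) = diag_ob D (tgt \<phi>)"
  by (simp_all add: diagonal_simps)

lemma functor_diagonal:
  assumes D: "category D"
  shows "is_functor (bisimp_cat D) (simp_cat D) (diagonal D)"
proof -
  note J = category_dop note S = category_fun_cat[OF J D]
  have r: "diagonal D = Func (restrict (\<lambda>Z. diag_ob D Z) (Ob (bisimp_cat D)))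
     (restrict (\<lambda>\<phi>. far (diagonal D) \<phi>) (Ar (bisimp_cat D)))"
    by (simp add: diagonal_def diag_ob_def[abs_def] Let_def cong: restrict_cong)
  show ?thesis
  proof (subst r, rule is_functorI[OF category_fun_cat[OF J S]])
    fix Z assume "Z \<in> Ob (bisimp_cat D)"
    then have Z: "is_functor delta_op (simp_cat D) Z" by (simp add: fun_cat_simps)
    then show "diag_ob D Z \<in> Ob (simp_cat D)" using functor_diag_ob[OF D]
        by (simp add: fun_cat_simps)
    show "far (diagonal D) (idn (bisimp_cat D) Z) = idn (simp_cat D) (diag_ob D Z)"
      using nat_idn[OF J S Z] by (simp add: diagonal_simps diag_ob_simps)
  next
    fix \<phi> assume "\<phi> \<in> Ar (bisimp_cat D)"
    then show "far (diagonal D) \<phi> \<in> hom (simp_cat D) (diag_ob D (dm (bisimp_cat D) \<phi>)) (diag_ob D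
        (cd (bisimp_cat D) \<phi>))"
      using nat_diagonal[OF D] by (simp add: fun_cat_simps hom_fun_cat diagonal_simps)
  next
    fix \<phi> \<psi> assume "\<phi> \<in> Ar (bisimp_cat D)" "\<psi> \<in> Ar (bisimp_cat D)" "cd (bisimp_cat D) \<phi>
        = dm (bisimp_cat D) \<psi>"
    then have h: "is_nat_trans delta_op (simp_cat D) \<phi>" "is_nat_trans delta_op (simp_cat D) \<psi>"
        "tgt \<phi> = src \<psi>"
      by (simp_all add: fun_cat_simps)
    show "far (diagonal D) (cmp (bisimp_cat D) \<psi> \<phi>)
      = cmp (simp_cat D) (far (diagonal D) \<psi>) (far (diagonal D) \<phi>)"
      using h nat_cmp[OF J S h] by (simp add: diagonal_simps)
  qed
qed

lemma rel_functor_diagonal: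
  "category D \<Longrightarrow> rel_functor (bisimp_cat D) (objectwise delta_op (simp_cat D) (objectwise delta_op
      D E))
    (simp_cat D) (objectwise delta_op D E) (diagonal D)"
  by (auto simp: rel_functor_def functor_diagonal objectwise_iff nat_diagonal diagonal_cpt)

lemma diag_ob_const:
  assumes "category A" "is_functor delta_op A X"
  shows "diag_ob A (const_fun delta_op (simp_cat A) X) = X"
      "diag_ob A (fun_comp delta_op (const_s A) X) = X"
proof -
  note J = category_dop and S = category_fun_cat[OF category_dop assms(1)] and x
      = functor_simps[OF assms(2)]
  have c: "is_functor delta_op (simp_cat A) (const_fun delta_op (simp_cat A) X)"
    using functor_const[OF J S] assms(2) by (simp add: fun_cat_simps)
  note f = functor_fun_comp[OF J assms(2) functor_diag_fun[OF J assms(1)]]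
  show "diag_ob A (const_fun delta_op (simp_cat A) X) = X"
    by (rule func_eqI[OF functor_diag_ob[OF assms(1) c] assms(2)])
      (simp_all add: diag_ob_simps x cat_unit[OF assms(1)])
  show "diag_ob A (fun_comp delta_op (const_s A) X) = X"
    by (rule func_eqI[OF functor_diag_ob[OF assms(1) f] assms(2)])
      (simp_all add: diag_ob_simps x cat_unit[OF assms(1)] cat_dm[OF J])
qed

section \<open>Joins of ordinals and simplicial homotopies\<close>

text \<open>The arrow \<open>[n] \<rightarrow> [m]\<close> of \<open>\<Delta>\<close> with underlying function \<open>f\<close>, and the underlying function of
  an arrow.\<close>

definition dmap :: "nat \<Rightarrow> nat \<Rightarrow> (nat \<Rightarrow> nat) \<Rightarrow> dmor" where
  "dmap n m f = (n, m, restrict f {..n})"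

abbreviation dfun :: "dmor \<Rightarrow> nat \<Rightarrow> nat" where "dfun u \<equiv> snd (snd u)"

lemma dmap_simps [simp]:
  "dm delta_cat (dmap n m f) = n" "cd delta_cat (dmap n m f) = m" "i \<le> n \<Longrightarrow> dfun (dmap n m f) i
      = f i"
  by (simp_all add: delta_cat_def dmap_def)

lemma dmap_Ar:
  assumes "\<And>i. i \<le> n \<Longrightarrow> f i \<le> m" "\<And>i j. i \<le> j \<Longrightarrow> j \<le> n \<Longrightarrow> f i \<le> f j"
  shows "dmap n m f \<in> Ar delta_cat"
  using assms by (auto simp: dmap_def delta_cat_def mono_on_def)

lemma dmap_cmp [simp]:
  "(\<And>i. i \<le> n \<Longrightarrow> f i \<le> m) \<Longrightarrow> cmp delta_cat (dmap m k g) (dmap n m f) = dmap n k (\<lambda>i. g (f i))"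
  by (auto simp: dmap_def delta_cat_def compose_def intro!: restrict_ext)

lemma dmap_eqI: "n = n' \<Longrightarrow> m = m' \<Longrightarrow> (\<And>i. i \<le> n \<Longrightarrow> f i = g i) \<Longrightarrow> dmap n m f = dmap n' m' g"
  by (auto simp: dmap_def intro!: restrict_ext)

lemma dmap_idn: "idn delta_cat n = dmap n n (\<lambda>i. i)"
  by (simp add: dmap_def delta_cat_def)

lemma dmap_cases:
  assumes "u \<in> Ar delta_cat"
  obtains n m f where "u = dmap n m f" "\<And>i. i \<le> n \<Longrightarrow> f i \<le> m"
    "\<And>i j. i \<le> j \<Longrightarrow> j \<le> n \<Longrightarrow> f i \<le> f j"
proof -
  obtain n m f where u: "u = (n, m, f)" by (cases u)
  then have "u = dmap n m f"
    using assms by (auto simp: dmap_def delta_cat_def PiE_iff extensional_def)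
  then show thesis
    by (rule that) (use u assms in \<open>auto simp: delta_cat_def mono_on_def PiE_iff\<close>)
qed

lemma dmap_hom_cases:
  assumes "u \<in> hom delta_cat n m"
  obtains f where "u = dmap n m f" "\<And>i. i \<le> n \<Longrightarrow> f i \<le> m"
    "\<And>i j. i \<le> j \<Longrightarrow> j \<le> n \<Longrightarrow> f i \<le> f j"
proof -
  from assms have "u \<in> Ar delta_cat" "dm delta_cat u = n" "cd delta_cat u = m"
    by (simp_all add: hom_iff)
  then show thesis using that by (elim dmap_cases) auto
qed

text \<open>The join \<open>f * u\<close> of arrows of \<open>\<Delta>\<close>. On objects \<open>[n] * [m] = [n+1+m]\<close>: the first \<open>n+1\<close>
  vertices are those of \<open>[n]\<close>, and \<open>n+1+j\<close> is the vertex \<open>j\<close> of \<open>[m]\<close>.\<close>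

definition join :: "dmor \<Rightarrow> dmor \<Rightarrow> dmor" where
  "join f u = dmap (dm delta_cat f + 1 + dm delta_cat u) (cd delta_cat f + 1 + cd delta_cat u)
    (\<lambda>i. if i \<le> dm delta_cat f then dfun f i else cd delta_cat f + 1 + dfun u (i - dm delta_cat f
        - 1))"

lemma join_dmap: "join (dmap n n' f) (dmap m m' g)
  = dmap (n + 1 + m) (n' + 1 + m') (\<lambda>i. if i \<le> n then f i else n' + 1 + g (i - n - 1))"
  by (auto simp: join_def intro!: dmap_eqI)

lemma join_Ar:
  assumes "f \<in> Ar delta_cat" "u \<in> Ar delta_cat"
  shows "join f u \<in> Ar delta_cat"
proof -
  obtain n n' f' m m' u' where h: "f = dmap n n' f'" "u = dmap m m' u'"
    "\<And>i. i \<le> n \<Longrightarrow> f' i \<le> n'" "\<And>i j. i \<le> j \<Longrightarrow> j \<le> n \<Longrightarrow> f' i \<le> f' j"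
    "\<And>i. i \<le> m \<Longrightarrow> u' i \<le> m'" "\<And>i j. i \<le> j \<Longrightarrow> j \<le> m \<Longrightarrow> u' i \<le> u' j"
    using assms by (elim dmap_cases) blast
  have "f' i \<le> n' + 1 + x" if "i \<le> n" for i x using h(3)[OF that] by simp
  then show ?thesis unfolding h join_dmap using h(3-) by (intro dmap_Ar) auto
qed

lemma join_dc [simp]:
  "dm delta_cat (join f u) = dm delta_cat f + 1 + dm delta_cat u"
  "cd delta_cat (join f u) = cd delta_cat f + 1 + cd delta_cat u"
  by (simp_all add: join_def)

lemma join_cmp:
  assumes "f \<in> Ar delta_cat" "g \<in> Ar delta_cat" "u \<in> Ar delta_cat" "v \<in> Ar delta_cat"
    and "cd delta_cat f = dm delta_cat g" "cd delta_cat u = dm delta_cat v"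
  shows "join (cmp delta_cat g f) (cmp delta_cat v u) = cmp delta_cat (join g v) (join f u)"
proof -
  obtain n n' f' m m' u' where h: "f = dmap n n' f'" "u = dmap m m' u'"
    "\<And>i. i \<le> n \<Longrightarrow> f' i \<le> n'" "\<And>i. i \<le> m \<Longrightarrow> u' i \<le> m'"
    using assms(1,3) by (elim dmap_cases) blast
  obtain n1 n2 g' m1 m2 v' where k: "g = dmap n1 n2 g'" "v = dmap m1 m2 v'"
    using assms(2,4) by (elim dmap_cases) blast
  have e: "n1 = n'" "m1 = m'" using assms(5,6) h k by auto
  have 1: "(if i \<le> n then f' i else n' + 1 + u' (i - n - 1)) \<le> n' + 1 + m'" if "i \<le> n + 1 + m" for i
    using h(3)[of i] h(4)[of "i - n - 1"] that by auto
  show ?thesis unfolding h(1,2) k e using h(3,4) 1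
    by (auto simp: join_dmap le_diff_conv intro!: dmap_eqI dest!: h(3))
qed

lemma join_idn: "join (idn delta_cat n) (idn delta_cat m) = idn delta_cat (n + 1 + m)"
  by (auto simp: dmap_idn join_dmap intro!: dmap_eqI)

lemmas dop_simps = op_cat_simps cat_idn[OF category_delta] cat_cmp[OF category_delta]
  cat_unit[OF category_delta]

lemma Ob_delta [simp]: "Ob delta_cat = UNIV" by (simp add: delta_cat_def)

text \<open>For fixed \<open>n\<close>, the functor \<open>[m] \<mapsto> [n] * [m]\<close> on \<open>\<Delta>\<^sup>o\<^sup>p\<close>; the transformations between these
  induced by arrows of \<open>\<Delta>\<close>; and the resulting functor \<open>\<Delta>\<^sup>o\<^sup>p \<rightarrow> Fun(\<Delta>\<^sup>o\<^sup>p, \<Delta>\<^sup>o\<^sup>p)\<close>.\<close>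

definition shift_fun :: "nat \<Rightarrow> (nat, dmor, nat, dmor) func" where
  "shift_fun n = Func (\<lambda>m\<in>Ob delta_op. n + 1 + m) (\<lambda>u\<in>Ar delta_op. join (idn delta_cat n) u)"

lemma shift_fun_simps [simp]: "fob (shift_fun n) m = n + 1 + m"
  "u \<in> Ar delta_cat \<Longrightarrow> far (shift_fun n) u = join (idn delta_cat n) u"
  by (simp_all add: shift_fun_def op_cat_simps)

lemma functor_shift_fun: "is_functor delta_op delta_op (shift_fun n)"
  unfolding shift_fun_def using category_dop
  by (intro is_functorI)
    (auto simp: hom_iff dop_simps join_Ar join_idn simp flip: join_cmp)

definition shift_nt :: "dmor \<Rightarrow> (nat, dmor, nat, dmor) nt" where
  "shift_nt f = NT (shift_fun (cd delta_cat f)) (shift_fun (dm delta_cat f))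
      (\<lambda>m\<in>Ob delta_op. join f (idn delta_cat m))"

lemma nat_shift_nt:
  assumes "f \<in> Ar delta_cat"
  shows "is_nat_trans delta_op delta_op (shift_nt f)"
  unfolding shift_nt_def using category_dop functor_shift_fun assms
  by (intro is_nat_transI)
    (auto simp: hom_iff dop_simps join_Ar simp flip: join_cmp)

definition join_fun :: "(nat, dmor, (nat, dmor, nat, dmor) func, (nat, dmor, nat, dmor) nt) func"
    where
  "join_fun = Func (\<lambda>n\<in>Ob delta_op. shift_fun n) (\<lambda>f\<in>Ar delta_op. shift_nt f)"

lemma join_fun_simps [simp]: "fob join_fun n = shift_fun n" "f \<in> Ar delta_cat \<Longrightarrow> far join_fun f
    = shift_nt f"
  by (simp_all add: join_fun_def op_cat_simps)

lemma functor_join_fun: "is_functor delta_op (fun_cat delta_op delta_op) join_fun"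
  unfolding join_fun_def using category_dop functor_shift_fun nat_shift_nt
  by (intro is_functorI)
    (auto simp: fun_cat_simps hom_fun_cat shift_nt_def dop_simps join_idn simp flip: join_cmp
        intro!: restrict_ext)

text \<open>The inclusions of \<open>[n]\<close> and \<open>[m]\<close> into \<open>[n] * [m]\<close>, and the retraction onto \<open>[n]\<close>
  collapsing \<open>[m]\<close> to the last vertex \<open>n\<close>.\<close>

definition join_in1 :: "nat \<Rightarrow> nat \<Rightarrow> dmor" where "join_in1 n m = dmap n (n + 1 + m) (\<lambda>i. i)"
definition join_in2 :: "nat \<Rightarrow> nat \<Rightarrow> dmor" where "join_in2 n m = dmap m (n + 1 + m) (\<lambda>j. n + 1 + j)"
definition join_collapse :: "nat \<Rightarrow> nat \<Rightarrow> dmor" where "join_collapse n m = dmap (n + 1 + m) n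
    (\<lambda>i. min i n)"

lemma join_in_Ar [simp]: "join_in1 n m \<in> Ar delta_cat" "join_in2 n m \<in> Ar delta_cat"
    "join_collapse n m \<in> Ar delta_cat"
  by (auto simp: join_in1_def join_in2_def join_collapse_def intro!: dmap_Ar)

lemma join_in_dc [simp]:
  "dm delta_cat (join_in1 n m) = n" "cd delta_cat (join_in1 n m) = n + 1 + m"
  "dm delta_cat (join_in2 n m) = m" "cd delta_cat (join_in2 n m) = n + 1 + m"
  "dm delta_cat (join_collapse n m) = n + 1 + m" "cd delta_cat (join_collapse n m) = n"
  by (simp_all add: join_in1_def join_in2_def join_collapse_def)

lemma join_in_natural:
  assumes "f \<in> Ar delta_cat" "u \<in> Ar delta_cat"
  shows "cmp delta_cat (join f u) (join_in1 (dm delta_cat f) (dm delta_cat u))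
      = cmp delta_cat (join_in1 (cd delta_cat f) (cd delta_cat u)) f"
    "cmp delta_cat (join f u) (join_in2 (dm delta_cat f) (dm delta_cat u))
        = cmp delta_cat (join_in2 (cd delta_cat f) (cd delta_cat u)) u"
  by (rule dmap_cases[OF assms(1)], rule dmap_cases[OF assms(2)],
      auto simp: join_in1_def join_in2_def join_dmap intro!: dmap_eqI)+

lemma join_collapse_natural:
  assumes "u \<in> Ar delta_cat"
  shows "cmp delta_cat (join_collapse n (cd delta_cat u)) (join (idn delta_cat n) u)
      = join_collapse n (dm delta_cat u)"
proof (rule dmap_cases[OF assms])
  fix p q f assume h: "u = dmap p q f" "\<And>i. i \<le> p \<Longrightarrow> f i \<le> q"
  have 1: "(if i \<le> n then i else n + 1 + f (i - n - 1)) \<le> n + 1 + q" if "i \<le> n + 1 + p" for i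
    using h(2)[of "i - n - 1"] that by auto
  then show ?thesis unfolding h(1) by (auto simp: join_collapse_def dmap_idn join_dmap intro!:
      dmap_eqI)
qed

lemma join_collapse_in1: "cmp delta_cat (join_collapse n m) (join_in1 n m) = idn delta_cat n"
  by (auto simp: join_collapse_def join_in1_def dmap_idn intro!: dmap_eqI)

text \<open>As transformations of endofunctors of \<open>\<Delta>\<^sup>o\<^sup>p\<close> in the variable \<open>m\<close>. Passing to the opposite
  category turns the inclusions into projections \<open>[n] * [m] \<rightarrow> [n]\<close> and \<open>[n] * [m] \<rightarrow> [m]\<close>, and the
  retraction into a section. The projections are also natural in \<open>n\<close>, the section is not.\<close>

definition join_pr1 :: "nat \<Rightarrow> (nat, dmor, nat, dmor) nt" where
  "join_pr1 n = NT (shift_fun n) (const_fun delta_op delta_op n) (\<lambda>m\<in>Ob delta_op. join_in1 n m)"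
definition join_pr2 :: "nat \<Rightarrow> (nat, dmor, nat, dmor) nt" where
  "join_pr2 n = NT (shift_fun n) (id_fun delta_op) (\<lambda>m\<in>Ob delta_op. join_in2 n m)"
definition join_sec :: "nat \<Rightarrow> (nat, dmor, nat, dmor) nt" where
  "join_sec n = NT (const_fun delta_op delta_op n) (shift_fun n)
      (\<lambda>m\<in>Ob delta_op. join_collapse n m)"

lemma nat_join_pr1: "is_nat_trans delta_op delta_op (join_pr1 n)"
  unfolding join_pr1_def
  by (rule is_nat_transI[OF functor_shift_fun functor_const[OF category_dop category_dop]
      category_dop])
    (use join_in_natural(1)[of "idn delta_cat n"] in \<open>simp_all add: hom_iff dop_simps\<close>)

lemma nat_join_pr2: "is_nat_trans delta_op delta_op (join_pr2 n)"
  unfolding join_pr2_def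
  by (rule is_nat_transI[OF functor_shift_fun functor_id[OF category_dop] category_dop])
    (use join_in_natural(2)[of "idn delta_cat n"] in \<open>simp_all add: hom_iff dop_simps\<close>)

lemma nat_join_sec: "is_nat_trans delta_op delta_op (join_sec n)"
  unfolding join_sec_def
  by (rule is_nat_transI[OF functor_const[OF category_dop category_dop] functor_shift_fun
      category_dop])
    (simp_all add: hom_iff dop_simps join_collapse_natural)

definition join_proj1 where "join_proj1 = NT join_fun (diag_fun delta_op delta_op)
    (\<lambda>n\<in>Ob delta_op. join_pr1 n)"
definition join_proj2 where "join_proj2 = NT join_fun (const_fun delta_op (fun_cat delta_op
    delta_op) (id_fun delta_op))
  (\<lambda>n\<in>Ob delta_op. join_pr2 n)"

lemma nat_join_proj1: "is_nat_trans delta_op (fun_cat delta_op delta_op) join_proj1"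
  unfolding join_proj1_def
  by (rule is_nat_transI[OF functor_join_fun functor_diag_fun[OF category_dop category_dop]
      category_dop])
    (use nat_join_pr1 join_in_natural(1)[of _ "idn delta_cat _"] in
      \<open>simp_all add: hom_fun_cat dop_simps shift_nt_def join_pr1_def restrict_def\<close>)

lemma nat_join_proj2: "is_nat_trans delta_op (fun_cat delta_op delta_op) join_proj2"
proof -
  note O = category_dop
  note OO = category_fun_cat[OF O O]
  have "is_functor delta_op (fun_cat delta_op delta_op)
      (const_fun delta_op (fun_cat delta_op delta_op) (id_fun delta_op))"
    using functor_const[OF O OO] functor_id[OF O] by (simp add: fun_cat_simps)
  from is_nat_transI[OF functor_join_fun this O, of join_pr2] show ?thesis
    unfolding join_proj2_def using nat_join_pr2 join_in_natural(2)[of _ "idn delta_cat _"]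
    by (simp add: hom_fun_cat dop_simps shift_nt_def join_pr2_def restrict_def)
qed

text \<open>The constant map \<open>[n] \<rightarrow> [1]\<close> at \<open>e\<close>.\<close>

definition vertex :: "nat \<Rightarrow> nat \<Rightarrow> dmor" where "vertex n e = dmap n 1 (\<lambda>i. e)"

text \<open>A simplicial homotopy, indexed by the simplices \<open>k \<in> \<Delta>[1]\<^sub>n\<close>, between transformations
  \<open>K1 \<rightarrow> K2\<close> of endofunctors of \<open>\<Delta>\<^sup>o\<^sup>p\<close>. Applying a simplicial object \<open>X\<close> gives a homotopy between
  maps \<open>X \<circ> K1 \<rightarrow> X \<circ> K2\<close>, natural in \<open>X\<close>; its ends are the values at \<open>vertex n 0\<close> and
  \<open>vertex n 1\<close>.\<close>

definition simplicial_homotopy where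
  "simplicial_homotopy K1 K2 h \<longleftrightarrow> (\<forall>n. \<forall>k\<in>hom delta_cat n 1. h n k \<in> hom delta_op (fob K1 n) (fob
      K2 n)) \<and>
    (\<forall>u\<in>Ar delta_cat. \<forall>k\<in>hom delta_cat (cd delta_cat u) 1.
      cmp delta_op (far K2 u) (h (cd delta_cat u) k)
        = cmp delta_op (h (dm delta_cat u) (cmp delta_cat k u)) (far K1 u))"

text \<open>The homotopy contracting \<open>[n] * [m]\<close> onto \<open>[n]\<close>: the vertex \<open>j\<close> of \<open>[m]\<close> stays fixed if
  \<open>k j = 1\<close> and goes to the last vertex of \<open>[n]\<close> if \<open>k j = 0\<close>. The map is monotone because \<open>k\<close>
  is.\<close>

definition shift_htpy :: "nat \<Rightarrow> nat \<Rightarrow> dmor \<Rightarrow> dmor" where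
  "shift_htpy n m k = dmap (n + 1 + m) (n + 1 + m) (\<lambda>i. if i \<le> n then i else if dfun k (i - n - 1)
      = 1 then i else n)"

lemma homotopy_shift: "simplicial_homotopy (shift_fun n) (shift_fun n) (shift_htpy n)"
proof -
  have 1: "shift_htpy n m k \<in> hom delta_op (n + 1 + m) (n + 1 + m)" if km: "k \<in> hom delta_cat m 1"
      for m k
  proof -
    obtain f where k: "k = dmap m 1 f" "\<And>i. i \<le> m \<Longrightarrow> f i \<le> 1" "\<And>i j. i \<le> j \<Longrightarrow> j \<le> m \<Longrightarrow> f i \<le> f j"
      using dmap_hom_cases[OF km] by blast
    have "f (j - Suc n) = 1" if "f (i - Suc n) = 1" "i \<le> j" "j \<le> n + 1 + m" for i j
    proof -
      have "f (i - Suc n) \<le> f (j - Suc n)" using that by (intro k(3)) auto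
      moreover have "f (j - Suc n) \<le> 1" using that by (intro k(2)) auto
      ultimately show ?thesis using that by simp
    qed
    then have "shift_htpy n m k \<in> Ar delta_cat"
      unfolding shift_htpy_def k by (intro dmap_Ar) auto
    then show ?thesis by (simp add: hom_iff dop_simps shift_htpy_def)
  qed
  have 2: "cmp delta_cat (shift_htpy n (cd delta_cat u) k) (join (idn delta_cat n) u)
    = cmp delta_cat (join (idn delta_cat n) u) (shift_htpy n (dm delta_cat u) (cmp delta_cat k u))"
    if u: "u \<in> Ar delta_cat" and k: "k \<in> hom delta_cat (cd delta_cat u) 1" for u k
  proof (rule dmap_cases[OF u])
    fix p q f assume h: "u = dmap p q f" "\<And>i. i \<le> p \<Longrightarrow> f i \<le> q"
    obtain g where g: "k = dmap q 1 g" using dmap_hom_cases[OF k] h(1) by auto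
    have 1: "(if i \<le> n then i else n + 1 + f (i - n - 1)) \<le> n + 1 + q" if "i \<le> n + 1 + p" for i
      using h(2)[of "i - n - 1"] that by auto
    show ?thesis unfolding h(1) g using 1 h(2)
      by (auto simp: shift_htpy_def dmap_idn join_dmap intro!: dmap_eqI)
  qed
  show ?thesis unfolding simplicial_homotopy_def using 1 2 by (simp add: op_cat_simps)
qed

lemma shift_htpy_ends: "shift_htpy n m (vertex m 1) = idn delta_cat (n + 1 + m)"
    "shift_htpy n m (vertex m 0) = cmp delta_cat (join_in1 n m) (join_collapse n m)"
  by (auto simp: shift_htpy_def vertex_def join_in1_def join_collapse_def dmap_idn intro!: dmap_eqI)

text \<open>The functor \<open>[n] \<mapsto> [n] * [n]\<close>, with its two projections to the identity.\<close>

definition diag_join where "diag_join = diag_ob delta_op join_fun"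
definition diag_join_pr1 where "diag_join_pr1 = far (diagonal delta_op) join_proj1"
definition diag_join_pr2 where "diag_join_pr2 = far (diagonal delta_op) join_proj2"

lemma diag_join_simps [simp]: "fob diag_join m = m + 1 + m" "u \<in> Ar delta_cat \<Longrightarrow> far diag_join u
    = join u u"
  by (simp_all add: diag_join_def diag_ob_simps op_cat_simps shift_nt_def dop_simps flip: join_cmp)

lemma functor_diag_join: "is_functor delta_op delta_op diag_join"
  unfolding diag_join_def by (rule functor_diag_ob[OF category_dop functor_join_fun])

lemma nat_diag_join_pr1: "is_nat_trans delta_op delta_op diag_join_pr1" "src diag_join_pr1
    = diag_join" "tgt diag_join_pr1 = id_fun delta_op"
    "cpt diag_join_pr1 n = join_in1 n n"
proof -
  note i = functor_id[OF category_dop]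
  note d = diag_ob_const(2)[OF category_dop i] fun_comp_id(1)[OF category_dop
      category_fun_cat[OF category_dop category_dop] functor_diag_fun[OF category_dop category_dop]]
  show "is_nat_trans delta_op delta_op diag_join_pr1" "src diag_join_pr1 = diag_join"
      "tgt diag_join_pr1 = id_fun delta_op"
    "cpt diag_join_pr1 n = join_in1 n n"
    unfolding diag_join_pr1_def using nat_diagonal[OF category_dop nat_join_proj1] d
    by (simp_all add: diagonal_cpt[OF nat_join_proj1]) (simp_all add: join_proj1_def join_pr1_def
        diag_join_def)
qed

lemma nat_diag_join_pr2: "is_nat_trans delta_op delta_op diag_join_pr2" "src diag_join_pr2
    = diag_join" "tgt diag_join_pr2 = id_fun delta_op"
    "cpt diag_join_pr2 n = join_in2 n n"
  unfolding diag_join_pr2_def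
  using nat_diagonal[OF category_dop nat_join_proj2] diag_ob_const(1)[OF category_dop
      functor_id[OF category_dop]]
  by (simp_all add: diagonal_cpt[OF nat_join_proj2]) (simp_all add: join_proj2_def join_pr2_def
      diag_join_def)

text \<open>The two inclusions \<open>[n] \<rightarrow> [n] * [n]\<close> are homotopic: the vertex \<open>i\<close> goes to the first copy
  if \<open>k i = 0\<close> and to the second if \<open>k i = 1\<close>.\<close>

definition diag_htpy :: "nat \<Rightarrow> dmor \<Rightarrow> dmor" where
  "diag_htpy n k = dmap n (n + 1 + n) (\<lambda>i. if dfun k i = 0 then i else n + 1 + i)"

lemma homotopy_diag_join: "simplicial_homotopy diag_join (id_fun delta_op) diag_htpy"
proof -
  have 1: "diag_htpy m k \<in> hom delta_op (m + 1 + m) m" if km: "k \<in> hom delta_cat m 1" for m k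
  proof -
    obtain f where k: "k = dmap m 1 f" "\<And>i. i \<le> m \<Longrightarrow> f i \<le> 1" "\<And>i j. i \<le> j \<Longrightarrow> j \<le> m \<Longrightarrow> f i \<le> f j"
      using dmap_hom_cases[OF km] by blast
    have "f i = 0" if "f j = 0" "i \<le> j" "j \<le> m" for i j
      using k(3)[of i j] that by simp
    then have "diag_htpy m k \<in> Ar delta_cat"
      unfolding diag_htpy_def k by (intro dmap_Ar) auto
    then show ?thesis by (simp add: hom_iff dop_simps diag_htpy_def)
  qed
  have 2: "cmp delta_cat (diag_htpy (cd delta_cat u) k) u
    = cmp delta_cat (join u u) (diag_htpy (dm delta_cat u) (cmp delta_cat k u))"
    if u: "u \<in> Ar delta_cat" and k: "k \<in> hom delta_cat (cd delta_cat u) 1" for u k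
  proof (rule dmap_cases[OF u])
    fix p q f assume h: "u = dmap p q f" "\<And>i. i \<le> p \<Longrightarrow> f i \<le> q"
    obtain g where g: "k = dmap q 1 g" using dmap_hom_cases[OF k] h(1) by auto
    show ?thesis unfolding h(1) g using h(2)
      by (auto simp: diag_htpy_def join_dmap intro!: dmap_eqI)
  qed
  show ?thesis unfolding simplicial_homotopy_def using 1 2 by (simp add: op_cat_simps)
qed

lemma diag_htpy_ends: "diag_htpy n (vertex n 0) = join_in1 n n" "diag_htpy n (vertex n 1)
    = join_in2 n n"
  by (auto simp: diag_htpy_def vertex_def join_in1_def join_in2_def intro!: dmap_eqI)

section \<open>Cylinders in a category with finite coproducts\<close>

lemma idn_delta [simp]: "idn delta_cat n \<in> Ar delta_cat" "dm delta_cat (idn delta_cat n) = n"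
    "cd delta_cat (idn delta_cat n) = n"
  by (simp_all add: cat_idn[OF category_delta])

lemma finite_delta_hom: "finite (hom delta_cat n m)"
proof -
  have "hom delta_cat n m \<subseteq> (\<lambda>f. (n, m, f)) ` ({..n} \<rightarrow>\<^sub>E {..m})"
    by (auto simp: hom_iff delta_cat_def)
  then show ?thesis by (rule finite_subset) (auto intro: finite_PiE)
qed

lemma copower_exists:
  assumes "has_finite_coproducts D" "A \<in> Ob D" "finite I"
  shows "\<exists>P \<iota>. is_coproduct D I (\<lambda>_. A) P \<iota>"
proof -
  obtain \<beta> where \<beta>: "bij_betw \<beta> I {..<card I}"
    using ex_bij_betw_finite_nat[OF assms(3)] by (auto simp: atLeast0LessThan)
  obtain P \<iota> where P: "is_coproduct D {..<card I} (\<lambda>_. A) P \<iota>"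
    using assms(1)[unfolded has_finite_coproducts_def, rule_format, of "card I" "\<lambda>_. A"] assms(2)
    by auto
  have bI: "inj_on \<beta> I" "\<beta> ` I = {..<card I}" using \<beta> unfolding bij_betw_def by blast+
  have lt: "\<beta> i < card I" if "i \<in> I" for i
    using imageI[OF that, of \<beta>] unfolding bI(2) by simp
  have ex: "\<exists>i\<in>I. \<beta> i = j" if "j < card I" for j
  proof -
    have "j \<in> \<beta> ` I" using that unfolding bI(2) by simp
    then show ?thesis by blast
  qed
  have inv: "inv_into I \<beta> (\<beta> i) = i" if "i \<in> I" for i
    using inv_into_f_f[OF bI(1) that] .
  have "is_coproduct D I (\<lambda>_. A) P (\<lambda>i. \<iota> (\<beta> i))"
    unfolding is_coproduct_def
  proof (intro conjI ballI allI impI)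
    fix Q g assume Q: "Q \<in> Ob D" and g: "\<forall>i\<in>I. g i \<in> hom D A Q"
    let ?g = "\<lambda>j. g (inv_into I \<beta> j)"
    have gQ: "\<forall>j\<in>{..<card I}. ?g j \<in> hom D A Q"
    proof
      fix j assume "j \<in> {..<card I}"
      then obtain i where "i \<in> I" "\<beta> i = j" using ex by blast
      then show "?g j \<in> hom D A Q" using g inv by auto
    qed
    have "\<forall>Q\<in>Ob D. \<forall>g. (\<forall>j\<in>{..<card I}. g j \<in> hom D A Q) \<longrightarrow>
        (\<exists>!h. h \<in> hom D P Q \<and> (\<forall>j\<in>{..<card I}. cmp D h (\<iota> j) = g j))"
      using P unfolding is_coproduct_def by (elim conjE)
    from this[THEN bspec, OF Q, THEN spec[of _ ?g], THEN mp, OF gQ]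
    have ex1: "\<exists>!h. h \<in> hom D P Q \<and> (\<forall>j\<in>{..<card I}. cmp D h (\<iota> j) = ?g j)" .
    have "(\<forall>j\<in>{..<card I}. cmp D h (\<iota> j) = ?g j) \<longleftrightarrow> (\<forall>i\<in>I. cmp D h (\<iota> (\<beta> i)) = g i)" for h
    proof
      assume l: "\<forall>j\<in>{..<card I}. cmp D h (\<iota> j) = ?g j"
      show "\<forall>i\<in>I. cmp D h (\<iota> (\<beta> i)) = g i"
        using l[rule_format, OF lessThan_iff[THEN iffD2, OF lt]] inv by simp
    next
      assume r: "\<forall>i\<in>I. cmp D h (\<iota> (\<beta> i)) = g i"
      show "\<forall>j\<in>{..<card I}. cmp D h (\<iota> j) = ?g j"
      proof
        fix j assume "j \<in> {..<card I}"
        then obtain i where "i \<in> I" "\<beta> i = j" using ex by blast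
        then show "cmp D h (\<iota> j) = ?g j" using r inv by auto
      qed
    qed
    then show "\<exists>!h. h \<in> hom D P Q \<and> (\<forall>i\<in>I. cmp D h (\<iota> (\<beta> i)) = g i)"
      using ex1 by (simp only:)
  qed (use P lt in \<open>auto simp: is_coproduct_def\<close>)
  then show ?thesis by blast
qed

text \<open>A category with finite coproducts; coproducts indexed by \<open>\<Delta>[1]\<^sub>n\<close> of copies of one object
  are chosen once and for all.\<close>

locale coproduct_category = category D for D :: "('o, 'm) cat" +
  assumes fc: "has_finite_coproducts D"
begin

lemmas is_cat = category_axioms
lemmas J = category_dop
lemmas S = category_fun_cat[OF category_dop is_cat]

text \<open>\<open>SS\<close> and \<open>BB\<close> are the categories of simplicial and bisimplicial objects; \<open>dpre K\<close> sends a
  simplicial object \<open>X\<close> to \<open>X \<circ> K\<close>.\<close>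

abbreviation "SS \<equiv> simp_cat D"
abbreviation "BB \<equiv> bisimp_cat D"
abbreviation "dpre \<equiv> pre delta_op delta_op D"
abbreviation "dpre_nt \<equiv> pre_nt delta_op delta_op D"

subsection \<open>Bisimplicial objects obtained by reindexing simplicial objects\<close>

abbreviation "DD \<equiv> fun_cat delta_op delta_op"
lemmas O = category_fun_cat[OF category_dop category_dop]

text \<open>A functor \<open>K : \<Delta>\<^sup>o\<^sup>p \<rightarrow> Fun(\<Delta>\<^sup>o\<^sup>p, \<Delta>\<^sup>o\<^sup>p)\<close> turns a simplicial object \<open>X\<close> into the
  bisimplicial object \<open>n \<mapsto> X \<circ> K n\<close>, naturally in \<open>X\<close> and \<open>K\<close>.\<close>

definition dec where "dec K = fun_comp SS (pre delta_op DD SS K) (post_fun delta_op delta_op D)"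
definition dec_nt where "dec_nt \<pi> = whisk_right SS (pre_nt delta_op DD SS \<pi>) (post_fun delta_op
    delta_op D)"

lemma functor_dec: "is_functor delta_op DD K \<Longrightarrow> is_functor SS BB (dec K)"
  unfolding dec_def
  using functor_fun_comp[OF S functor_post_fun[OF J J is_cat] functor_pre[OF J O S]] .

lemma nat_dec: "is_nat_trans delta_op DD \<pi> \<Longrightarrow> is_nat_trans SS BB (dec_nt \<pi>)"
  unfolding dec_nt_def
  using nat_whisk_right[OF S nat_pre[OF J O S] functor_post_fun[OF J J is_cat]] .

lemma dec_nt_st: "src (dec_nt \<pi>) = dec (src \<pi>)" "tgt (dec_nt \<pi>) = dec (tgt \<pi>)"
  by (simp_all add: dec_nt_def dec_def pre_simps)

lemma dec_simps:
  "is_functor delta_op D X \<Longrightarrow> fob (dec K) X = fun_comp delta_op (post delta_op delta_op X) K"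
  "is_nat_trans delta_op D \<phi> \<Longrightarrow> far (dec K) \<phi> = whisk_right delta_op (post_nt delta_op delta_op \<phi>) K"
  "is_functor delta_op D X \<Longrightarrow> cpt (dec_nt \<pi>) X = whisk_left delta_op (post delta_op delta_op X) \<pi>"
  by (simp_all add: dec_def dec_nt_def fun_cat_simps post_fun_simps pre_simps
      functor_post[OF J J] nat_post[OF J J])

text \<open>The objects \<open>X \<times> \<Delta>\<close> and \<open>\<Delta> \<times> X\<close> are of this form.\<close>

lemma dec_diag: "dec (diag_fun delta_op delta_op) = post delta_op D (const_s D)"
  by (rule func_eqI[OF functor_dec[OF functor_diag_fun[OF J J]] functor_post[OF J is_cat
      functor_diag_fun[OF J is_cat]]])
    (simp_all add: fun_cat_simps dec_simps post_simps post_diag_fun[OF J J] post_nt_diag_fun[OF J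
        J])

lemma dec_const: "dec (const_fun delta_op DD (id_fun delta_op)) = const_s SS"
proof (rule func_eqI[OF functor_dec[OF functor_const[OF J O]] functor_diag_fun[OF J S]])
  have i: "id_fun delta_op \<in> Ob DD" using functor_id[OF J] by (simp add: fun_cat_simps)
  then show "id_fun delta_op \<in> Ob DD" .
  have ob: "fun_comp delta_op (post delta_op delta_op X) (const_fun delta_op DD (id_fun delta_op))
      = const_fun delta_op SS X"
    if "is_functor delta_op D X" for X
    using fun_comp_const[OF J O functor_post[OF J J that] i] that functor_id[OF J]
    by (simp add: post_simps fun_comp_id[OF J is_cat that])
  show "fob (dec (const_fun delta_op DD (id_fun delta_op))) X = fob (const_s SS) X" if "X \<in> Ob SS"
      for X
    using that ob by (simp add: fun_cat_simps dec_simps)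
  fix \<phi> assume p: "\<phi> \<in> Ar SS"
  then have \<phi>: "is_nat_trans delta_op D \<phi>" by (simp add: fun_cat_simps)
  show "far (dec (const_fun delta_op DD (id_fun delta_op))) \<phi> = far (const_s SS) \<phi>"
    using p \<phi> ob[OF nat_functors(1)[OF \<phi>]] ob[OF nat_functors(2)[OF \<phi>]] functor_id[OF J]
      whisk_id(1)[OF J is_cat \<phi>]
    by (simp add: dec_simps whisk_right_def[of delta_op
        "post_nt delta_op delta_op \<phi>"] post_nt_simps)
qed

text \<open>The diagonal of \<open>n \<mapsto> X \<circ> K n\<close> is \<open>X\<close> precomposed with the diagonal of \<open>K\<close>, where \<open>K\<close> is
  viewed as a bisimplicial object of \<open>\<Delta>\<^sup>o\<^sup>p\<close>.\<close>

lemma diagonal_dec: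
  assumes K: "is_functor delta_op DD K"
  shows "fun_comp SS (diagonal D) (dec K) = dpre (diag_ob delta_op K)"
proof (rule func_eqI[OF functor_fun_comp[OF S functor_dec[OF K] functor_diagonal[OF is_cat]]
      functor_pre[OF J J is_cat functor_diag_ob[OF J K]]])
  have Kn: "is_functor delta_op delta_op (fob K n)" for n
    using functor_ob[OF K, of n] by (simp add: fun_cat_simps)
  have Ku: "is_nat_trans delta_op delta_op (far K u)" "src (far K u) = fob K (dm delta_op u)"
    "tgt (far K u) = fob K (cd delta_op u)" if "u \<in> Ar delta_op" for u
    using functor_ar[OF K that] by (simp_all add: fun_cat_simps)
  have f: "is_functor delta_op SS (fun_comp delta_op (post delta_op delta_op X) K)"
    if X: "is_functor delta_op D X" for X
    using functor_fun_comp[OF J K functor_post[OF J J X]] .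
  have ob: "diag_ob D (fun_comp delta_op (post delta_op delta_op X) K)
      = fun_comp delta_op X (diag_ob delta_op K)"
    if X: "is_functor delta_op D X" for X
    by (rule func_eqI[OF functor_diag_ob[OF is_cat f[OF X]] functor_fun_comp[OF J
        functor_diag_ob[OF J K] X]])
      (simp_all add: diag_ob_simps post_simps Kn Ku nat_cpt[OF Ku(1)] functor_simps[OF Kn]
        functor_simps[OF X])
  show "fob (fun_comp SS (diagonal D) (dec K)) X = fob (dpre (diag_ob delta_op K)) X" if
      "X \<in> Ob SS" for X
    using that f ob by (simp add: fun_cat_simps dec_simps diagonal_simps pre_simps)
  fix \<phi> assume p: "\<phi> \<in> Ar SS"
  then have \<phi>: "is_nat_trans delta_op D \<phi>" by (simp add: fun_cat_simps)
  note n = nat_functors[OF \<phi>]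
  have w: "is_nat_trans delta_op SS (whisk_right delta_op (post_nt delta_op delta_op \<phi>) K)"
    using nat_whisk_right[OF J nat_post[OF J J \<phi>] K] .
  show "far (fun_comp SS (diagonal D) (dec K)) \<phi> = far (dpre (diag_ob delta_op K)) \<phi>"
    using p \<phi> w ob[OF n(1)] ob[OF n(2)] Kn
    by (simp add: dec_simps diagonal_simps pre_simps post_nt_simps diag_ob_simps
        whisk_right_def[of delta_op \<phi> "diag_ob delta_op K"])
qed

lemma diagonal_dec_nt:
  assumes p: "is_nat_trans delta_op DD \<pi>"
  shows "whisk_left SS (diagonal D) (dec_nt \<pi>) = dpre_nt (far (diagonal delta_op) \<pi>)" (is "?l = ?r")
proof -
  note d = nat_whisk_left[OF S nat_dec[OF p] functor_diagonal[OF is_cat]]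
  note pa = nat_pre[OF J J is_cat nat_diagonal[OF J p]]
  note e = diagonal_dec[OF nat_functors(1)[OF p]] diagonal_dec[OF nat_functors(2)[OF p]]
  have \<pi>: "is_nat_trans delta_op delta_op (cpt \<pi> n)" for n
    using nat_cpt(1)[OF p, of n] by (simp add: fun_cat_simps)
  show ?thesis
  proof (rule nt_eqI[OF d pa])
    show s: "src ?l = src ?r"
      "tgt ?l = tgt ?r"
      by (simp_all add: pre_simps dec_nt_st e diagonal_cpt[OF p])
    fix X assume X': "X \<in> Ob SS"
    then have X: "is_functor delta_op D X" by (simp add: fun_cat_simps)
    show "cpt ?l X = cpt ?r X"
    proof (rule nt_eqI)
      show "is_nat_trans delta_op D (cpt ?l X)"
        "is_nat_trans delta_op D (cpt ?r X)"
        using nat_cpt(1)[OF d X'] nat_cpt(1)[OF pa X'] by (simp_all add: fun_cat_simps)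
      show "src (cpt ?l X) = src (cpt ?r X)"
        "tgt (cpt ?l X) = tgt (cpt ?r X)"
        using nat_cpt(2,3)[OF d X'] nat_cpt(2,3)[OF pa X'] s by (simp_all del: whisk_left_simps)
    qed (use X' in \<open>simp add: dec_simps(3)[OF X] diagonal_simps pre_simps X post_simps \<pi>
        diagonal_cpt[OF p] nat_whisk_left[OF J p functor_post[OF J J X]]\<close>)
  qed
qed

lemma pre_id: "dpre (id_fun delta_op) = id_fun SS"
  by (rule func_eqI[OF functor_pre[OF J J is_cat functor_id[OF J]] functor_id[OF S]])
    (simp_all add: fun_cat_simps pre_simps fun_comp_id[OF J is_cat] whisk_id[OF J is_cat])

lemma diagonal_post_const: "fun_comp SS (diagonal D) (post delta_op D (const_s D)) = id_fun SS"
proof -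
  have "diag_ob delta_op (diag_fun delta_op delta_op) = id_fun delta_op"
    using diag_ob_const(2)[OF J functor_id[OF J]] fun_comp_id(1)[OF J O functor_diag_fun[OF J J]]
        by simp
  then show ?thesis
    using diagonal_dec[OF functor_diag_fun[OF J J]] by (simp add: dec_diag pre_id)
qed

lemma diagonal_const: "fun_comp SS (diagonal D) (const_s SS) = id_fun SS"
proof -
  have "is_functor delta_op DD (const_fun delta_op DD (id_fun delta_op))"
    using functor_const[OF J O] functor_id[OF J] by (simp add: fun_cat_simps)
  from diagonal_dec[OF this] show ?thesis
    by (simp add: dec_const pre_id diag_ob_const(1)[OF J functor_id[OF J]])
qed

subsection \<open>The product of an object with the standard 1-simplex\<close>

text \<open>\<open>copow A n\<close> is the chosen coproduct of copies of \<open>A\<close> indexed by \<open>\<Delta>[1]\<^sub>n\<close>, with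
  coprojections \<open>coproj A n k\<close>.\<close>

definition copower where
  "copower A n = (SOME Pi. is_coproduct D (hom delta_cat n 1) (\<lambda>_. A) (fst Pi) (snd Pi))"

definition copow where "copow A n = fst (copower A n)"
definition coproj where "coproj A n = snd (copower A n)"

lemma is_coproduct_copow:
  assumes "A \<in> Ob D" shows "is_coproduct D (hom delta_cat n 1) (\<lambda>_. A) (copow A n) (coproj A n)"
proof -
  obtain P \<iota> where "is_coproduct D (hom delta_cat n 1) (\<lambda>_. A) P \<iota>"
    using copower_exists[OF fc assms finite_delta_hom[of n 1]] by blast
  then show ?thesis unfolding copow_def coproj_def copower_def
    using someI[of "\<lambda>Pi. is_coproduct D (hom delta_cat n 1) (\<lambda>_. A) (fst Pi) (snd Pi)" "(P, \<iota>)"]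
    by simp
qed

lemma copow_ob [simp]: "A \<in> Ob D \<Longrightarrow> copow A n \<in> Ob D"
  using is_coproduct_copow by (auto simp: is_coproduct_def)

lemma coproj_hom:
  assumes "A \<in> Ob D" "k \<in> hom delta_cat n 1"
  shows "coproj A n k \<in> Ar D" "dm D (coproj A n k) = A" "cd D (coproj A n k) = copow A n"
  using is_coproduct_copow[OF assms(1), of n] assms(2) by (auto simp: is_coproduct_def hom_iff)

lemma copow_ex1:
  assumes "A \<in> Ob D" "Q \<in> Ob D" "\<And>k. k \<in> hom delta_cat n 1 \<Longrightarrow> g k \<in> hom D A Q"
  shows "\<exists>!h. h \<in> hom D (copow A n) Q \<and> (\<forall>k\<in>hom delta_cat n 1. cmp D h (coproj A n k) = g k)"
proof -
  have "\<forall>Q\<in>Ob D. \<forall>g. (\<forall>k\<in>hom delta_cat n 1. g k \<in> hom D A Q) \<longrightarrow>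
      (\<exists>!h. h \<in> hom D (copow A n) Q \<and> (\<forall>k\<in>hom delta_cat n 1. cmp D h (coproj A n k) = g k))"
    using is_coproduct_copow[OF assms(1), of n] unfolding is_coproduct_def by (elim conjE)
  from this[THEN bspec, OF assms(2), THEN spec[of _ g], THEN mp] assms(3) show ?thesis by blast
qed

text \<open>The arrow \<open>copow A n \<rightarrow> Q\<close> with components \<open>g k\<close>.\<close>

definition copair where
  "copair A n Q g = (THE h. h \<in> hom D (copow A n) Q \<and> (\<forall>k\<in>hom delta_cat n 1. cmp D h (coproj A n
      k) = g k))"

lemma copair_props:
  assumes "A \<in> Ob D" "Q \<in> Ob D" "\<And>k. k \<in> hom delta_cat n 1 \<Longrightarrow> g k \<in> hom D A Q"
  shows "copair A n Q g \<in> Ar D" "dm D (copair A n Q g) = copow A n" "cd D (copair A n Q g) = Q"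
    "k \<in> hom delta_cat n 1 \<Longrightarrow> cmp D (copair A n Q g) (coproj A n k) = g k"
proof -
  have "\<exists>!h. h \<in> hom D (copow A n) Q \<and> (\<forall>k\<in>hom delta_cat n 1. cmp D h (coproj A n k) = g k)"
    using assms by (rule copow_ex1)
  from theI'[OF this] show "copair A n Q g \<in> Ar D" "dm D (copair A n Q g) = copow A n"
      "cd D (copair A n Q g) = Q"
    "k \<in> hom delta_cat n 1 \<Longrightarrow> cmp D (copair A n Q g) (coproj A n k) = g k"
    unfolding copair_def[symmetric] by (auto simp: hom_iff)
qed

lemma copow_eqI:
  assumes "A \<in> Ob D" "h \<in> Ar D" "h' \<in> Ar D" "dm D h = copow A n" "dm D h' = copow A n" "cd D h
      = cd D h'"
    and "\<And>k. k \<in> hom delta_cat n 1 \<Longrightarrow> cmp D h (coproj A n k) = cmp D h' (coproj A n k)"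
  shows "h = h'"
proof -
  have "cmp D h (coproj A n k) \<in> hom D A (cd D h)" if "k \<in> hom delta_cat n 1" for k
    using coproj_hom[OF assms(1) that] assms by (simp add: hom_iff cmp_props)
  then have ex1: "\<exists>!x. x \<in> hom D (copow A n) (cd D h) \<and>
      (\<forall>k\<in>hom delta_cat n 1. cmp D x (coproj A n k) = cmp D h (coproj A n k))"
    by (rule copow_ex1[OF assms(1) cd_closed[OF assms(2)]])
  have 1: "h \<in> hom D (copow A n) (cd D h)" "h' \<in> hom D (copow A n) (cd D h)"
    using assms by (simp_all add: hom_iff)
  have "\<forall>k\<in>hom delta_cat n 1. cmp D h' (coproj A n k) = cmp D h (coproj A n k)"
    using assms(7) by simp
  with 1(2) have 2: "h' \<in> hom D (copow A n) (cd D h) \<and>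
      (\<forall>k\<in>hom delta_cat n 1. cmp D h' (coproj A n k) = cmp D h (coproj A n k))" ..
  show ?thesis
    using the1_equality[OF ex1 conjI[OF 1(1) ballI[OF HOL.refl]]] the1_equality[OF ex1 2] by simp
qed

text \<open>The joint functoriality of \<open>copow A n\<close> in \<open>A\<close> and \<open>[n]\<close>: the summand of index \<open>k\<close> is sent
  by \<open>f\<close> to the summand of index \<open>k \<circ> u\<close>.\<close>

definition copow_map where
  "copow_map f u = copair (dm D f) (cd delta_cat u) (copow (cd D f) (dm delta_cat u))
    (\<lambda>k. cmp D (coproj (cd D f) (dm delta_cat u) (cmp delta_cat k u)) f)"

lemma delta_cmp_hom: "u \<in> Ar delta_cat \<Longrightarrow> k \<in> hom delta_cat (cd delta_cat u) m \<Longrightarrow>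
    cmp delta_cat k u \<in> hom delta_cat (dm delta_cat u) m"
  by (auto simp: hom_iff cat_cmp[OF category_delta])

lemma copow_map_props:
  assumes "f \<in> Ar D" "u \<in> Ar delta_cat"
  shows "copow_map f u \<in> Ar D" "dm D (copow_map f u) = copow (dm D f) (cd delta_cat u)"
    "cd D (copow_map f u) = copow (cd D f) (dm delta_cat u)"
    "k \<in> hom delta_cat (cd delta_cat u) 1 \<Longrightarrow> a = dm D f \<Longrightarrow> n = cd delta_cat u \<Longrightarrow>
      cmp D (copow_map f u) (coproj a n k)
      = cmp D (coproj (cd D f) (dm delta_cat u) (cmp delta_cat k u)) f"
proof -
  have "cmp D (coproj (cd D f) (dm delta_cat u) (cmp delta_cat k u)) f \<in> hom D (dm D f) (copow (cd
      D f) (dm delta_cat u))"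
    if "k \<in> hom delta_cat (cd delta_cat u) 1" for k
    using coproj_hom[OF cd_closed[OF assms(1)] delta_cmp_hom[OF assms(2) that]] assms
    by (simp add: hom_iff cmp_props)
  note c = copair_props[where g = "\<lambda>k. cmp D (coproj (cd D f) (dm delta_cat u) (cmp delta_cat k
      u)) f",
      OF dm_closed[OF assms(1)] copow_ob[OF cd_closed[OF assms(1)]] this]
  show "copow_map f u \<in> Ar D" "dm D (copow_map f u) = copow (dm D f) (cd delta_cat u)"
    "cd D (copow_map f u) = copow (cd D f) (dm delta_cat u)"
    "k \<in> hom delta_cat (cd delta_cat u) 1 \<Longrightarrow> a = dm D f \<Longrightarrow> n = cd delta_cat u \<Longrightarrow>
      cmp D (copow_map f u) (coproj a n k)
      = cmp D (coproj (cd D f) (dm delta_cat u) (cmp delta_cat k u)) f"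
    unfolding copow_map_def using c by auto
qed

lemma copow_map_cmp:
  assumes f: "f \<in> Ar D" and g: "g \<in> Ar D" and fg: "cd D f = dm D g"
    and u: "u \<in> Ar delta_cat" and v: "v \<in> Ar delta_cat" and uv: "cd delta_cat v = dm delta_cat u"
  shows "copow_map (cmp D g f) (cmp delta_cat u v) = cmp D (copow_map g v) (copow_map f u)"
proof (rule copow_eqI[OF dm_closed[OF f], where n = "cd delta_cat u"])
  note c = cmp_props[OF f g fg] cat_cmp[OF category_delta v u uv]
  note b = copow_map_props[OF f u] copow_map_props[OF g v] copow_map_props[OF c(1,4)]
  show "copow_map (cmp D g f) (cmp delta_cat u v) \<in> Ar D"
      "cmp D (copow_map g v) (copow_map f u) \<in> Ar D"
    "dm D (copow_map (cmp D g f) (cmp delta_cat u v)) = copow (dm D f) (cd delta_cat u)"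
    "dm D (cmp D (copow_map g v) (copow_map f u)) = copow (dm D f) (cd delta_cat u)"
    "cd D (copow_map (cmp D g f) (cmp delta_cat u v))
        = cd D (cmp D (copow_map g v) (copow_map f u))"
    using b(1-3) b(5-7) b(9-11) c fg uv by (simp_all add: cmp_props)
  fix k assume k: "k \<in> hom delta_cat (cd delta_cat u) 1"
  note k1 = delta_cmp_hom[OF u k]
  have k1': "cmp delta_cat k u \<in> hom delta_cat (cd delta_cat v) 1" using k1 uv by simp
  have k3: "k \<in> hom delta_cat (cd delta_cat (cmp delta_cat u v)) 1" using k c(6) by simp
  have k2: "cmp delta_cat (cmp delta_cat k u) v \<in> hom delta_cat (dm delta_cat v) 1"
    using delta_cmp_hom[OF v, of "cmp delta_cat k u" 1] k1 uv by simp
  have kk: "cmp delta_cat k (cmp delta_cat u v) = cmp delta_cat (cmp delta_cat k u) v"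
    using k u v uv by (simp add: cat_assoc[OF category_delta] hom_iff)
  note i = coproj_hom[OF dm_closed[OF f] k] coproj_hom[OF cd_closed[OF f] k1] coproj_hom[OF
      cd_closed[OF g] k2]
  have "cmp D (cmp D (copow_map g v) (copow_map f u)) (coproj (dm D f) (cd delta_cat u) k)
    = cmp D (copow_map g v) (cmp D (copow_map f u) (coproj (dm D f) (cd delta_cat u) k))"
    using b(1-3) b(5-7) i fg uv by (intro cmp_assoc'[symmetric]) simp_all
  also have "\<dots> = cmp D (copow_map g v) (cmp D (coproj (cd D f) (dm delta_cat u) (cmp delta_cat k
      u)) f)"
    using b(4)[OF k HOL.refl HOL.refl] by simp
  also have "\<dots> = cmp D (cmp D (copow_map g v) (coproj (cd D f) (dm delta_cat u) (cmp delta_cat k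
      u))) f"
    using b(5-7) i fg uv f by (intro cmp_assoc') simp_all
  also have "\<dots> = cmp D (cmp D (coproj (cd D g) (dm delta_cat v) (cmp delta_cat (cmp delta_cat k u)
      v)) g) f"
    by (simp only: b(8)[OF k1' fg uv[symmetric]])
  also have "\<dots> = cmp D (coproj (cd D g) (dm delta_cat v) (cmp delta_cat (cmp delta_cat k u) v))
      (cmp D g f)"
    using i f g fg by (intro cmp_assoc'[symmetric]) simp_all
  also have "\<dots> = cmp D (copow_map (cmp D g f) (cmp delta_cat u v)) (coproj (dm D f) (cd delta_cat
      u) k)"
    by (simp only: b(12)[OF k3 c(2)[symmetric] c(6)[symmetric]] c(3,5) kk)
  finally show "cmp D (copow_map (cmp D g f) (cmp delta_cat u v)) (coproj (dm D f) (cd delta_cat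
      u) k)
    = cmp D (cmp D (copow_map g v) (copow_map f u)) (coproj (dm D f) (cd delta_cat u) k)" ..
qed

lemma copow_map_idn:
  assumes "A \<in> Ob D" shows "copow_map (idn D A) (idn delta_cat n) = idn D (copow A n)"
proof (rule copow_eqI[OF assms, where n = n])
  note d = cat_idn[OF category_delta, of n]
  note b = copow_map_props[OF idn_props(1)[OF assms] d(1)]
  show "copow_map (idn D A) (idn delta_cat n) \<in> Ar D" "idn D (copow A n) \<in> Ar D"
    "dm D (copow_map (idn D A) (idn delta_cat n)) = copow A n" "dm D (idn D (copow A n))
        = copow A n"
    "cd D (copow_map (idn D A) (idn delta_cat n)) = cd D (idn D (copow A n))"
    using b d assms idn_props by simp_all
  fix k assume k: "k \<in> hom delta_cat n 1"
  then have "cmp delta_cat k (idn delta_cat n) = k"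
    by (simp add: hom_iff cat_unit[OF category_delta])
  then show "cmp D (copow_map (idn D A) (idn delta_cat n)) (coproj A n k)
      = cmp D (idn D (copow A n)) (coproj A n k)"
    using b(4)[of k A n] k d assms coproj_hom[OF assms k] by (simp add: idn_props cmp_idn')
qed

text \<open>The simplicial object \<open>A \<boxtimes> \<Delta>[1]\<close> for constant \<open>A\<close>, and the functor \<open>A \<mapsto> A \<boxtimes> \<Delta>[1]\<close>.\<close>

definition box where "box A = Func (\<lambda>n\<in>Ob delta_op. copow A n)
    (\<lambda>u\<in>Ar delta_op. copow_map (idn D A) u)"

lemma box_simps [simp]: "fob (box A) n = copow A n" "u \<in> Ar delta_cat \<Longrightarrow> far (box A) u
    = copow_map (idn D A) u"
  by (simp_all add: box_def op_cat_simps)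

lemma functor_box: "A \<in> Ob D \<Longrightarrow> is_functor delta_op D (box A)"
  unfolding box_def using J
  by (intro is_functorI)
    (auto simp: hom_iff dop_simps copow_map_props idn_props copow_map_idn cmp_idn' simp flip:
        copow_map_cmp)

definition box_fun where
  "box_fun = Func (\<lambda>A\<in>Ob D. box A)
    (\<lambda>f\<in>Ar D. NT (box (dm D f)) (box (cd D f)) (\<lambda>n\<in>Ob delta_op. copow_map f (idn delta_cat n)))"

lemma box_fun_simps [simp]: "A \<in> Ob D \<Longrightarrow> fob box_fun A = box A"
  "f \<in> Ar D \<Longrightarrow> far box_fun f
    = NT (box (dm D f)) (box (cd D f)) (\<lambda>n\<in>Ob delta_op. copow_map f (idn delta_cat n))"
  by (simp_all add: box_fun_def)

lemma nat_box_fun: "f \<in> Ar D \<Longrightarrow> is_nat_trans delta_op D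
    (NT (box (dm D f)) (box (cd D f)) (\<lambda>n\<in>Ob delta_op. copow_map f (idn delta_cat n)))"
  using J functor_box dm_closed cd_closed
  by (intro is_nat_transI)
    (auto simp: hom_iff dop_simps copow_map_props idn_props cmp_idn' simp flip: copow_map_cmp)

lemma functor_box_fun: "is_functor D SS box_fun"
  unfolding box_fun_def
proof (rule is_functorI[OF is_cat])
  fix f g assume "f \<in> Ar D" "g \<in> Ar D" "cd D f = dm D g"
  then show "NT (box (dm D (cmp D g f))) (box (cd D (cmp D g f)))
      (\<lambda>n\<in>Ob delta_op. copow_map (cmp D g f) (idn delta_cat n)) =
       cmp SS (NT (box (dm D g)) (box (cd D g)) (\<lambda>n\<in>Ob delta_op. copow_map g (idn delta_cat n)))
        (NT (box (dm D f)) (box (cd D f)) (\<lambda>n\<in>Ob delta_op. copow_map f (idn delta_cat n)))"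
    by (auto simp: cmp_props dop_simps simp flip: copow_map_cmp intro!: restrict_ext)
qed (use functor_box nat_box_fun in \<open>auto simp: fun_cat_simps hom_fun_cat idn_props copow_map_idn
    intro!: restrict_ext\<close>)

lemma vertex_hom: "e \<le> 1 \<Longrightarrow> vertex n e \<in> hom delta_cat n 1"
  by (auto simp: vertex_def hom_iff intro!: dmap_Ar)

lemma vertex_cmp: "u \<in> Ar delta_cat \<Longrightarrow> cmp delta_cat (vertex (cd delta_cat u) e) u
    = vertex (dm delta_cat u) e"
  by (erule dmap_cases) (simp add: vertex_def)

lemma is_box_box:
  assumes A: "A \<in> Ob D"
  shows "is_box D (const_fun delta_op D A) (std_simplex 1) (box A) (coproj A)"
  unfolding is_box_def
proof (intro conjI allI ballI)
  show "box A \<in> Ob SS" using functor_box[OF A] by (simp add: fun_cat_simps)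
  show "is_coproduct D (fob (std_simplex 1) n) (\<lambda>_. fob (const_fun delta_op D A) n) (fob (box A)
      n) (coproj A n)" for n
    using is_coproduct_copow[OF A, of n] by (simp add: std_simplex_def)
  fix u k assume u: "u \<in> Ar delta_cat" and k: "k \<in> fob (std_simplex 1) (cd delta_cat u)"
  then show "cmp D (far (box A) u) (coproj A (cd delta_cat u) k) =
           cmp D (coproj A (dm delta_cat u) (snd (snd (far (std_simplex 1) u)) k))
            (far (const_fun delta_op D A) u)"
    using copow_map_props(4)[OF idn_props(1)[OF A] u, of k A] A
    by (simp add: std_simplex_def idn_props op_cat_simps)
qed

text \<open>The inclusion of \<open>A\<close> at the vertex \<open>e\<close> of \<open>\<Delta>[1]\<close>. For \<open>e = 1\<close> this is the map \<open>d\<^sub>0\<^sup>A\<close> of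
  (S5).\<close>

definition box_end where "box_end e A = NT (const_fun delta_op D A) (box A)
    (\<lambda>n\<in>Ob delta_op. coproj A n (vertex n e))"
definition box_end_nt where "box_end_nt e = NT (const_s D) box_fun (\<lambda>A\<in>Ob D. box_end e A)"

lemma d0_map_box: "d0_map (const_fun delta_op D A) (box A) (coproj A) = box_end 1 A"
proof -
  have "cmp delta_cat coface0 (n, 0, \<lambda>i\<in>{..n}. 0) = vertex n 1" for n
    by (auto simp: delta_cat_def coface0_def vertex_def dmap_def compose_def intro!: restrict_ext)
  then show ?thesis by (simp add: d0_map_def box_end_def)
qed

lemma nat_box_end:
  assumes "A \<in> Ob D" "e \<le> 1"
  shows "is_nat_trans delta_op D (box_end e A)"
  unfolding box_end_def
proof (rule is_nat_transI[OF functor_const[OF J is_cat assms(1)] functor_box[OF assms(1)] J])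
  fix u assume u: "u \<in> Ar delta_op"
  then have u': "u \<in> Ar delta_cat" by (simp add: op_cat_simps)
  note b = copow_map_props(4)[OF idn_props(1)[OF assms(1)] u' vertex_hom[OF assms(2)], of A]
  show "cmp D (coproj A (cd delta_op u) (vertex (cd delta_op u) e)) (far (const_fun delta_op D A)
      u) =
         cmp D (far (box A) u) (coproj A (dm delta_op u) (vertex (dm delta_op u) e))"
    using u u' b assms by (simp add: op_cat_simps vertex_cmp idn_props)
qed (use assms coproj_hom[OF assms(1) vertex_hom[OF assms(2)]] in \<open>simp add: hom_iff\<close>)

lemma nat_box_end_nt:
  assumes "e \<le> 1"
  shows "is_nat_trans D SS (box_end_nt e)"
  unfolding box_end_nt_def
proof (rule is_nat_transI[OF functor_diag_fun[OF J is_cat] functor_box_fun is_cat])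
  fix f assume f: "f \<in> Ar D"
  have "cmp D (copow_map f (idn delta_cat n)) (coproj (dm D f) n (vertex n e))
      = cmp D (coproj (cd D f) n (vertex n e)) f" for n
    using copow_map_props(4)[OF f idn_delta(1)[of n], of "vertex n e"
        "dm D f" n] vertex_hom[OF assms, of n]
       vertex_cmp[OF idn_delta(1)[of n], of e]
    by simp
  then show "cmp SS (box_end e (cd D f)) (far (const_s D) f)
      = cmp SS (far box_fun f) (box_end e (dm D f))"
    using f by (simp add: box_end_def)
qed (use assms in \<open>simp add: hom_fun_cat nat_box_end\<close>, simp add: box_end_def)

subsection \<open>Cylinders and homotopies\<close>

text \<open>The cylinder \<open>X \<boxtimes> \<Delta>[1]\<close> of a simplicial object, as the diagonal of \<open>n \<mapsto> X\<^sub>n \<boxtimes> \<Delta>[1]\<close>.\<close>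

definition cyl where "cyl = fun_comp SS (diagonal D) (post delta_op D box_fun)"

lemma functor_cyl: "is_functor SS SS cyl"
  unfolding cyl_def
  using functor_fun_comp[OF S functor_post[OF J is_cat functor_box_fun] functor_diagonal[OF
      is_cat]] .

lemma cyl_simps:
  assumes Y: "is_functor delta_op D Y"
  shows "fob (fob cyl Y) n = copow (fob Y n) n" "u \<in> Ar delta_cat \<Longrightarrow> far (fob cyl Y) u
      = copow_map (far Y u) u"
proof -
  have f: "is_functor delta_op SS (fun_comp delta_op box_fun Y)"
    using functor_fun_comp[OF J Y functor_box_fun] .
  note y = functor_simps[OF Y]
  have e: "fob cyl Y = diag_ob D (fun_comp delta_op box_fun Y)"
    using Y f by (simp add: cyl_def fun_cat_simps post_simps diagonal_simps)
  show "fob (fob cyl Y) n = copow (fob Y n) n" using y by (simp add: e diag_ob_simps)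
  assume u: "u \<in> Ar delta_cat"
  have "far (fob cyl Y) u = cmp D (copow_map (far Y u) (idn delta_cat (dm delta_cat u)))
     (copow_map (idn D (fob Y (cd delta_cat u))) u)"
    using u y by (simp add: e diag_ob_simps op_cat_simps)
  also have "\<dots> = copow_map (far Y u) u"
    using u y cat_idn[OF category_delta] by (subst copow_map_cmp[symmetric])
      (simp_all add: op_cat_simps idn_props cmp_idn' cat_unit[OF category_delta])
  finally show "far (fob cyl Y) u = copow_map (far Y u) u" .
qed

lemma cyl_far:
  assumes \<phi>: "is_nat_trans delta_op D \<phi>"
  shows "cpt (far cyl \<phi>) n = copow_map (cpt \<phi> n) (idn delta_cat n)"
  using nat_whisk_left[OF J \<phi> functor_box_fun] nat_cpt[OF \<phi>] \<phi>
  by (simp add: cyl_def fun_cat_simps post_simps diagonal_simps)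

text \<open>The inclusions of \<open>X\<close> at the two ends of its cylinder.\<close>

definition cyl_end where "cyl_end e = whisk_left SS (diagonal D) (post_nt delta_op D (box_end_nt
    e))"

lemma nat_cyl_end:
  assumes "e \<le> 1"
  shows "is_nat_trans SS SS (cyl_end e)" "src (cyl_end e) = id_fun SS" "tgt (cyl_end e) = cyl"
  using nat_whisk_left[OF S nat_post[OF J is_cat nat_box_end_nt[OF assms]] functor_diagonal[OF
      is_cat]]
  by (simp_all add: cyl_end_def post_nt_simps box_end_nt_def cyl_def diagonal_post_const)

lemma cyl_end_cpt:
  assumes "is_functor delta_op D X" "e \<le> 1"
  shows "cpt (cpt (cyl_end e) X) n = coproj (fob X n) n (vertex n e)"
proof -
  have "is_nat_trans delta_op SS (whisk_right delta_op (box_end_nt e) X)"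
    using nat_whisk_right[OF J nat_box_end_nt[OF assms(2)] assms(1)] .
  then show ?thesis using assms functor_ob[OF assms(1), of n]
    by (simp add: cyl_end_def fun_cat_simps post_nt_simps diagonal_simps box_end_nt_def box_end_def)
qed

text \<open>The map \<open>(X \<circ> K1) \<boxtimes> \<Delta>[1] \<rightarrow> X \<circ> K2\<close> defined by a homotopy \<open>h\<close>: its components in degree \<open>n\<close>,
  the simplicial map, and the transformation natural in \<open>X\<close>.\<close>

definition htpy_cpt where
  "htpy_cpt K1 K2 h X n = copair (fob X (fob K1 n)) n (fob X (fob K2 n)) (\<lambda>k. far X (h n k))"

definition htpy_map where
  "htpy_map K1 K2 h X = NT (fob cyl (fun_comp delta_op X K1)) (fun_comp delta_op X K2)
    (\<lambda>n\<in>Ob delta_op. htpy_cpt K1 K2 h X n)"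

definition htpy_nt where
  "htpy_nt K1 K2 h = NT (fun_comp SS cyl (dpre K1)) (dpre K2)
    (\<lambda>X\<in>Ob SS. htpy_map K1 K2 h X)"

context
  fixes K1 K2 h
  assumes K1: "is_functor delta_op delta_op K1" and K2: "is_functor delta_op delta_op K2"
    and h: "simplicial_homotopy K1 K2 h"
begin

lemma h_props:
  assumes "k \<in> hom delta_cat n 1"
  shows "h n k \<in> Ar delta_op" "dm delta_op (h n k) = fob K1 n" "cd delta_op (h n k) = fob K2 n"
  using h assms by (auto simp: simplicial_homotopy_def hom_iff)

lemma copair_h:
  assumes X: "is_functor delta_op D X"
  shows "htpy_cpt K1 K2 h X n \<in> Ar D"
   "dm D (htpy_cpt K1 K2 h X n) = copow (fob X (fob K1 n)) n"
   "cd D (htpy_cpt K1 K2 h X n) = fob X (fob K2 n)"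
   "k \<in> hom delta_cat n 1 \<Longrightarrow> cmp D (htpy_cpt K1 K2 h X n)
      (coproj (fob X (fob K1 n)) n k) = far X (h n k)"
  using copair_props[of "fob X (fob K1 n)" "fob X (fob K2 n)" n "\<lambda>k. far X (h n k)"]
    functor_simps[OF X] h_props by (auto simp: hom_iff htpy_cpt_def)

lemma nat_htpy_map:
  assumes X: "is_functor delta_op D X"
  shows "is_nat_trans delta_op D (htpy_map K1 K2 h X)"
  unfolding htpy_map_def
proof (rule is_nat_transI)
  note x = functor_simps[OF X] note k1 = functor_simps[OF K1] note k2 = functor_simps[OF K2]
  have XK: "is_functor delta_op D (fun_comp delta_op X K1)"
      "is_functor delta_op D (fun_comp delta_op X K2)"
    using functor_fun_comp J K1 K2 X by blast+
  show "is_functor delta_op D (fob cyl (fun_comp delta_op X K1))"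
    using functor_ob[OF functor_cyl, of "fun_comp delta_op X K1"] XK by (simp add: fun_cat_simps)
  show "is_functor delta_op D (fun_comp delta_op X K2)" by fact
  fix n
  show "htpy_cpt K1 K2 h X n \<in>
       hom D (fob (fob cyl (fun_comp delta_op X K1)) n) (fob (fun_comp delta_op X K2) n)"
    using copair_h[OF X, where n = n] by (simp add: hom_iff cyl_simps[OF XK(1)])
next
  note x = functor_simps[OF X] note k1 = functor_simps[OF K1] note k2 = functor_simps[OF K2]
  have XK: "is_functor delta_op D (fun_comp delta_op X K1)"
    using functor_fun_comp J K1 X by blast
  let ?c = "\<lambda>n. htpy_cpt K1 K2 h X n"
  fix u assume u: "u \<in> Ar delta_op"
  then have u': "u \<in> Ar delta_cat" by (simp add: op_cat_simps)
  let ?n = "cd delta_cat u" and ?m = "dm delta_cat u"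
  let ?f = "far X (far K1 u)"
  note ud = k1(2-4)[OF u] k2(2-4)[OF u] x(2-4)[OF k1(2)[OF u]] x(2-4)[OF k2(2)[OF u]]
  note ud = ud[unfolded op_cat_simps]
  note b = copow_map_props[OF x(2)[OF k1(2)[OF u]] u']
  have "cmp D (?c ?m) (copow_map ?f u) = cmp D (far X (far K2 u)) (?c ?n)"
  proof (rule copow_eqI[where A = "fob X (fob K1 ?n)" and n = ?n])
    show "fob X (fob K1 ?n) \<in> Ob D" using x k1 by simp
    show "cmp D (?c ?m) (copow_map ?f u) \<in> Ar D" "cmp D (far X (far K2 u)) (?c ?n) \<in> Ar D"
      "dm D (cmp D (?c ?m) (copow_map ?f u)) = copow (fob X (fob K1 ?n)) ?n"
      "dm D (cmp D (far X (far K2 u)) (?c ?n)) = copow (fob X (fob K1 ?n)) ?n"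
      "cd D (cmp D (?c ?m) (copow_map ?f u)) = cd D (cmp D (far X (far K2 u)) (?c ?n))"
      using copair_h[OF X, where n = "?m"] copair_h[OF X, where n = "?n"] b ud
        by (simp_all add: cmp_props)
    fix k assume k: "k \<in> hom delta_cat ?n 1"
    let ?k = "cmp delta_cat k u"
    note k' = delta_cmp_hom[OF u' k]
    note i = coproj_hom[OF _ k, of "fob X (fob K1 ?n)"] coproj_hom[OF _ k', of "fob X (fob K1 ?m)"]
    have X1: "fob X (fob K1 n) \<in> Ob D" for n using x k1 by simp
    have "cmp D (cmp D (?c ?m) (copow_map ?f u)) (coproj (fob X (fob K1 ?n)) ?n k)
      = cmp D (?c ?m) (cmp D (coproj (fob X (fob K1 ?m)) ?m ?k) ?f)"
      using b(1-3) b(4)[OF k, of "fob X (fob K1 ?n)"] copair_h(1-3)[OF X, where n = "?m"] i X1 ud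
        by (simp flip: cmp_assoc')
    also have "\<dots> = cmp D (far X (h ?m ?k)) ?f"
      using copair_h(1-3)[OF X, where n = "?m"] copair_h(4)[OF X k'] i X1 ud
        by (simp add: cmp_assoc')
    also have "\<dots> = far X (cmp delta_op (h ?m ?k) (far K1 u))"
      using x(6)[of "far K1 u" "h ?m ?k"] h_props[OF k'] k1(2-4)[OF u] by (simp add: op_cat_simps)
    also have "\<dots> = far X (cmp delta_op (far K2 u) (h ?n k))"
      using h u' k by (simp add: simplicial_homotopy_def)
    also have "\<dots> = cmp D (far X (far K2 u)) (far X (h ?n k))"
      using x(6)[of "h ?n k" "far K2 u"] h_props[OF k] k2(2-4)[OF u] by (simp add: op_cat_simps)
    also have "\<dots> = cmp D (cmp D (far X (far K2 u)) (?c ?n)) (coproj (fob X (fob K1 ?n)) ?n k)"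
      using copair_h(1-3)[OF X, where n = "?n"] copair_h(4)[OF X k] i X1 ud
        by (simp flip: cmp_assoc')
    finally show "cmp D (cmp D (?c ?m) (copow_map ?f u)) (coproj (fob X (fob K1 ?n)) ?n k)
      = cmp D (cmp D (far X (far K2 u)) (?c ?n)) (coproj (fob X (fob K1 ?n)) ?n k)" .
  qed
  then show "cmp D (?c (cd delta_op u)) (far (fob cyl (fun_comp delta_op X K1)) u) =
         cmp D (far (fun_comp delta_op X K2) u) (?c (dm delta_op u))"
    using u u' by (simp add: op_cat_simps cyl_simps[OF XK])
qed (rule J)

lemma nat_htpy_nt: "is_nat_trans SS SS (htpy_nt K1 K2 h)"
  unfolding htpy_nt_def
proof (rule is_nat_transI)
  note p = functor_pre[OF J J is_cat K1] functor_pre[OF J J is_cat K2]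
  show "is_functor SS SS (fun_comp SS cyl (dpre K1))"
    using functor_fun_comp[OF S p(1) functor_cyl] .
  show "is_functor SS SS (dpre K2)" by (rule p(2))
  show "htpy_map K1 K2 h X \<in> hom SS (fob (fun_comp SS cyl (dpre K1)) X)
          (fob (dpre K2) X)" if "X \<in> Ob SS" for X
    using that nat_htpy_map by (simp add: hom_fun_cat fun_cat_simps pre_simps) (simp add:
        htpy_map_def)
  fix \<phi> assume "\<phi> \<in> Ar SS"
  then have \<phi>: "is_nat_trans delta_op D \<phi>" by (simp add: fun_cat_simps)
  note f = nat_functors[OF \<phi>]
  note k1 = functor_simps[OF K1] note k2 = functor_simps[OF K2]
  note w = nat_whisk_right[OF J \<phi> K1]
  note c = nat_cpt[OF \<phi>]
  let ?X = "src \<phi>" and ?Y = "tgt \<phi>"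
  have sq: "cmp D (htpy_cpt K1 K2 h ?Y n) (copow_map (cpt \<phi> (fob K1 n)) (idn delta_cat n))
    = cmp D (cpt \<phi> (fob K2 n)) (htpy_cpt K1 K2 h ?X n)" (is "cmp D ?cY ?b = cmp D _ ?cX") for n
  proof (rule copow_eqI[where A = "fob ?X (fob K1 n)" and n = n])
    have cK: "cpt \<phi> (fob K1 n) \<in> Ar D" using c(1) by simp
    note b = copow_map_props[OF cK idn_delta(1)[of n], unfolded idn_delta]
    note y = functor_simps[OF f(1)] functor_simps[OF f(2)]
    show X1: "fob ?X (fob K1 n) \<in> Ob D" using y by simp
    have Y1: "fob ?Y (fob K1 n) \<in> Ob D" using y by simp
    show "cmp D ?cY ?b \<in> Ar D" "cmp D (cpt \<phi> (fob K2 n)) ?cX \<in> Ar D"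
      "dm D (cmp D ?cY ?b) = copow (fob ?X (fob K1 n)) n"
      "dm D (cmp D (cpt \<phi> (fob K2 n)) ?cX) = copow (fob ?X (fob K1 n)) n"
      "cd D (cmp D ?cY ?b) = cd D (cmp D (cpt \<phi> (fob K2 n)) ?cX)"
      using copair_h[OF f(1), where n = n] copair_h[OF f(2), where n = n] b(1-3) c
        by (simp_all add: cmp_props)
    fix k assume k: "k \<in> hom delta_cat n 1"
    note i = coproj_hom[OF X1 k] coproj_hom[OF Y1 k]
    have ki: "cmp delta_cat k (idn delta_cat n) = k" using k
        by (simp add: hom_iff cat_unit[OF category_delta])
    have "cmp D (cmp D ?cY ?b) (coproj (fob ?X (fob K1 n)) n k)
        = cmp D ?cY (cmp D (coproj (fob ?Y (fob K1 n)) n k) (cpt \<phi> (fob K1 n)))"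
      using b(1-3) b(4)[OF k, of "fob ?X (fob K1 n)"] copair_h(1-3)[OF f(2), of n] i c
        by (simp add: ki flip: cmp_assoc')
    also have "\<dots> = cmp D (far ?Y (h n k)) (cpt \<phi> (fob K1 n))"
      using copair_h(1-3)[OF f(2), of n] copair_h(4)[OF f(2) k] i c by (simp add: cmp_assoc')
    also have "\<dots> = cmp D (cpt \<phi> (fob K2 n)) (far ?X (h n k))"
      using nat_square[OF \<phi> h_props(1)[OF k]] h_props[OF k] by simp
    also have "\<dots> = cmp D (cmp D (cpt \<phi> (fob K2 n)) ?cX) (coproj (fob ?X (fob K1 n)) n k)"
      using copair_h(1-3)[OF f(1), of n] copair_h(4)[OF f(1) k] i c by (simp flip: cmp_assoc')
    finally show "cmp D (cmp D ?cY ?b) (coproj (fob ?X (fob K1 n)) n k)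
       = cmp D (cmp D (cpt \<phi> (fob K2 n)) ?cX) (coproj (fob ?X (fob K1 n)) n k)" .
  qed
  have e: "src (far cyl (whisk_right delta_op \<phi> K1)) = fob cyl (fun_comp delta_op ?X K1)"
    using functor_ar[OF functor_cyl, of "whisk_right delta_op \<phi> K1"] w by (simp add: fun_cat_simps)
  show "cmp SS (htpy_map K1 K2 h (cd SS \<phi>)) (far (fun_comp SS cyl (dpre K1)) \<phi>) =
         cmp SS (far (dpre K2) \<phi>) (htpy_map K1 K2 h (dm SS \<phi>))"
    using \<phi> e w sq by (simp add: fun_cat_simps pre_simps htpy_map_def cyl_far)
qed (rule S)

text \<open>Restricting the homotopy to an end of the cylinder gives the corresponding map.\<close>

lemma htpy_nt_end:
  assumes "e \<le> 1" and a: "is_nat_trans delta_op delta_op a" "src a = K1" "tgt a = K2"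
    and ae: "\<And>n. cpt a n = h n (vertex n e)"
  shows "cmp (fun_cat SS SS) (htpy_nt K1 K2 h) (whisk_right SS (cyl_end e) (dpre K1))
    = dpre_nt a" (is "?m = _")
proof (rule nt_eqI)
  note p = functor_pre[OF J J is_cat K1]
  note w = nat_whisk_right[OF S nat_cyl_end(1)[OF assms(1)] p]
  show "is_nat_trans SS SS (?m)"
    using nat_cmp[OF S S w nat_htpy_nt] by (simp add: htpy_nt_def nat_cyl_end[OF assms(1)])
  show "is_nat_trans SS SS (dpre_nt a)"
    using nat_pre[OF J J is_cat a(1)] .
  show "src (?m)
     = src (dpre_nt a)"
    using fun_comp_id(2)[OF S S p] by (simp add: pre_simps a nat_cyl_end[OF assms(1)])
  show "tgt (?m)
     = tgt (dpre_nt a)"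
    by (simp add: pre_simps a htpy_nt_def)
  fix X assume X': "X \<in> Ob SS"
  then have X: "is_functor delta_op D X" by (simp add: fun_cat_simps)
  have XK: "is_functor delta_op D (fun_comp delta_op X K1)" using functor_fun_comp[OF J K1 X] .
  have s: "src (cpt (cyl_end e) (fun_comp delta_op X K1)) = fun_comp delta_op X K1"
    using nat_cpt(2)[OF nat_cyl_end(1)[OF assms(1)], of "fun_comp delta_op X K1"] XK
    by (simp add: fun_cat_simps nat_cyl_end[OF assms(1)])
  have "cmp D (htpy_cpt K1 K2 h X n) (coproj (fob X (fob K1 n)) n (vertex n e))
     = far X (cpt a n)" for n
    using copair_h(4)[OF X vertex_hom[OF assms(1)]] ae by simp
  then show "cpt (?m) X =
         cpt (dpre_nt a) X"
    using X X' s cyl_end_cpt[OF XK assms(1)] by (simp add: pre_simps htpy_nt_def htpy_map_def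
        whisk_left_def a)
qed

end

end

section \<open>The total decalage\<close>

sublocale relative_category_coprod \<subseteq> coproduct_category D
  using finite_coproducts by unfold_locales

context relative_category_coprod
begin

text \<open>\<open>SE\<close> and \<open>BE\<close> are the levelwise weak equivalences of simplicial and bisimplicial objects,
  and \<open>Pc\<close> is the functor \<open>X \<mapsto> X \<times> \<Delta>\<close>.\<close>

abbreviation "SE \<equiv> objectwise delta_op D E"
abbreviation "BE \<equiv> objectwise delta_op SS SE"
abbreviation "Pc \<equiv> post delta_op D (const_s D)"

lemmas B = category_fun_cat[OF category_dop S]

lemma E_ar: "E \<subseteq> Ar D"
  using saturated unfolding saturated_def by blast

text \<open>Saturation, for arrows and for natural transformations: what is inverted by the
  localization is a weak equivalence.\<close>

lemma in_E:
  assumes "f \<in> Ar D" "inv_paths D E (dm D f) (cd D f) [Fwd f] q"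
  shows "f \<in> E"
  using inv_paths_iso[OF is_cat _ assms(2)] saturated assms(1)
  by (auto simp: saturated_def hom_iff)

lemma in_objectwise:
  assumes A: "is_nat_trans A D \<alpha>"
    and i: "inv_paths (fun_cat A D) (objectwise A D E) (src \<alpha>) (tgt \<alpha>) [Fwd \<alpha>] q"
  shows "\<alpha> \<in> objectwise A D E"
  unfolding objectwise_iff
proof (intro conjI ballI A)
  fix a assume a: "a \<in> Ob A"
  show "cpt \<alpha> a \<in> E"
    using rel_map_inv_paths[OF rel_map_eval[OF a] i] nat_cpt[OF A a] in_E by simp
qed

lemma c_rel: "rel_functor D E SS SE (const_s D)"
  by (rule rel_functor_diag_fun[OF J is_cat E_ar])

lemma cS_rel: "rel_functor SS SE BB BE (const_s SS)"
  by (rule rel_functor_diag_fun[OF J S objectwise_ar])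

lemma Pc_rel: "rel_functor SS SE BB BE Pc"
  by (rule rel_functor_post[OF J is_cat c_rel])

lemma diagonal_rel: "rel_functor BB BE SS SE (diagonal D)"
  by (rule rel_functor_diagonal[OF is_cat])

text \<open>The total decalage \<open>Z\<^sub>n\<^sub>,\<^sub>m = X\<^sub>n\<^sub>+\<^sub>1\<^sub>+\<^sub>m\<close> and its projections \<open>p : Z \<rightarrow> X \<times> \<Delta>\<close> and
  \<open>q : Z \<rightarrow> \<Delta> \<times> X\<close>.\<close>

abbreviation "ZZ \<equiv> dec join_fun"
abbreviation "pp \<equiv> dec_nt join_proj1"
abbreviation "qq \<equiv> dec_nt join_proj2"

lemma ZZ: "is_functor SS BB ZZ" by (rule functor_dec[OF functor_join_fun])

lemma pq: "is_nat_trans SS BB pp" "src pp = ZZ" "tgt pp = Pc"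
  "is_nat_trans SS BB qq" "src qq = ZZ" "tgt qq = const_s SS"
  using nat_dec[OF nat_join_proj1] nat_dec[OF nat_join_proj2]
  by (simp_all add: dec_nt_st) (simp_all add: join_proj1_def join_proj2_def dec_diag dec_const)

lemma pq_cpt:
  assumes "is_functor delta_op D X"
  shows "cpt (cpt pp X) n = whisk_left delta_op X (join_pr1 n)" "cpt (cpt qq X) n
      = whisk_left delta_op X (join_pr2 n)"
  using assms nat_join_pr1 nat_join_pr2 by (simp_all add: dec_simps post_simps) (simp_all add:
      join_proj1_def join_proj2_def post_simps)

lemma diagonal_pq:
  "whisk_left SS (diagonal D) pp = dpre_nt diag_join_pr1" "whisk_left SS (diagonal D) qq
      = dpre_nt diag_join_pr2"
  by (simp_all only: diagonal_dec_nt[OF nat_join_proj1] diagonal_dec_nt[OF nat_join_proj2]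
      diag_join_pr1_def diag_join_pr2_def)

text \<open>On a constant object all three bisimplicial objects are constant, and both projections are
  the identity.\<close>

lemma pq_const: "whisk_right D pp (const_s D) = whisk_right D qq (const_s D)"
proof (rule nt_eqI)
  note c = functor_diag_fun[OF J is_cat]
  show "is_nat_trans D BB (whisk_right D pp (const_s D))"
      "is_nat_trans D BB (whisk_right D qq (const_s D))"
    using nat_whisk_right[OF is_cat pq(1) c] nat_whisk_right[OF is_cat pq(4) c] by blast+
  show "src (whisk_right D pp (const_s D)) = src (whisk_right D qq (const_s D))"
    "tgt (whisk_right D pp (const_s D)) = tgt (whisk_right D qq (const_s D))"
    by (simp_all add: pq post_diag_fun[OF J is_cat c])
  fix A assume A: "A \<in> Ob D"
  note k = functor_const[OF J is_cat A]
  have k': "const_fun delta_op D A \<in> Ob SS" using k by (simp add: fun_cat_simps)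
  have e: "whisk_left delta_op (const_fun delta_op D A) (join_pr1 n)
      = whisk_left delta_op (const_fun delta_op D A) (join_pr2 n)" for n
  proof (rule nt_eqI[OF nat_whisk_left[OF J nat_join_pr1 k] nat_whisk_left[OF J nat_join_pr2 k]])
    show "src (whisk_left delta_op (const_fun delta_op D A) (join_pr1 n))
        = src (whisk_left delta_op (const_fun delta_op D A) (join_pr2 n))"
      by (simp add: join_pr1_def join_pr2_def)
    show "tgt (whisk_left delta_op (const_fun delta_op D A) (join_pr1 n))
        = tgt (whisk_left delta_op (const_fun delta_op D A) (join_pr2 n))"
      by (simp add: join_pr1_def join_pr2_def fun_comp_const[OF J J k] fun_comp_id[OF J is_cat k])
  qed (simp add: join_pr1_def join_pr2_def op_cat_simps)
  have "cpt pp (const_fun delta_op D A) = cpt qq (const_fun delta_op D A)"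
  proof (rule nt_eqI)
    show "is_nat_trans delta_op SS (cpt pp (const_fun delta_op D A))"
      "is_nat_trans delta_op SS (cpt qq (const_fun delta_op D A))"
      using nat_cpt(1)[OF pq(1) k'] nat_cpt(1)[OF pq(4) k'] by (simp_all add: fun_cat_simps)
    show "src (cpt pp (const_fun delta_op D A)) = src (cpt qq (const_fun delta_op D A))"
      using nat_cpt(2)[OF pq(1) k'] nat_cpt(2)[OF pq(4) k'] by (simp add: pq)
    show "tgt (cpt pp (const_fun delta_op D A)) = tgt (cpt qq (const_fun delta_op D A))"
      using nat_cpt(3)[OF pq(1) k'] nat_cpt(3)[OF pq(4) k'] k k' fun_comp_const[OF J is_cat c A] A
      by (simp add: pq post_simps)
  qed (simp add: pq_cpt[OF k] e)
  then show "cpt (whisk_right D pp (const_s D)) A = cpt (whisk_right D qq (const_s D)) A"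
    using A by simp
qed

end

section \<open>The simple functor is left adjoint to the constant functor\<close>

lemma path_Fwd:
  "is_nat_trans A D \<alpha> \<Longrightarrow> is_path (fun_cat A D) W (src \<alpha>) [Fwd \<alpha>] (tgt \<alpha>)"
  by (simp add: fun_cat_simps nat_functors)

lemma loc_eq_cmp:
  assumes "is_nat_trans A D \<alpha>" "is_nat_trans A D \<beta>" "tgt \<alpha> = src \<beta>"
  shows "loc_eq (fun_cat A D) W (src \<alpha>) (tgt \<beta>) [Fwd \<alpha>, Fwd \<beta>] [Fwd (cmp (fun_cat A D) \<beta> \<alpha>)]"
  by (rule loc_eq.cmp[where b = "tgt \<alpha>"]) (use assms in \<open>auto simp: hom_fun_cat\<close>)

lemma loc_eq_idn:
  "is_functor A D F \<Longrightarrow> loc_eq (fun_cat A D) W F F [Fwd (idn (fun_cat A D) F)] []"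
  by (rule loc_eq.idn) (simp add: fun_cat_simps)

context simplicial_descent_structure
begin

lemma s_rel: "rel_functor SS SE D E s"
  using S1_functor S4 by (auto simp: rel_functor_def objectwise_iff fun_cat_simps)

text \<open>\<open>s\<close> applied in each outer degree: \<open>Z \<mapsto> (n \<mapsto> s(m \<mapsto> Z\<^sub>n\<^sub>,\<^sub>m))\<close>.\<close>

abbreviation "Ps \<equiv> post delta_op SS s"

lemma Ps_rel: "rel_functor BB BE SS SE Ps"
  by (rule rel_functor_post[OF J S s_rel])

lemma sD_rel: "rel_functor BB BE D E (simple_diag D s)"
  by (rule rel_functor_comp[OF B diagonal_rel s_rel objectwise_ar])

lemmas s_fun = rel_functorD[OF s_rel]
lemmas diag_fn = rel_functorD[OF diagonal_rel]

text \<open>Naturality of \<open>\<mu>\<close> along a transformation of functors from simplicial to bisimplicial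
  objects.\<close>

lemma mu_natural:
  assumes \<alpha>: "is_nat_trans SS BB \<alpha>"
  shows "nat_eq SS D E (fun_comp SS (simple_diag D s) (src \<alpha>)) (fun_comp SS (simple2 D s s) (tgt \<alpha>))
    ([Fwd (whisk_left SS s (whisk_left SS (diagonal D) \<alpha>))] @ WR SS (tgt \<alpha>) mu)
    (WR SS (src \<alpha>) mu @ [Fwd (whisk_left SS s (whisk_left SS Ps \<alpha>))])"
  using interchange_step[OF S B is_cat \<alpha>, of E "simple_diag D s" mu "simple2 D s s"] S2
  by (simp add: is_zigzag_def whisk_left_left[OF \<alpha>])

lemma mu_zigzag:
  assumes "is_functor SS BB F"
  shows "nat_zigzag SS D E (fun_comp SS (simple_diag D s) F) (WR SS F mu) (fun_comp SS (simple2 D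
      s s) F)"
  by (rule rel_map_zigzag[OF rel_map_WR[OF S assms] S2])

lemma Ps_weak:
  assumes \<alpha>: "is_nat_trans SS BB \<alpha>"
    and w: "\<And>X n. is_functor delta_op D X \<Longrightarrow> far s (cpt (cpt \<alpha> X) n) \<in> E"
  shows "whisk_left SS Ps \<alpha> \<in> objectwise SS SS SE"
  unfolding objectwise_iff
proof (intro conjI ballI)
  show "is_nat_trans SS SS (whisk_left SS Ps \<alpha>)"
    by (rule nat_whisk_left[OF S \<alpha> rel_functorD[OF Ps_rel]])
  fix X assume X: "X \<in> Ob SS"
  then have \<alpha>X: "is_nat_trans delta_op SS (cpt \<alpha> X)" using nat_cpt(1)[OF \<alpha> X]
      by (simp add: fun_cat_simps)
  show "is_nat_trans delta_op D (cpt (whisk_left SS Ps \<alpha>) X)"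
    using X \<alpha>X nat_whisk_left[OF J \<alpha>X s_fun] by (simp add: post_simps)
  show "cpt (cpt (whisk_left SS Ps \<alpha>) X) n \<in> E" for n
    using X \<alpha>X w by (simp add: post_simps fun_cat_simps)
qed

lemma s_weak:
  assumes "\<beta> \<in> objectwise SS SS SE"
  shows "whisk_left SS s \<beta> \<in> objectwise SS D E"
  using assms rel_map_WL[OF S s_rel] by (auto simp: rel_map_def)

text \<open>Through \<open>\<mu>\<close>, the map \<open>s(X \<rightarrow> X \<boxtimes> \<Delta>[1])\<close> corresponds to the result of applying \<open>s\<close> to the
  maps \<open>s(X\<^sub>n \<rightarrow> X\<^sub>n \<boxtimes> \<Delta>[1])\<close>, which are weak equivalences by (S5); then (S4) applies.\<close>

lemma s_inverts_cyl_end: "\<exists>q. inv_paths (fun_cat SS D) (objectwise SS D E) s (fun_comp SS s cyl)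
    [Fwd (whisk_left SS s (cyl_end 1))] q"
proof -
  define j where "j = post_nt delta_op D (box_end_nt 1)"
  have j: "is_nat_trans SS BB j" "src j = Pc" "tgt j = post delta_op D box_fun"
    unfolding j_def using nat_post[OF J is_cat nat_box_end_nt[of 1]]
        by (simp_all add: post_nt_simps box_end_nt_def)
  have "far s (cpt (cpt j X) n) \<in> E" if X: "is_functor delta_op D X" for X n
  proof -
    have A: "fob X n \<in> Ob D" using functor_ob[OF X] by simp
    have "cpt (cpt j X) n = box_end 1 (fob X n)"
      using X A by (simp add: j_def post_nt_simps box_end_nt_def)
    then show ?thesis using S5[OF A is_box_box[OF A]] by (simp add: d0_map_box)
  qed
  then have w: "whisk_left SS s (whisk_left SS Ps j) \<in> objectwise SS D E"
    by (intro s_weak Ps_weak j)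
  let ?F = "fun_cat SS D" and ?W = "objectwise SS D E"
  note m1 = mu_zigzag[OF nat_functors(1)[OF j(1)]] and m2 = mu_zigzag[OF nat_functors(2)[OF j(1)]]
  have C: "category ?F" by (rule category_fun_cat[OF S is_cat])
  have e: "src (whisk_left SS s (whisk_left SS Ps j)) = fun_comp SS (simple2 D s s) (src j)"
    "tgt (whisk_left SS s (whisk_left SS Ps j)) = fun_comp SS (simple2 D s s) (tgt j)"
    "src (whisk_left SS s (whisk_left SS (diagonal D) j)) = s"
    "tgt (whisk_left SS s (whisk_left SS (diagonal D) j)) = fun_comp SS s cyl"
    "fun_comp SS (simple_diag D s) (src j) = s"
    "fun_comp SS (simple_diag D s) (tgt j) = fun_comp SS s cyl"
    using fun_comp_assoc[OF nat_functors(1)[OF j(1)], symmetric, of s]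
      fun_comp_assoc[OF nat_functors(2)[OF j(1)], symmetric, of s]
    by (simp_all add: j diagonal_post_const fun_comp_id[OF S is_cat s_fun] cyl_def)
  have z: "nat_zigzag SS D E (fun_comp SS (simple2 D s s) (src j)) [Fwd (whisk_left SS s
      (whisk_left SS Ps j))]
      (fun_comp SS (simple2 D s s) (tgt j))"
  proof -
    have "is_nat_trans SS D (whisk_left SS s (whisk_left SS Ps j))"
      using w unfolding objectwise_iff ..
    from path_Fwd[OF this] have "cell SS D E (fun_comp SS (simple2 D s s) (src j))
        [Fwd (whisk_left SS s (whisk_left SS Ps j))] (fun_comp SS (simple2 D s s) (tgt j))"
      by (simp only: e)
    then show ?thesis using w by (simp add: is_zigzag_def del: is_path.simps)
  qed
  note z' = zigzag_inv[OF C zigzag_append[OF m1 z], THEN conjunct2]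
  have "is_nat_trans SS D (whisk_left SS s (whisk_left SS (diagonal D) j))"
    by (intro nat_whisk_left[OF S _ s_fun] nat_whisk_left[OF S j(1) diag_fn])
  from path_Fwd[OF this] have x: "cell SS D E (fun_comp SS (simple_diag D s) (src j))
      [Fwd (whisk_left SS s (whisk_left SS (diagonal D) j))] (fun_comp SS (simple_diag D s) (tgt
        j))"
    by (simp only: e)
  have nil: "inv_paths ?F ?W (fun_comp SS (simple_diag D s) (src j)) (fun_comp SS (simple_diag D
      s) (src j)) [] []"
    using path_ob(1)[OF C x] by (auto simp: inv_paths_def intro: loc_eq.refl)
  note i = inv_paths_eq[OF C z' loc_eq.sym[OF mu_natural[OF j(1)]]]
  have "inv_paths ?F ?W (fun_comp SS (simple_diag D s) (src j)) (fun_comp SS (simple_diag D s)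
      (tgt j))
    [Fwd (whisk_left SS s (whisk_left SS (diagonal D) j))] (WR SS (tgt j) mu @
      inv_path (WR SS (src j) mu @ [Fwd (whisk_left SS s (whisk_left SS Ps j))]) @ [])"
    by (rule inv_paths_factor[OF C nil zigzag_inv[OF C m2, THEN conjunct2] x]) (use i in simp)
  moreover have "whisk_left SS (diagonal D) j = cyl_end 1" by (simp add: cyl_end_def j_def)
  ultimately show ?thesis unfolding e by auto
qed

text \<open>The projection \<open>X \<boxtimes> \<Delta>[1] \<rightarrow> X\<close>, as the constant homotopy of the identity.\<close>

definition cyl_proj where "cyl_proj = htpy_nt (id_fun delta_op) (id_fun delta_op)
    (\<lambda>n k. idn delta_cat n)"

lemma homotopy_id: "simplicial_homotopy (id_fun delta_op) (id_fun delta_op) (\<lambda>n k. idn delta_cat n)"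
  by (simp add: simplicial_homotopy_def hom_iff dop_simps)

lemma cyl_proj: "is_nat_trans SS SS cyl_proj" "src cyl_proj = cyl" "tgt cyl_proj = id_fun SS"
  using nat_htpy_nt[OF functor_id[OF J] functor_id[OF J] homotopy_id]
  by (simp_all add: cyl_proj_def) (simp_all add: htpy_nt_def pre_id fun_comp_id[OF S S functor_cyl])

lemma cyl_proj_end:
  assumes "e \<le> 1"
  shows "cmp (fun_cat SS SS) cyl_proj (cyl_end e) = idn (fun_cat SS SS) (id_fun SS)"
proof -
  note i = functor_id[OF J]
  let ?i = "idn DD (id_fun delta_op)"
  have "cmp (fun_cat SS SS) cyl_proj (whisk_right SS (cyl_end e) (dpre (id_fun delta_op)))
      = dpre_nt ?i"
    unfolding cyl_proj_def
    by (rule htpy_nt_end[OF i i homotopy_id assms nat_idn[OF J J i, folded fun_cat_dc(3)]])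
      (simp_all add: op_cat_simps)
  then show ?thesis
    by (simp only: pre_id whisk_id(1)[OF S S nat_cyl_end(1)[OF assms]] pre_nt_idn[OF J J is_cat i])
qed

text \<open>The two ends of the cylinder are sections of the same projection, which \<open>s\<close> inverts because
  it inverts one of them.\<close>

lemma s_cylinder: "nat_eq SS D E s (fun_comp SS s cyl) [Fwd (whisk_left SS s (cyl_end 0))] [Fwd
    (whisk_left SS s (cyl_end 1))]"
proof -
  let ?F = "fun_cat SS D" and ?W = "objectwise SS D E"
  let ?s = "\<lambda>\<alpha>. whisk_left SS s \<alpha>"
  have C: "category ?F" by (rule category_fun_cat[OF S is_cat])
  have cyl_end: "is_nat_trans SS D (?s (cyl_end e))" "src (?s (cyl_end e)) = s"
      "tgt (?s (cyl_end e)) = fun_comp SS s cyl" if "e \<le> 1" for e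
    using nat_whisk_left[OF S nat_cyl_end(1)[OF that] s_fun] nat_cyl_end[OF that]
    by (simp_all add: fun_comp_id[OF S is_cat s_fun])
  have r: "is_nat_trans SS D (?s cyl_proj)" "src (?s cyl_proj) = fun_comp SS s cyl"
      "tgt (?s cyl_proj) = s"
    using nat_whisk_left[OF S cyl_proj(1) s_fun] cyl_proj
        by (simp_all add: fun_comp_id[OF S is_cat s_fun])
  have ret: "loc_eq ?F ?W s s ([Fwd (?s (cyl_end e))] @ [Fwd (?s cyl_proj)]) []" if e: "e \<le> 1" for e
  proof -
    have "cmp ?F (?s cyl_proj) (?s (cyl_end e)) = ?s (cmp (fun_cat SS SS) cyl_proj (cyl_end e))"
      by (rule whisk_left_cmp[symmetric, OF nat_cyl_end(1)[OF e] cyl_proj(1) _ s_fun]) (simp add: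
        nat_cyl_end[OF e] cyl_proj)
    also have "\<dots> = idn ?F s"
      by (simp only: cyl_proj_end[OF e] whisk_left_idn[OF functor_id[OF S] s_fun] fun_comp_id[OF S
        is_cat s_fun])
    finally have "loc_eq ?F ?W s s [Fwd (?s (cyl_end e)), Fwd (?s cyl_proj)] [Fwd (idn ?F s)]"
      using loc_eq_cmp[OF cyl_end(1)[OF e] r(1), of ?W] cyl_end[OF e] r by (simp del: fun_cat_dc)
    from loc_eq.trans[OF this loc_eq_idn[OF s_fun]] show ?thesis by simp
  qed
  obtain q where q: "inv_paths ?F ?W s (fun_comp SS s cyl) [Fwd (?s (cyl_end 1))] q"
      using s_inverts_cyl_end by blast
  have path: "is_path ?F ?W s [Fwd (?s (cyl_end e))] (fun_comp SS s cyl)" if "e \<le> 1" for e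
    using path_Fwd[OF cyl_end(1)[OF that], of ?W] cyl_end[OF that] by simp
  have pr: "is_path ?F ?W (fun_comp SS s cyl) [Fwd (?s cyl_proj)] s"
    using path_Fwd[OF r(1), of ?W] r by simp
  have "loc_eq ?F ?W s s ([Fwd (?s (cyl_end 1))] @ [Fwd (?s cyl_proj)]) ([Fwd (?s (cyl_end 1))]
      @ q)"
    using ret[of 1] q by (auto simp: inv_paths_def intro: loc_eq.sym loc_eq.trans)
  from inv_paths_cancel[OF q pr _ this] have "loc_eq ?F ?W (fun_comp SS s cyl) s [Fwd (?s
      cyl_proj)] q"
    using q by (simp add: inv_paths_def)
  then have ir: "inv_paths ?F ?W (fun_comp SS s cyl) s [Fwd (?s cyl_proj)] [Fwd (?s (cyl_end 1))]"
    using inv_paths_eq[OF C inv_paths_sym[OF q] loc_eq.sym] by blast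
  show ?thesis
    by (rule inv_paths_cancel_right[OF ir path[OF zero_le] path[OF order_refl]
          loc_eq.trans[OF ret[OF zero_le] loc_eq.sym[OF ret[OF order_refl]]]])
qed

text \<open>Hence \<open>s\<close> identifies the two ends of any homotopy.\<close>

lemma s_homotopy:
  assumes K1: "is_functor delta_op delta_op K1" and K2: "is_functor delta_op delta_op K2"
    and h: "simplicial_homotopy K1 K2 h"
    and a: "is_nat_trans delta_op delta_op a" "src a = K1" "tgt a = K2" "\<And>n. cpt a n
        = h n (vertex n 0)"
    and b: "is_nat_trans delta_op delta_op b" "src b = K1" "tgt b = K2" "\<And>n. cpt b n
        = h n (vertex n 1)"
  shows "nat_eq SS D E (fun_comp SS s (dpre K1)) (fun_comp SS s (dpre K2))
    [Fwd (whisk_left SS s (dpre_nt a))] [Fwd (whisk_left SS s (dpre_nt b))]"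
proof -
  let ?F = "fun_cat SS D" and ?W = "objectwise SS D E"
  let ?s = "\<lambda>\<alpha>. whisk_left SS s \<alpha>"
  let ?p = "dpre" and ?H = "htpy_nt K1 K2 h"
  note p = functor_pre[OF J J is_cat K1]
  note H = nat_htpy_nt[OF K1 K2 h]
  have Hst: "src ?H = fun_comp SS cyl (?p K1)" "tgt ?H = ?p K2" by (simp_all add: htpy_nt_def)
  have sH: "is_nat_trans SS D (?s ?H)" "src (?s ?H) = fun_comp SS s (fun_comp SS cyl (?p K1))"
    "tgt (?s ?H) = fun_comp SS s (?p K2)"
    using nat_whisk_left[OF S H s_fun] by (simp_all add: Hst)
  have step: "loc_eq ?F ?W (fun_comp SS s (?p K1)) (fun_comp SS s (?p K2))
      (WR SS (?p K1) [Fwd (?s (cyl_end e))] @ [Fwd (?s ?H)]) [Fwd (?s (dpre_nt c))]"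
    if c: "is_nat_trans delta_op delta_op c" "src c = K1" "tgt c = K2" "\<And>n. cpt c n
        = h n (vertex n e)"
      and e: "e \<le> 1" for c e
  proof -
    let ?w = "whisk_right SS (cyl_end e) (?p K1)"
    have w: "is_nat_trans SS SS ?w" "src ?w = ?p K1" "tgt ?w = fun_comp SS cyl (?p K1)"
      using nat_whisk_right[OF S nat_cyl_end(1)[OF e] p] nat_cyl_end[OF e]
        by (simp_all add: fun_comp_id[OF S S p])
    have sw: "is_nat_trans SS D (?s ?w)" "src (?s ?w) = fun_comp SS s (?p K1)"
       "tgt (?s ?w) = fun_comp SS s (fun_comp SS cyl (?p K1))"
      using nat_whisk_left[OF S w(1) s_fun] w by simp_all
    have "cmp ?F (?s ?H) (?s ?w) = ?s (cmp (fun_cat SS SS) ?H ?w)"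
      by (rule whisk_left_cmp[symmetric, OF w(1) H _ s_fun]) (simp only: w Hst)
    also have "\<dots> = ?s (dpre_nt c)"
      by (simp only: htpy_nt_end[OF K1 K2 h e c])
    finally have "loc_eq ?F ?W (fun_comp SS s (?p K1)) (fun_comp SS s (?p K2))
       [Fwd (?s ?w), Fwd (?s ?H)] [Fwd (?s (dpre_nt c))]"
      using loc_eq_cmp[OF sw(1) sH(1), of ?W] sw sH by (simp del: fun_cat_dc whisk_left_simps)
    then show ?thesis by (simp add: whisk_left_right[OF p])
  qed
  have pH: "is_path ?F ?W (fun_comp SS (fun_comp SS s cyl) (?p K1)) [Fwd (?s ?H)] (fun_comp SS s
      (?p K2))"
    using path_Fwd[OF sH(1), of ?W] by (simp only: sH fun_comp_assoc[OF p])
  have "loc_eq ?F ?W (fun_comp SS s (?p K1)) (fun_comp SS s (?p K2))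
      (WR SS (?p K1) [Fwd (?s (cyl_end 0))] @ [Fwd (?s ?H)]) (WR SS (?p K1) [Fwd (?s (cyl_end 1))]
        @ [Fwd (?s ?H)])"
    by (rule loc_right[OF eq_WR[OF S p s_cylinder] pH])
  from loc_eq.trans[OF loc_eq.trans[OF loc_eq.sym[OF step[OF a zero_le]] this] step[OF b
      order_refl]]
  show ?thesis .
qed

text \<open>For fixed \<open>n\<close> the map \<open>X\<^sub>n\<^sub>+\<^sub>1\<^sub>+\<^sub>m \<rightarrow> X\<^sub>n\<close> has a section, and the composite in the other
  order is homotopic to the identity by \<open>shift_htpy\<close>.\<close>

lemma s_inverts_join_pr1:
  "whisk_left SS s (dpre_nt (join_pr1 n)) \<in> objectwise SS D E"
proof -
  let ?F = "fun_cat SS D" and ?W = "objectwise SS D E"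
  let ?s = "\<lambda>\<alpha>. whisk_left SS s (dpre_nt \<alpha>)"
  let ?p = "\<lambda>K. fun_comp SS s (dpre K)"
  let ?k = "const_fun delta_op delta_op n"
  have st: "src (join_pr1 n) = shift_fun n" "tgt (join_pr1 n) = ?k" "src (join_sec n) = ?k"
      "tgt (join_sec n) = shift_fun n"
    by (simp_all add: join_pr1_def join_sec_def)
  have k: "is_functor delta_op delta_op ?k" by (rule functor_const[OF J J]) simp
  have snt: "is_nat_trans SS D (?s a)" "src (?s a) = ?p (src a)" "tgt (?s a) = ?p (tgt a)"
    if "is_nat_trans delta_op delta_op a" for a
    using nat_whisk_left[OF S nat_pre[OF J J is_cat that] s_fun] by (simp_all add: pre_simps)
  have cmp: "loc_eq ?F ?W (?p (src a)) (?p (tgt b)) [Fwd (?s a), Fwd (?s b)] [Fwd (?s (cmp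
      (fun_cat delta_op delta_op) b a))]"
    if a: "is_nat_trans delta_op delta_op a" "is_nat_trans delta_op delta_op b" "tgt a = src b"
        for a b
  proof -
    have "cmp ?F (?s b) (?s a) = whisk_left SS s (cmp (fun_cat SS SS) (dpre_nt b) (dpre_nt a))"
      by (rule whisk_left_cmp[symmetric, OF nat_pre[OF J J is_cat a(1)] nat_pre[OF J J is_cat
        a(2)] _ s_fun])
        (simp add: pre_simps a)
    also have "\<dots> = ?s (cmp (fun_cat delta_op delta_op) b a)" by (simp only: pre_nt_cmp[OF a])
    finally show ?thesis
      using loc_eq_cmp[OF snt(1)[OF a(1)] snt(1)[OF a(2)], of ?W] snt[OF a(1)] snt[OF a(2)] a(3)
      by (simp del: fun_cat_dc whisk_left_simps)
  qed
  have idn: "loc_eq ?F ?W (?p K) (?p K) [Fwd (?s (idn (fun_cat delta_op delta_op) K))] []"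
    if "is_functor delta_op delta_op K" for K
  proof -
    have "?s (idn (fun_cat delta_op delta_op) K) = idn ?F (?p K)"
      by (simp only: pre_nt_idn[OF J J is_cat that] whisk_left_idn[OF functor_pre[OF J J is_cat
        that] s_fun])
    then show ?thesis
      using loc_eq_idn[OF functor_fun_comp[OF S functor_pre[OF J J is_cat that] s_fun]]
        by (simp del: fun_cat_dc)
  qed
  have 1: "cmp (fun_cat delta_op delta_op) (join_pr1 n) (join_sec n)
      = idn (fun_cat delta_op delta_op) ?k"
    by (simp add: st) (auto simp: join_pr1_def join_sec_def op_cat_simps join_collapse_in1 intro!:
        restrict_ext)
  have "loc_eq ?F ?W (?p ?k) (?p ?k) [Fwd (?s (join_sec n)), Fwd (?s (join_pr1 n))] []"
    using loc_eq.trans[OF cmp[OF nat_join_sec[of n] nat_join_pr1[of n], unfolded st, OF HOL.refl,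
        unfolded 1] idn[OF k]] .
  moreover have "loc_eq ?F ?W (?p (shift_fun n)) (?p (shift_fun n)) [Fwd (?s (join_pr1 n)), Fwd
      (?s (join_sec n))] []"
  proof -
    let ?a = "cmp (fun_cat delta_op delta_op) (join_sec n) (join_pr1 n)" and ?b =
        "idn (fun_cat delta_op delta_op) (shift_fun n)"
    have "loc_eq ?F ?W (?p (shift_fun n)) (?p (shift_fun n)) [Fwd (?s ?a)] [Fwd (?s ?b)]"
    proof (rule s_homotopy[OF functor_shift_fun functor_shift_fun homotopy_shift])
      show "is_nat_trans delta_op delta_op ?a" using nat_cmp[OF J J nat_join_pr1[of n]
        nat_join_sec[of n]] st by simp
      show "is_nat_trans delta_op delta_op ?b" using nat_idn[OF J J functor_shift_fun] by simp
      show "src ?a = shift_fun n" "tgt ?a = shift_fun n" "src ?b = shift_fun n" "tgt ?b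
        = shift_fun n" by (simp_all add: st)
      show "cpt ?a m = shift_htpy n m (vertex m 0)" for m
        by (simp add: shift_htpy_ends(2)) (simp add: join_pr1_def join_sec_def op_cat_simps)
      show "cpt ?b m = shift_htpy n m (vertex m 1)" for m
        unfolding shift_htpy_ends(1) by (simp add: op_cat_simps)
    qed
    from loc_eq.trans[OF loc_eq.trans[OF cmp[OF nat_join_pr1[of n] nat_join_sec[of n], unfolded
        st, OF HOL.refl] this]
        idn[OF functor_shift_fun]]
    show ?thesis .
  qed
  ultimately have "inv_paths ?F ?W (src (?s (join_pr1 n))) (tgt (?s (join_pr1 n))) [Fwd (?s
      (join_pr1 n))] [Fwd (?s (join_sec n))]"
    using path_Fwd[OF snt(1)[OF nat_join_pr1[of n]], of ?W] path_Fwd[OF snt(1)[OF nat_join_sec[of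
        n]], of ?W]
      snt[OF nat_join_pr1[of n]] snt[OF nat_join_sec[of n]] st
    unfolding inv_paths_def by (simp del: whisk_left_simps is_path.simps)
  with in_objectwise[OF snt(1)[OF nat_join_pr1]] show ?thesis by blast
qed

lemma Ps_pp_weak: "whisk_left SS Ps pp \<in> objectwise SS SS SE"
proof (rule Ps_weak[OF pq(1)])
  fix X n assume X: "is_functor delta_op D X"
  then show "far s (cpt (cpt pp X) n) \<in> E"
    using s_inverts_join_pr1[of n] by (simp add: pq_cpt objectwise_iff fun_cat_simps pre_simps)
qed

text \<open>The unit \<open>1 \<Rightarrow> c s\<close> is \<open>post(\<lambda>)\<^sup>-\<^sup>1\<close>, followed by the inverse of \<open>post(s) p\<close> and by
  \<open>post(s) q\<close>. Its initial part \<open>eta0\<close> is a zigzag; the last step need not be a weak equivalence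
  of simplicial objects.\<close>

definition eta0 where "eta0 = inv_path (PN delta_op D lam) @ [Bwd (whisk_left SS Ps pp)]"
definition eta where "eta = eta0 @ [Fwd (whisk_left SS Ps qq)]"

lemma PN_lam: "nat_zigzag SS SS SE (fun_comp SS Ps Pc) (PN delta_op D lam) (id_fun SS)"
  using rel_map_zigzag[OF rel_map_post[OF J is_cat is_cat] S3]
  by (simp add: post_fun_comp[OF J is_cat rel_functorD[OF c_rel] s_fun] post_id[OF J is_cat])

lemma eta0: "nat_zigzag SS SS SE (id_fun SS) eta0 (fun_comp SS Ps ZZ)"
proof -
  have C: "category (fun_cat SS SS)" by (rule category_fun_cat[OF S S])
  note n = nat_whisk_left[OF S pq(1) rel_functorD[OF Ps_rel]]
  have "nat_zigzag SS SS SE (fun_comp SS Ps Pc) [Bwd (whisk_left SS Ps pp)] (fun_comp SS Ps ZZ)"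
    using Ps_pp_weak n nat_functors[OF n] by (simp add: is_zigzag_def fun_cat_simps pq)
  then show ?thesis unfolding eta0_def
    using zigzag_append[OF zigzag_inv[OF C PN_lam, THEN conjunct1]] by blast
qed

lemma Ps_qq: "is_nat_trans SS SS (whisk_left SS Ps qq)" "src (whisk_left SS Ps qq)
    = fun_comp SS Ps ZZ"
  "tgt (whisk_left SS Ps qq) = fun_comp SS (const_s D) s"
  using nat_whisk_left[OF S pq(4) rel_functorD[OF Ps_rel]] post_diag_fun[OF J S s_fun]
  by (simp_all add: pq)

lemma eta: "cell SS SS SE (id_fun SS) eta (fun_comp SS (const_s D) s)"
  unfolding eta_def
  using path_append[OF _ path_Fwd[OF Ps_qq(1)], unfolded Ps_qq(2,3)] eta0
      by (simp add: is_zigzag_def)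

lemma lam_cell: "cell D D E (fun_comp D s (const_s D)) lam (id_fun D)"
  using S3 by (simp add: is_zigzag_def)

text \<open>Write \<open>m = \<mu>\<^sub>Z\<close>. The paths \<open>m @ ?a @ l\<close> and \<open>m @ ?b @ n\<close> equal \<open>s(D p)\<close> and \<open>s(D q)\<close> by
  naturality of \<open>\<mu>\<close> and (S3); these agree by the homotopy \<open>diag_htpy\<close>, and \<open>m\<close> cancels. The
  triangle composite is the inverse of \<open>?a @ l\<close> followed by \<open>?b @ n\<close>.\<close>

lemma triangle_s: "nat_eq SS D E s s (WL SS s eta @ WR SS s lam) []"
proof -
  let ?F = "fun_cat SS D" and ?W = "objectwise SS D E"
  let ?s = "\<lambda>\<alpha>. whisk_left SS s \<alpha>"
  have C: "category ?F" by (rule category_fun_cat[OF S is_cat])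
  define l where "l = WL SS s (PN delta_op D lam)"
  define n where "n = WR SS s lam"
  define m where "m = WR SS ZZ mu"
  let ?a = "[Fwd (?s (whisk_left SS Ps pp))]" and ?b = "[Fwd (?s (whisk_left SS Ps qq))]"
  let ?Da = "[Fwd (?s (whisk_left SS (diagonal D) pp))]" and ?Db =
      "[Fwd (?s (whisk_left SS (diagonal D) qq))]"
  let ?sDZ = "fun_comp SS (simple_diag D s) ZZ" and ?ssZ = "fun_comp SS (simple2 D s s) ZZ"
  have zm: "nat_zigzag SS D E ?sDZ m ?ssZ" unfolding m_def by (rule mu_zigzag[OF ZZ])
  have Pcf: "is_functor SS BB Pc" and cSf: "is_functor SS BB (const_s SS)"
    using rel_functorD[OF Pc_rel] rel_functorD[OF cS_rel] by blast+
  have id1: "fun_comp SS (simple_diag D s) Pc = s" "fun_comp SS (simple_diag D s) (const_s SS) = s"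
    by (simp_all add: fun_comp_assoc[OF Pcf, symmetric] fun_comp_assoc[OF cSf, symmetric]
        diagonal_post_const diagonal_const fun_comp_id[OF S is_cat s_fun])
  have zl: "nat_zigzag SS D E (fun_comp SS (simple2 D s s) Pc) l s"
    unfolding l_def using rel_map_zigzag[OF rel_map_WL[OF S s_rel] PN_lam]
    by (simp add: fun_comp_assoc[OF Pcf] fun_comp_id[OF S is_cat s_fun])
  have zn: "nat_zigzag SS D E (fun_comp SS (simple2 D s s) (const_s SS)) n s"
    unfolding n_def using rel_map_zigzag[OF rel_map_WR[OF S s_fun] S3]
    by (simp add: fun_comp_assoc[OF s_fun, symmetric] fun_comp_assoc[OF cSf, symmetric]
        post_diag_fun[OF J S s_fun] fun_comp_id[OF S is_cat s_fun])
  have na: "is_nat_trans SS D (?s (whisk_left SS Ps pp))"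
      "is_nat_trans SS D (?s (whisk_left SS Ps qq))"
    by (intro nat_whisk_left[OF S _ s_fun] nat_whisk_left[OF S _ rel_functorD[OF Ps_rel]] pq)+
  have za: "nat_zigzag SS D E ?ssZ ?a (fun_comp SS (simple2 D s s) Pc)"
    using path_Fwd[OF na(1), of ?W] s_weak[OF Ps_pp_weak]
    by (simp add: is_zigzag_def pq fun_comp_assoc[OF ZZ] fun_comp_assoc[OF Pcf])
  have pb: "cell SS D E ?ssZ ?b (fun_comp SS (simple2 D s s) (const_s SS))"
    using path_Fwd[OF na(2), of ?W] by (simp add: pq fun_comp_assoc[OF ZZ] fun_comp_assoc[OF cSf])
  have nd: "is_nat_trans SS D (?s (whisk_left SS (diagonal D) pp))"
      "is_nat_trans SS D (?s (whisk_left SS (diagonal D) qq))"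
    by (intro nat_whisk_left[OF S _ s_fun] nat_whisk_left[OF S _ diag_fn] pq)+
  have pD: "cell SS D E ?sDZ ?Da s" "cell SS D E ?sDZ ?Db s"
    using path_Fwd[OF nd(1), of ?W] path_Fwd[OF nd(2), of ?W] id1
    by (simp_all add: pq fun_comp_assoc[OF ZZ] fun_comp_assoc[OF Pcf] fun_comp_assoc[OF cSf])
  have A: "nat_eq SS D E ?sDZ s (m @ ?a @ l) ?Da"
  proof -
    have "nat_eq SS D E ?sDZ s ((m @ ?a) @ l) ((?Da @ WR SS Pc mu) @ l)"
      using loc_right[OF loc_eq.sym[OF mu_natural[OF pq(1)], unfolded pq(2,3)]] zl
        unfolding m_def is_zigzag_def by blast
    moreover have "nat_eq SS D E ?sDZ s (?Da @ (WR SS Pc mu @ l)) (?Da @ [])"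
      using loc_left[OF pD(1) S3_inner] unfolding l_def by (simp add: step.map_comp o_def)
    ultimately show ?thesis by simp (blast intro: loc_eq.trans)
  qed
  have Bq: "nat_eq SS D E ?sDZ s (m @ ?b @ n) ?Db"
  proof -
    have "nat_eq SS D E ?sDZ s ((m @ ?b) @ n) ((?Db @ WR SS (const_s SS) mu) @ n)"
      using loc_right[OF loc_eq.sym[OF mu_natural[OF pq(4)], unfolded pq(5,6)]] zn
        unfolding m_def is_zigzag_def by blast
    moreover have "nat_eq SS D E ?sDZ s (?Db @ (WR SS (const_s SS) mu @ n)) (?Db @ [])"
      using loc_left[OF pD(2) S3_outer] unfolding n_def by simp
    ultimately show ?thesis by simp (blast intro: loc_eq.trans)
  qed
  have "nat_eq SS D E (fun_comp SS s (dpre diag_join)) (fun_comp SS s (dpre (id_fun delta_op)))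
      ?Da ?Db"
    unfolding diagonal_pq
    by (rule s_homotopy[OF functor_diag_join functor_id[OF J] homotopy_diag_join
        nat_diag_join_pr1(1-3) _ nat_diag_join_pr2(1-3)])
      (simp_all only: diag_htpy_ends nat_diag_join_pr1 nat_diag_join_pr2)
  then have "nat_eq SS D E ?sDZ s ?Da ?Db"
    by (simp add: pre_id fun_comp_id[OF S is_cat s_fun] diagonal_dec[OF functor_join_fun, folded
        diag_join_def, symmetric] fun_comp_assoc[OF ZZ])
  from loc_eq.trans[OF A loc_eq.trans[OF this loc_eq.sym[OF Bq]]]
  have AB: "nat_eq SS D E ?sDZ s (m @ (?a @ l)) (m @ (?b @ n))" .
  have zal: "nat_zigzag SS D E ?ssZ (?a @ l) s" by (rule zigzag_append[OF za zl])
  have pbn: "cell SS D E ?ssZ (?b @ n) s" using path_append[OF pb, of n s] zn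
      unfolding is_zigzag_def by blast
  note ial = zigzag_inv[OF C zal, THEN conjunct2]
  have pal: "cell SS D E ?ssZ (?a @ l) s" using zal unfolding is_zigzag_def ..
  have "nat_eq SS D E ?ssZ s (?b @ n) (?a @ l)"
    by (rule loc_eq.sym[OF inv_paths_cancel[OF zigzag_inv[OF C zm, THEN conjunct2] pal pbn AB]])
  moreover have "cell SS D E s (inv_path (?a @ l)) ?ssZ"
    and z: "nat_eq SS D E s s (inv_path (?a @ l) @ (?a @ l)) []"
    using ial unfolding inv_paths_def by blast+
  ultimately have "nat_eq SS D E s s (inv_path (?a @ l) @ (?b @ n)) (inv_path (?a @ l) @ (?a @ l))"
    by (intro loc_left)
  from loc_eq.trans[OF this z] have "nat_eq SS D E s s (inv_path (?a @ l) @ (?b @ n)) []" .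
  moreover have "WL SS s eta @ WR SS s lam = inv_path (?a @ l) @ (?b @ n)"
    by (simp only: eta_def eta0_def l_def n_def map_inv_path map_append inv_path_simps list.map
        step.map append_assoc)
  ultimately show ?thesis by simp
qed

text \<open>On constant objects \<open>p\<close> and \<open>q\<close> coincide and cancel, so that \<open>eta\<close> restricts to \<open>c(\<lambda>)\<^sup>-\<^sup>1\<close>.\<close>

lemma triangle_c: "nat_eq D SS SE (const_s D) (const_s D) (WR D (const_s D) eta
    @ WL D (const_s D) lam) []"
proof -
  let ?F = "fun_cat D SS" and ?W = "objectwise D SS SE"
  note c = rel_functorD[OF c_rel]
  have C: "category ?F" by (rule category_fun_cat[OF is_cat S])
  let ?l = "WL D (const_s D) lam"
  have zl: "nat_zigzag D SS SE (fun_comp D (const_s D) (fun_comp D s (const_s D))) ?l (const_s D)"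
    using rel_map_zigzag[OF rel_map_WL[OF is_cat c_rel] S3]
        by (simp add: fun_comp_id[OF is_cat S c])
  have e: "WR D (const_s D) (PN delta_op D lam) = ?l"
    using path_map_cong[OF lam_cell, of "\<lambda>\<alpha>. whisk_right D (post_nt delta_op D \<alpha>) (const_s D)"
        "whisk_left D (const_s D)"]
    by (simp add: step.map_comp o_def fun_cat_simps post_nt_diag_fun[OF J is_cat])
  let ?x = "whisk_right D (whisk_left SS Ps pp) (const_s D)"
  have q: "whisk_right D (whisk_left SS Ps qq) (const_s D) = ?x"
    by (simp only: whisk_left_right[OF c, symmetric] pq_const)
  have x: "?x \<in> ?W"
    using Ps_pp_weak rel_map_WR[OF is_cat c, of SS SE] unfolding rel_map_def by blast
  then have nx: "is_nat_trans D SS ?x" by (simp add: objectwise_iff)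
  have tx: "tgt ?x = fun_comp D (const_s D) (fun_comp D s (const_s D))"
    using q Ps_qq(3) whisk_right_simps(2)[of D "whisk_left SS Ps qq" "const_s D"]
    by (simp add: fun_comp_assoc[OF c] Ps_qq del: whisk_right_simps whisk_left_simps)
  have "loc_eq ?F ?W (tgt ?x) (tgt ?x) [Bwd ?x, Fwd ?x] []"
    by (rule loc_eq.inv_left[where a = "src ?x"]) (use nx x in \<open>simp_all add: hom_fun_cat del:
        whisk_right_simps\<close>)
  then have "loc_eq ?F ?W (const_s D) (const_s D) (inv_path ?l @ [Bwd ?x, Fwd ?x]
      @ ?l) (inv_path ?l @ [] @ ?l)"
    unfolding tx using zigzag_inv[OF C zl] by (intro loc_ctx) (auto simp: inv_paths_def)
  moreover have "loc_eq ?F ?W (const_s D) (const_s D) (inv_path ?l @ ?l) []"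
    using zigzag_inv[OF C zl] by (simp add: inv_paths_def)
  moreover have "WR D (const_s D) eta = inv_path ?l @ [Bwd ?x, Fwd ?x]"
    by (simp add: eta_def eta0_def map_inv_path e q del: map_map)
  ultimately show ?thesis by simp (blast intro: loc_eq.trans)
qed

lemma adj: "half_adj SS SE D E s (const_s D) lam eta"
  unfolding half_adj_def
  using S is_cat objectwise_ar E_ar s_rel c_rel lam_cell eta triangle_s by blast

end

section \<open>Comparison of two descent structures\<close>

context relative_category_coprod
begin

lemma star_eq: "star D s s' \<psi> = WR BB (post delta_op SS s) \<psi> @ WL BB s' (PN delta_op SS \<psi>)"
  by (simp add: star_def step.map_comp o_def)

text \<open>Both sides are 2-cells \<open>s D \<Rightarrow> s's'\<close>, and \<open>s's'\<close> is left adjoint to the functor sending an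
  object to the constant bisimplicial object. By \<open>adj_unique\<close> they may be compared after
  restriction along that functor and composition with the counit \<open>?e\<close>; both then become \<open>lam\<close>.\<close>

lemma mu_compatible:
  assumes "simplicial_descent_structure D E s mu lam"
    and "simplicial_descent_structure D E s' mu' lam'"
    and \<psi>: "cell SS D E s \<psi> s'" and lam: "compatible_lam D E s lam lam' \<psi>"
  shows "compatible_mu D E s mu s' mu' \<psi>"
proof -
  interpret X: simplicial_descent_structure D E s mu lam by fact
  interpret Y: simplicial_descent_structure D E s' mu' lam' by fact
  note c = rel_functorD[OF c_rel] and Pcf = rel_functorD[OF Pc_rel] and dg
      = rel_functorD[OF diagonal_rel]
  note Xs = rel_functorD[OF X.Ps_rel] and Ys = rel_functorD[OF Y.Ps_rel]
  let ?c = "const_s D" and ?R = "fun_comp D Pc (const_s D)"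
  let ?L = "PN delta_op D lam" and ?L' = "PN delta_op D lam'"
  have R: "is_functor D BB ?R" by (rule functor_fun_comp[OF is_cat c Pcf])
  have lam: "nat_eq D D E (fun_comp D s ?c) (id_fun D) (WR D ?c \<psi> @ lam') lam"
    using lam by (simp add: compatible_lam_def)
  have mu: "cell BB D E (simple_diag D s) mu (simple2 D s s)"
    and mu': "cell BB D E (simple_diag D s') mu' (simple2 D s' s')"
    using X.S2 Y.S2 by (auto simp: is_zigzag_def)
  have a: "cell BB D E (simple_diag D s) (WR BB (diagonal D) \<psi> @ mu') (simple2 D s' s')"
    using path_append[OF cell_WR[OF B dg \<psi>] mu'] .
  have b: "cell BB D E (simple_diag D s) (mu @ star D s s' \<psi>) (simple2 D s' s')"
    unfolding star_eq
    by (intro path_append[OF mu] path_append[OF cell_WR[OF B Xs \<psi>]] cell_WL[OF B Y.s_rel]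
        cell_PN[OF J S is_cat \<psi>])
  note adj2 = half_adj_comp[OF half_adj_post[OF J Y.adj] Y.adj]
  let ?e = "WL D s' (WR D ?c ?L') @ lam'"
  have dR: "fun_comp D (diagonal D) ?R = ?c"
    by (simp add: fun_comp_assoc[OF c] diagonal_post_const fun_comp_id[OF is_cat S c])
  have c\<psi>: "cell D D E (fun_comp D s ?c) (WR D ?c \<psi>) (fun_comp D s' ?c)"
    by (rule cell_WR[OF is_cat c \<psi>])
  have inner: "nat_eq SS D E s s (WR SS Pc mu @ WL SS s ?L) []"
    and inner': "nat_eq SS D E s' s' (WR SS Pc mu' @ WL SS s' ?L') []"
    using X.S3_inner Y.S3_inner by (simp_all add: step.map_comp o_def)
  \<comment> \<open>The diagonal of a constant bisimplicial object is constant, and \<open>\<mu>'\<close> cancels against \<open>s'(\<lambda>')\<close>.\<close>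
  have left: "nat_eq D D E (fun_comp D s ?c) (id_fun D) (WR D ?R (WR BB (diagonal D) \<psi> @ mu')
      @ ?e) lam"
  proof -
    have "WR D ?R (WR BB (diagonal D) \<psi> @ mu') @ ?e
        = WR D ?c \<psi> @ WR D ?c (WR SS Pc mu' @ WL SS s' ?L') @ lam'"
      by (simp only: map_append append_assoc WR_WR[OF R] WR_WR[OF c] WL_WR[OF c] dR)
    also have "nat_eq D D E (fun_comp D s ?c) (id_fun D) \<dots> (WR D ?c \<psi> @ WR D ?c [] @ lam')"
      by (rule loc_ctx[OF c\<psi> eq_WR[OF is_cat c inner'] Y.lam_cell])
    finally show ?thesis using loc_eq.trans[OF _ lam] by simp
  qed
  \<comment> \<open>The inner \<open>\<psi>\<close> turns \<open>\<lambda>'\<close> into \<open>\<lambda>\<close>, interchange moves the outer one to the end, and \<open>\<mu>\<close>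
      cancels against
    \<open>s(\<lambda>)\<close>.\<close>
  have right: "nat_eq D D E (fun_comp D s ?c) (id_fun D) (WR D ?R (mu @ star D s s' \<psi>) @ ?e) lam"
  proof -
    let ?PQ = "fun_comp SS X.Ps Pc" and ?m = "WR D ?c (WR SS Pc mu)"
    have PQ: "post delta_op D (fun_comp D s ?c) = ?PQ"
      by (rule post_fun_comp[OF J is_cat c X.s_fun])
    have m: "cell D D E (fun_comp D s ?c) ?m (fun_comp D s (fun_comp D ?PQ ?c))"
      using cell_WR[OF is_cat R mu]
      by (simp add: WR_WR[OF c] fun_comp_assoc[OF R, symmetric] dR del: map_map)
        (simp add: fun_comp_assoc[OF c])
    have L: "cell D SS SE (fun_comp D ?PQ ?c) (WR D ?c ?L) ?c"
      using cell_WR[OF is_cat c cell_PN[OF J is_cat is_cat X.lam_cell]]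
      by (simp add: PQ post_id[OF J is_cat] fun_comp_id[OF is_cat S c] del: map_map)
    have q: "cell D D E (fun_comp D s (fun_comp D ?PQ ?c)) (WR D (fun_comp D ?PQ ?c) \<psi>)
        (fun_comp D s' (fun_comp D ?PQ ?c))"
      by (rule cell_WR[OF is_cat path_ob(1)[OF category_fun_cat[OF is_cat S] L, unfolded
        fun_cat_simps mem_Collect_eq] \<psi>])
    have "WR D ?R (mu @ star D s s' \<psi>) @ ?e
      = ?m @ WR D (fun_comp D X.Ps ?R) \<psi> @ WL D s' (WR D ?c (WR SS Pc (PN delta_op SS \<psi>) @ ?L'))
        @ lam'"
      unfolding star_eq
      by (simp only: map_append append_assoc WR_WR[OF R] WR_WR[OF c] WL_WR[OF c] WL_WR[OF R])
    also have "\<dots> = (?m @ WR D (fun_comp D ?PQ ?c) \<psi>) @ WL D s' (WR D ?c (PN delta_op D (WR D ?c \<psi>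
        @ lam'))) @ lam'"
      by (simp only: map_append append_assoc PN_WR[OF J is_cat c \<psi>] fun_comp_assoc[OF c])
    finally have start: "WR D ?R (mu @ star D s s' \<psi>) @ ?e
      = (?m @ WR D (fun_comp D ?PQ ?c) \<psi>) @ WL D s' (WR D ?c (PN delta_op D (WR D ?c \<psi> @ lam')))
        @ lam'" .
    have "nat_eq D D E (fun_comp D s ?c) (id_fun D)
      ((?m @ WR D (fun_comp D ?PQ ?c) \<psi>) @ WL D s' (WR D ?c (PN delta_op D (WR D ?c \<psi> @ lam')))
        @ lam')
      ((?m @ WR D (fun_comp D ?PQ ?c) \<psi>) @ WL D s' (WR D ?c ?L) @ lam')"
    proof (rule loc_ctx[OF path_append[OF m q] _ Y.lam_cell])
      show "nat_eq D D E (fun_comp D s' (fun_comp D ?PQ ?c)) (fun_comp D s' ?c)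
         (WL D s' (WR D ?c (PN delta_op D (WR D ?c \<psi> @ lam')))) (WL D s' (WR D ?c ?L))"
        using eq_WL[OF is_cat Y.s_rel eq_WR[OF is_cat c eq_PN[OF J is_cat is_cat lam]]]
        by (simp only: PQ post_id[OF J is_cat] fun_comp_id[OF is_cat S c])
    qed
    also have "nat_eq D D E (fun_comp D s ?c) (id_fun D)
      ((?m @ WR D (fun_comp D ?PQ ?c) \<psi>) @ WL D s' (WR D ?c ?L) @ lam')
      (WR D ?c (WR SS Pc mu @ WL SS s ?L) @ WR D ?c \<psi> @ lam')"
    proof -
      have "nat_eq D D E (fun_comp D s (fun_comp D ?PQ ?c)) (fun_comp D s' ?c)
          (WR D (fun_comp D ?PQ ?c) \<psi> @ WL D s' (WR D ?c ?L)) (WL D s (WR D ?c ?L) @ WR D ?c \<psi>)"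
        by (rule loc_eq.sym, rule interchange) (fact is_cat S X.s_rel Y.s_rel L \<psi>)+
      from loc_ctx[OF m this Y.lam_cell] show ?thesis
        by (simp only: map_append append_assoc WL_WR[OF c])
    qed
    also have "nat_eq D D E (fun_comp D s ?c) (id_fun D)
      (WR D ?c (WR SS Pc mu @ WL SS s ?L) @ WR D ?c \<psi> @ lam') (WR D ?c [] @ lam)"
      by (rule loc_eq.append[OF eq_WR[OF is_cat c inner] lam])
    finally show ?thesis unfolding start by simp
  qed
  have "nat_eq D D E (fun_comp D (simple_diag D s) ?R) (id_fun D)
      (WR D ?R (WR BB (diagonal D) \<psi> @ mu') @ ?e) (WR D ?R (mu @ star D s s' \<psi>) @ ?e)"
    using loc_eq.trans[OF left loc_eq.sym[OF right]]
    by (simp only: fun_comp_assoc[OF R, symmetric] dR)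
  from adj_unique[OF adj2 X.sD_rel a b this] show ?thesis
    unfolding compatible_mu_def .
qed

end

theorem corollary5p2:
  fixes D :: "('o, 'm) cat" and E :: "'m set"
    and s s' :: "(('o, 'm) sob, ('o, 'm) sar, 'o, 'm) func"
    and mu mu' :: "(('o, 'm) ssob, ('o, 'm) ssar, 'o, 'm) nt step list"
    and lam lam' :: "('o, 'm, 'o, 'm) nt step list"
  assumes "relative_category_coprod D E"
    and "simplicial_descent_structure D E s mu lam"
    and "simplicial_descent_structure D E s' mu' lam'"
  shows "\<exists>!\<Psi>. \<exists>\<psi>. nat_zigzag (simp_cat D) D E s \<psi> s'
    \<and> compatible_lam D E s lam lam' \<psi>
    \<and> compatible_mu D E s mu s' mu' \<psi>
    \<and> \<Psi> = nat_mor (simp_cat D) D E s s' \<psi>"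
proof -
  interpret relative_category_coprod D E by fact
  interpret X: simplicial_descent_structure D E s mu lam by fact
  interpret Y: simplicial_descent_structure D E s' mu' lam' by fact
  let ?F = "fun_cat SS D" and ?W = "objectwise SS D E"
  have C: "category ?F" by (rule category_fun_cat[OF S is_cat])
  define \<psi> where "\<psi> = WL SS s Y.eta @ WR SS s' lam"
  note m = mate_compatible[OF Y.adj X.s_rel X.lam_cell Y.triangle_c, folded \<psi>_def]
  have lam: "compatible_lam D E s lam lam' \<psi>"
    using m(2) by (simp add: compatible_lam_def)
  have zz: "nat_zigzag SS D E s \<psi> s'"
  proof -
    let ?\<alpha> = "whisk_left SS Y.Ps qq" and ?x = "whisk_left SS s (whisk_left SS Y.Ps qq)"
    have z1: "nat_zigzag SS D E s (WL SS s Y.eta0) (fun_comp SS s (fun_comp SS Y.Ps ZZ))"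
      using rel_map_zigzag[OF rel_map_WL[OF S X.s_rel] Y.eta0]
      by (simp only: fun_comp_id[OF S is_cat X.s_fun])
    have z2: "nat_zigzag SS D E (fun_comp SS s (fun_comp SS (const_s D) s')) (WR SS s' lam) s'"
      using rel_map_zigzag[OF rel_map_WR[OF S Y.s_fun] X.S3]
      by (simp only: fun_comp_id[OF S is_cat Y.s_fun] fun_comp_assoc[OF Y.s_fun])
    have nx: "is_nat_trans SS D ?x" by (rule nat_whisk_left[OF S Y.Ps_qq(1) X.s_fun])
    have st: "src ?x = fun_comp SS s (fun_comp SS Y.Ps ZZ)"
      "tgt ?x = fun_comp SS s (fun_comp SS (const_s D) s')"
      by (simp_all only: whisk_left_simps Y.Ps_qq[unfolded whisk_left_simps])
    have px: "is_path ?F ?W (src ?x) [Fwd ?x] (tgt ?x)" by (rule path_Fwd[OF nx])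
    have \<psi>: "\<psi> = WL SS s Y.eta0 @ [Fwd ?x] @ WR SS s' lam"
      by (simp add: \<psi>_def Y.eta_def)
    note i = mate_invertible[OF X.adj Y.adj X.triangle_c Y.triangle_c, folded \<psi>_def, unfolded \<psi>]
    \<comment> \<open>The only step of \<open>\<psi>\<close> that is not a weak equivalence
        by construction; it is invertible because \<open>\<psi>\<close> is.\<close>
    have "?x \<in> ?W"
      by (rule in_objectwise[OF nx inv_paths_factor[OF C
            zigzag_inv[OF C z1, THEN conjunct2, folded st] zigzag_inv[OF C z2, THEN conjunct2,
              folded st] px i]])
    then have "nat_zigzag SS D E (src ?x) [Fwd ?x] (tgt ?x)"
      using px by (simp add: is_zigzag_def del: is_path.simps)
    then show ?thesis unfolding \<psi> using z1 z2 unfolding st[symmetric]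
        by (blast intro: zigzag_append)
  qed
  have uniq: "nat_eq SS D E s s' \<phi> \<psi>"
    if "nat_zigzag SS D E s \<phi> s'" "compatible_lam D E s lam lam' \<phi>" for \<phi>
  proof (rule adj_unique[OF Y.adj X.s_rel _ m(1)])
    show "cell SS D E s \<phi> s'" using that(1) by (simp add: is_zigzag_def)
    show "nat_eq D D E (fun_comp D s (const_s D)) (id_fun D)
        (WR D (const_s D) \<phi> @ lam') (WR D (const_s D) \<psi> @ lam')"
      using that(2) lam unfolding compatible_lam_def by (rule loc_eq.trans[OF _ loc_eq.sym])
  qed
  show ?thesis
  proof (rule ex1I[of _ "nat_mor SS D E s s' \<psi>"])
    show "\<exists>\<phi>. nat_zigzag SS D E s \<phi> s' \<and> compatible_lam D E s lam lam' \<phi>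
        \<and> compatible_mu D E s mu s' mu' \<phi> \<and> nat_mor SS D E s s' \<psi> = nat_mor SS D E s s' \<phi>"
      using zz lam mu_compatible[OF assms(2,3) m(1) lam] by blast
  next
    fix \<Psi> assume "\<exists>\<phi>. nat_zigzag SS D E s \<phi> s' \<and> compatible_lam D E s lam lam' \<phi>
        \<and> compatible_mu D E s mu s' mu' \<phi> \<and> \<Psi> = nat_mor SS D E s s' \<phi>"
    then show "\<Psi> = nat_mor SS D E s s' \<psi>" using uniq loc_mor_eq by metis
  qed
qed

end
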